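(* Let $\alpha>0$ and let $\mu$ be a probability measure on $[0,\infty)$ such that the limit $$\rho := \lim_{x\to \infty} -\frac{ \ln \mu ([x , \infty)) }{x}$$ exists and $\rho\in (0, \alpha)$. For $t>0$ let $\nu_t$ be the probability measure on $[0,\infty)$ with cumulative distribution function $$F_{\nu_t}(z) = C_t \int_{[0,zt]} e^{-x^2/(2t)} e^{\alpha x}\, d \mu(x),\qquad z\ge 0,$$ where $C_t$ is the normalization constant. Then $$\lim_{t \to \infty} \nu_t = \delta_{\alpha - \rho}$$ in distribution, and moreover $$\lim_{t \to \infty} P_\mu (X_t \in \cdot \mid \tau > t) = \pi_{\alpha - \rho}$$ in distribution.
   Context: $X=(X_t:t\ge 0)$ is Brownian motion with constant negative drift $-\alpha$ ($\alpha>0$) on $[0,\infty)$, absorbed at $0$; that is, $X_t=X_0+B_t-\alpha t$ up to the hitting time $\tau=\inf\{t\ge 0: X_t=0\}$, with $B$ a standard Brownian motion started at $0$ and independent of $X_0$, and $X_t=0$ for $t\ge\tau$. $P_\mu$ denotes the law of the process when $X_0$ has distribution $\mu$. $\delta_a$ is the point mass at $a$. For $\gamma\in(0,\alpha)$, $\pi_\gamma$ is the probability measure on $(0,\infty)$ with density $\frac{\alpha^2-\gamma^2}{\gamma } e^{-\alpha x} \sinh(\gamma x)$. *)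

theory Defs
  imports "HOL-Probability.Probability"
begin

section \<open>Weak convergence along a filter\<close>

text \<open>The library's \<^const>\<open>weak_conv_m\<close> is restricted to sequences; here the time parameter is real.\<close>

definition weak_conv_m_along :: "('i \<Rightarrow> real measure) \<Rightarrow> real measure \<Rightarrow> 'i filter \<Rightarrow> bool" where
  "weak_conv_m_along N L F \<longleftrightarrow>
     (\<forall>x. isCont (cdf L) x \<longrightarrow> ((\<lambda>i. cdf (N i) x) \<longlongrightarrow> cdf L x) F)"

lemma weak_conv_m_along_sequentially:
  "weak_conv_m_along N L sequentially \<longleftrightarrow> weak_conv_m N L"
  by (simp add: weak_conv_m_along_def weak_conv_m_def weak_conv_def)


section \<open>Brownian motion with negative drift, absorbed at 0\<close>

text \<open>Paths are indexed by \<^typ>\<open>real\<close>, but only times \<open>t \<ge> 0\<close> are constrained or used.\<close>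

definition standard_brownian_motion :: "'a measure \<Rightarrow> (real \<Rightarrow> 'a \<Rightarrow> real) \<Rightarrow> bool" where
  "standard_brownian_motion M B \<longleftrightarrow>
     prob_space M \<and>
     (\<forall>t\<ge>0. B t \<in> borel_measurable M) \<and>
     (\<forall>\<omega>\<in>space M. B 0 \<omega> = 0) \<and>
     (\<forall>\<omega>\<in>space M. continuous_on {0..} (\<lambda>t. B t \<omega>)) \<and>
     (\<forall>s t. 0 \<le> s \<longrightarrow> s < t \<longrightarrow>
        distributed M lborel (\<lambda>\<omega>. B t \<omega> - B s \<omega>) (normal_density 0 (sqrt (t - s)))) \<and>
     (\<forall>(n::nat) t. 0 \<le> t 0 \<longrightarrow> (\<forall>i<n. t i \<le> t (Suc i)) \<longrightarrow>
        prob_space.indep_vars M (\<lambda>_. borel) (\<lambda>i \<omega>. B (t (Suc i)) \<omega> - B (t i) \<omega>) {..<n})"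

text \<open>Independence of the initial value from the whole path of \<open>B\<close>, regarded as a random element
  of the product space over the time set \<open>{0..}\<close>. The library's \<open>indep_var\<close> requires both
  variables to have the same type, so independence is stated for the generated sigma-algebras.\<close>

definition brownian_with_initial_law ::
    "real measure \<Rightarrow> 'a measure \<Rightarrow> ('a \<Rightarrow> real) \<Rightarrow> (real \<Rightarrow> 'a \<Rightarrow> real) \<Rightarrow> bool" where
  "brownian_with_initial_law \<mu> M X0 B \<longleftrightarrow>
     standard_brownian_motion M B \<and>
     X0 \<in> borel_measurable M \<and>
     distr M borel X0 = \<mu> \<and>
     prob_space.indep_set M
       (sets (vimage_algebra (space M) X0 borel))
       (sets (vimage_algebra (space M) (\<lambda>\<omega>. \<lambda>t\<in>{0..}. B t \<omega>) (PiM {0..} (\<lambda>_. borel))))"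

definition drifted_path :: "real \<Rightarrow> ('a \<Rightarrow> real) \<Rightarrow> (real \<Rightarrow> 'a \<Rightarrow> real) \<Rightarrow> real \<Rightarrow> 'a \<Rightarrow> real" where
  "drifted_path \<alpha> X0 B t \<omega> = X0 \<omega> + B t \<omega> - \<alpha> * t"

text \<open>The infimum is taken in \<^typ>\<open>ereal\<close>, so the hitting time is infinite if 0 is never hit.\<close>

definition hitting_time :: "real \<Rightarrow> ('a \<Rightarrow> real) \<Rightarrow> (real \<Rightarrow> 'a \<Rightarrow> real) \<Rightarrow> 'a \<Rightarrow> ereal" where
  "hitting_time \<alpha> X0 B \<omega> = Inf (ereal ` {t. 0 \<le> t \<and> drifted_path \<alpha> X0 B t \<omega> = 0})"

definition absorbed_process ::
    "real \<Rightarrow> ('a \<Rightarrow> real) \<Rightarrow> (real \<Rightarrow> 'a \<Rightarrow> real) \<Rightarrow> real \<Rightarrow> 'a \<Rightarrow> real" where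
  "absorbed_process \<alpha> X0 B t \<omega> =
     (if ereal t < hitting_time \<alpha> X0 B \<omega> then drifted_path \<alpha> X0 B t \<omega> else 0)"

definition conditional_law ::
    "real \<Rightarrow> 'a measure \<Rightarrow> ('a \<Rightarrow> real) \<Rightarrow> (real \<Rightarrow> 'a \<Rightarrow> real) \<Rightarrow> real \<Rightarrow> real measure" where
  "conditional_law \<alpha> M X0 B t =
     distr (uniform_measure M {\<omega>\<in>space M. ereal t < hitting_time \<alpha> X0 B \<omega>}) borel
       (absorbed_process \<alpha> X0 B t)"


section \<open>The limiting quasi-stationary distributions\<close>

definition qsd :: "real \<Rightarrow> real \<Rightarrow> real measure" where
  "qsd \<alpha> \<gamma> = density lborel (\<lambda>x. ennreal
     (indicator {0<..} x * ((\<alpha>\<^sup>2 - \<gamma>\<^sup>2) / \<gamma> * exp (- \<alpha> * x) * sinh (\<gamma> * x))))"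


section \<open>The tilted and rescaled initial distributions\<close>

definition tilt_weight :: "real \<Rightarrow> real \<Rightarrow> real \<Rightarrow> real" where
  "tilt_weight \<alpha> t x = exp (- x\<^sup>2 / (2 * t)) * exp (\<alpha> * x)"

definition tilt_const :: "real \<Rightarrow> real measure \<Rightarrow> real \<Rightarrow> real" where
  "tilt_const \<alpha> \<mu> t = 1 / (LINT x:{0..}|\<mu>. tilt_weight \<alpha> t x)"

text \<open>For \<open>z < 0\<close> and \<open>t > 0\<close> the integral is over the empty set, hence the value is 0.\<close>

definition tilted_cdf :: "real \<Rightarrow> real measure \<Rightarrow> real \<Rightarrow> real \<Rightarrow> real" where
  "tilted_cdf \<alpha> \<mu> t z = tilt_const \<alpha> \<mu> t * (LINT x:{0..z * t}|\<mu>. tilt_weight \<alpha> t x)"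

text \<open>\<^const>\<open>interval_measure\<close> yields the Borel measure with a given distribution function; that
  \<open>tilted_cdf\<close> is indeed such a function is shown in the lemmas below.\<close>

definition tilted_law :: "real \<Rightarrow> real measure \<Rightarrow> real \<Rightarrow> real measure" where
  "tilted_law \<alpha> \<mu> t = interval_measure (tilted_cdf \<alpha> \<mu> t)"

lemma tilt_weight_pos: "tilt_weight \<alpha> t x > 0"
  by (simp add: tilt_weight_def)

lemma tilt_weight_le:
  assumes "t > 0"
  shows "tilt_weight \<alpha> t x \<le> exp (\<alpha>\<^sup>2 * t / 2)"
proof -
  have "- x\<^sup>2 / (2 * t) + \<alpha> * x = \<alpha>\<^sup>2 * t / 2 - (x - \<alpha> * t)\<^sup>2 / (2 * t)"
    using assms by (simp add: field_simps power2_eq_square)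
  also have "\<dots> \<le> \<alpha>\<^sup>2 * t / 2" using assms by simp
  finally show ?thesis
    unfolding tilt_weight_def exp_add[symmetric] by simp
qed

lemma tilted_law_aux:
  assumes "real_distribution \<mu>" "AE x in \<mu>. 0 \<le> x" "t > 0"
  obtains N where "real_distribution N" "cdf N = tilted_cdf \<alpha> \<mu> t"
proof -
  interpret real_distribution \<mu> by fact
  let ?w = "tilt_weight \<alpha> t"
  define Z where "Z = (LINT x|\<mu>. ?w x)"
  have meas: "?w \<in> borel_measurable borel"
    unfolding tilt_weight_def by measurable
  have int: "integrable \<mu> ?w"
    by (rule integrable_const_bound[where B = "exp (\<alpha>\<^sup>2 * t / 2)"])
       (use tilt_weight_le[OF assms(3), of \<alpha>] tilt_weight_pos[of \<alpha> t] meas in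
         \<open>auto simp: abs_of_pos\<close>)
  have Z_eq: "(LINT x:{0..}|\<mu>. ?w x) = Z"
    unfolding Z_def set_lebesgue_integral_def
    by (rule integral_cong_AE) (use assms(2) meas in \<open>auto simp: indicator_def\<close>)
  have "Z \<noteq> 0"
  proof
    assume "Z = 0"
    hence "AE x in \<mu>. ?w x = 0"
      using integral_nonneg_eq_0_iff_AE[OF int] tilt_weight_pos[of \<alpha> t]
      unfolding Z_def by (simp add: less_imp_le)
    hence "AE x in \<mu>. False"
      using tilt_weight_pos[of \<alpha> t] by (simp add: less_imp_neq[symmetric])
    thus False by simp
  qed
  moreover have "Z \<ge> 0"
    unfolding Z_def using tilt_weight_pos[of \<alpha> t] by (simp add: less_imp_le)
  ultimately have Z: "Z > 0" by simp
  define D where "D = density \<mu> (\<lambda>x. ennreal (?w x / Z))"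
  have nn: "0 \<le> ?w x / Z" for x
    using Z tilt_weight_pos[of \<alpha> t x] by simp
  have emD: "emeasure D A = ennreal ((LINT x:A|\<mu>. ?w x) / Z)" if A: "A \<in> sets borel" for A
  proof -
    have "emeasure D A = (\<integral>\<^sup>+x. ennreal (?w x / Z) * indicator A x \<partial>\<mu>)"
      unfolding D_def using A meas by (subst emeasure_density) auto
    also have "\<dots> = (\<integral>\<^sup>+x. ennreal (indicator A x * ?w x / Z) \<partial>\<mu>)"
      by (intro nn_integral_cong) (auto simp: indicator_def)
    also have "\<dots> = ennreal (LINT x|\<mu>. indicator A x * ?w x / Z)"
    proof (rule nn_integral_eq_integral)
      have "integrable \<mu> (\<lambda>x. indicator A x *\<^sub>R ?w x)"
        using A by (intro integrable_mult_indicator int) simp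
      thus "integrable \<mu> (\<lambda>x. indicator A x * ?w x / Z)" by simp
      show "AE x in \<mu>. 0 \<le> indicator A x * ?w x / Z"
        using nn by (simp add: indicator_def)
    qed
    finally show ?thesis by (simp add: set_lebesgue_integral_def)
  qed
  have setsD: "sets D = sets borel" by (simp add: D_def)
  have "emeasure D (space D) = 1"
    using emD[of UNIV] Z by (simp add: D_def set_lebesgue_integral_def Z_def)
  then interpret D: prob_space D by (rule prob_spaceI)
  define N where "N = distr D borel (\<lambda>x. x / t)"
  have mt: "(\<lambda>x::real. x / t) \<in> borel_measurable D"
    using setsD by (simp cong: measurable_cong_sets)
  have "real_distribution N" unfolding N_def by (rule D.real_distribution_distr) (use mt in simp)
  moreover have "cdf N z = tilted_cdf \<alpha> \<mu> t z" for z
  proof -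
    have "cdf N z = measure D ((\<lambda>x. x / t) -` {..z} \<inter> space D)"
      unfolding cdf_def N_def using mt by (subst measure_distr) auto
    also have "(\<lambda>x. x / t) -` {..z} \<inter> space D = {..z * t}"
      using \<open>t > 0\<close> by (auto simp: D_def field_simps)
    also have "measure D {..z * t} = (LINT x:{..z * t}|\<mu>. ?w x) / Z"
      using emD[of "{..z * t}"] Z tilt_weight_pos[of \<alpha> t]
      by (simp add: measure_def set_lebesgue_integral_def less_imp_le)
    also have "(LINT x:{..z * t}|\<mu>. ?w x) = (LINT x:{0..z * t}|\<mu>. ?w x)"
      unfolding set_lebesgue_integral_def
      by (rule integral_cong_AE) (use assms(2) meas in \<open>auto simp: indicator_def\<close>)
    finally show ?thesis by (simp add: tilted_cdf_def tilt_const_def Z_eq)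
  qed
  ultimately show ?thesis using that by blast
qed

lemma tilted_law_correct:
  assumes "real_distribution \<mu>" "AE x in \<mu>. 0 \<le> x" "t > 0"
  shows real_distribution_tilted_law: "real_distribution (tilted_law \<alpha> \<mu> t)"
    and cdf_tilted_law: "cdf (tilted_law \<alpha> \<mu> t) = tilted_cdf \<alpha> \<mu> t"
proof -
  obtain N where N: "real_distribution N" "cdf N = tilted_cdf \<alpha> \<mu> t"
    using tilted_law_aux[OF assms] .
  interpret real_distribution N by fact
  have "real_distribution (interval_measure (cdf N))"
    by (intro real_distribution_interval_measure cdf_nondecreasing cdf_is_right_cont
        cdf_lim_at_bot cdf_lim_at_top_prob)
  moreover have "cdf (interval_measure (cdf N)) = cdf N"
    by (intro cdf_interval_measure cdf_nondecreasing cdf_is_right_cont cdf_lim_at_bot)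
  ultimately show "real_distribution (tilted_law \<alpha> \<mu> t)"
    and "cdf (tilted_law \<alpha> \<mu> t) = tilted_cdf \<alpha> \<mu> t"
    by (simp_all add: tilted_law_def N(2))
qed

end

theory Submission
  imports Defs
begin

text \<open>Write \<open>\<gamma> = \<alpha> - \<rho>\<close>. By reflection and Girsanov, the probability
  that the drifted path started at \<open>x \<ge> 0\<close> stays positive up to time
  \<open>t\<close> and ends above \<open>a \<ge> 0\<close> is the explicit
  \<open>killed_tail\<close>, which factorises as \<open>sqrt (2 / (\<pi> t)) * exp (- (x -
  \<alpha> t)^2 / (2 t)) * reflected_mass\<close>. The middle factor is, up to a constant
  depending on \<open>t\<close> only, the weight that defines the tilted laws, and the last
  factor depends on \<open>x\<close> only through \<open>x / t\<close>. So the conditional law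
  of \<open>X_t\<close> is governed by where \<open>x / t\<close> lives under the tilted law.

  Concentration. A starting point near \<open>z t\<close> has initial probability about \<open>exp
  (- \<rho> z t)\<close> and weight about \<open>exp (- t (\<alpha> - z)^2 / 2)\<close>. The
  exponent \<open>(\<alpha> - z)^2 / 2 + \<rho> z\<close> has its unique minimum at \<open>z =
  \<gamma>\<close>, so the tilted laws concentrate there. The upper bound away from
  \<open>\<gamma>\<close> (\<open>far_weight_upper\<close>) replaces the quadratic by a tangent
  line and uses exponential moments of order below \<open>\<rho>\<close>; the lower bound
  (\<open>total_weight_lower\<close>) only counts the mass between \<open>\<gamma> t\<close> and
  \<open>\<alpha> t\<close>.

  Limit of the conditional law. Weak convergence of the tilted laws alone is not enough, because
  \<open>reflected_mass\<close> is unbounded in \<open>x / t\<close> as \<open>t\<close> grows.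
  The far part is therefore estimated directly by the Chernoff bound for
  \<open>killed_tail\<close>, with the same exponent truncated at \<open>z = \<alpha>\<close>,
  and on the near part \<open>reflected_mass\<close> is monotone in \<open>x / t\<close> and
  converges to \<open>limit_mass\<close>. Up to normalisation this is the tail of the
  quasi-stationary law (\<open>scaled_survival_tendsto\<close>, \<open>cdf_qsd\<close>).

  The survival probability is identified with \<open>killed_tail\<close> in
  \<open>positive_path_prob\<close>. Since \<open>killed_tail\<close> is a space-time harmonic
  function of the Gaussian random walk on all of the real line
  (\<open>killed_tail_semigroup\<close>), its expectation along a time grid changes only at the
  first grid point where the path is not positive. There the path has just crossed zero, and
  \<open>killed_tail\<close> vanishes on the boundary, uniformly in the remaining time if
  \<open>a > 0\<close>. Hence the discretisation error tends to 0 with the mesh. Staying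
  positive at the grid points gives only a non-negative path in the limit; the gap to a strictly
  positive path is closed by lowering the starting point by \<open>1 / (j + 1)\<close> and
  letting \<open>j\<close> tend to infinity.\<close>

section \<open>Gaussian tails\<close>

text \<open>The centred normal law of variance \<open>r\<close>. Variance 0 is the point mass, so that
  formulas in the remaining time stay valid at the terminal time.\<close>
definition gauss_law :: "real \<Rightarrow> real measure" where
  "gauss_law r = (if r = 0 then return borel 0
     else density lborel (\<lambda>x. ennreal (normal_density 0 (sqrt r) x)))"

definition gauss_tail :: "real \<Rightarrow> real \<Rightarrow> real" where
  "gauss_tail s u = measure (gauss_law s) {u<..}"

lemma sets_gauss_law [simp, measurable_cong]: "sets (gauss_law r) = sets borel"
  by (simp add: gauss_law_def)

lemma space_gauss_law [simp]: "space (gauss_law r) = UNIV"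
  by (simp add: gauss_law_def)

lemma prob_space_gauss_law: "0 \<le> r \<Longrightarrow> prob_space (gauss_law r)"
  by (auto simp: gauss_law_def prob_space_return intro!: prob_space_normal_density)

lemma gauss_law_convolution:
  assumes "0 \<le> s" "0 < r"
  shows "gauss_law r \<star> gauss_law s = gauss_law (r + s)"
proof (cases "s = 0")
  case True
  interpret R: prob_space "gauss_law r" using assms by (intro prob_space_gauss_law) simp
  show ?thesis
  proof (rule measure_eqI)
    fix A assume "A \<in> sets (gauss_law r \<star> gauss_law s)"
    then have [measurable]: "A \<in> sets borel" by simp
    have "emeasure (gauss_law r \<star> gauss_law s) A = (\<integral>\<^sup>+x. \<integral>\<^sup>+y. indicator A (x + y) \<partial>gauss_law s \<partial>gauss_law r)"
      by (rule convolution_emeasure') (use assms R.finite_measure_axioms in \<open>auto intro!: prob_space.finite_measure prob_space_gauss_law\<close>)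
    also have "\<dots> = (\<integral>\<^sup>+x. indicator A x \<partial>gauss_law r)"
      using True by (intro nn_integral_cong) (simp add: gauss_law_def nn_integral_return)
    finally show "emeasure (gauss_law r \<star> gauss_law s) A = emeasure (gauss_law (r + s)) A"
      using True by simp
  qed simp
next
  case False
  with assms have s: "0 < s" by simp
  have "density lborel (normal_density 0 (sqrt r)) \<star> density lborel (normal_density 0 (sqrt s)) =
      density lborel (\<lambda>x. \<integral>\<^sup>+y. ennreal (normal_density 0 (sqrt r) (x - y)) * ennreal (normal_density 0 (sqrt s) y) \<partial>lborel)"
    using assms s by (intro convolution_density)
      (auto intro!: prob_space.finite_measure prob_space_normal_density)
  also have "(\<lambda>x. \<integral>\<^sup>+y. ennreal (normal_density 0 (sqrt r) (x - y)) * ennreal (normal_density 0 (sqrt s) y) \<partial>lborel)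
     = normal_density 0 (sqrt (r + s))"
    using conv_normal_density_zero_mean[of "sqrt r" "sqrt s"] assms s
    by (simp add: ennreal_mult')
  finally show ?thesis using assms s by (simp add: gauss_law_def)
qed

lemma gauss_tail_nonneg [simp]: "0 \<le> gauss_tail s u"
  by (simp add: gauss_tail_def)

lemma gauss_tail_le_1: "0 \<le> s \<Longrightarrow> gauss_tail s u \<le> 1"
  unfolding gauss_tail_def by (intro prob_space.prob_le_1 prob_space_gauss_law)

lemma gauss_tail_antimono: 
  assumes "0 \<le> s" "u \<le> v" shows "gauss_tail s v \<le> gauss_tail s u"
proof -
  interpret prob_space "gauss_law s" using assms by (intro prob_space_gauss_law) simp
  show ?thesis unfolding gauss_tail_def using assms by (intro finite_measure_mono) auto
qed

lemma measurable_gauss_tail [measurable]: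
  assumes "0 \<le> s" shows "gauss_tail s \<in> borel_measurable borel"
proof -
  have "(\<lambda>u. - gauss_tail s u) \<in> borel_measurable borel"
    by (rule borel_measurable_mono) (use gauss_tail_antimono[OF assms] in \<open>simp add: mono_def\<close>)
  then show ?thesis by simp
qed

lemma gauss_tail_semigroup:
  assumes "0 \<le> s" "0 < r"
  shows "(\<integral>z. gauss_tail s (u - z) \<partial>gauss_law r) = gauss_tail (r + s) u"
proof -
  interpret R: prob_space "gauss_law r" using assms by (intro prob_space_gauss_law) simp
  interpret S: prob_space "gauss_law s" using assms by (intro prob_space_gauss_law) simp
  have [measurable]: "gauss_tail s \<in> borel_measurable borel" using assms by simp
  have "emeasure (gauss_law r \<star> gauss_law s) {u<..} = (\<integral>\<^sup>+z. emeasure (gauss_law s) {y. y + z \<in> {u<..}} \<partial>gauss_law r)"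
    by (rule convolution_emeasure) (use R.finite_measure_axioms S.finite_measure_axioms in auto)
  also have "\<dots> = (\<integral>\<^sup>+z. ennreal (gauss_tail s (u - z)) \<partial>gauss_law r)"
    by (intro nn_integral_cong)
      (auto simp: gauss_tail_def S.emeasure_eq_measure[symmetric] algebra_simps intro!: arg_cong[where f="emeasure _"])
  also have "\<dots> = ennreal (\<integral>z. gauss_tail s (u - z) \<partial>gauss_law r)"
    by (intro nn_integral_eq_integral R.integrable_const_bound[where B=1])
      (use gauss_tail_le_1 assms in \<open>auto\<close>)
  finally show ?thesis
    unfolding gauss_law_convolution[OF assms] gauss_tail_def[of "r+s"] measure_def
    by (simp add: enn2real_ennreal integral_nonneg)
qed

lemma integral_gauss_law:
  assumes "0 < r" "f \<in> borel_measurable borel"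
  shows "(\<integral>z. f z \<partial>gauss_law r) = (\<integral>z. normal_density 0 (sqrt r) z * f z \<partial>lborel)"
  using assms unfolding gauss_law_def by (simp add: integral_real_density)

text \<open>Exponential tilting of a centred Gaussian shifts its mean (Cameron-Martin); combined with the
  symmetry of the law, the shift becomes a reflection about \<open>\<alpha> r\<close>. This is
  what turns the reflected term of \<open>killed_tail\<close> into an ordinary convolution.\<close>
lemma gauss_law_exponential_tilt:
  fixes f :: "real \<Rightarrow> real"
  assumes "0 < r" and [measurable]: "f \<in> borel_measurable borel"
  shows "(\<integral>z. exp (2 * \<alpha> * (z - \<alpha> * r)) * f z \<partial>gauss_law r) = (\<integral>z. f (2 * \<alpha> * r - z) \<partial>gauss_law r)"
proof -
  \<comment> \<open>Completing the square; the identity is used after the substitution of \<open>2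
    \<alpha> r - z\<close> for \<open>z\<close>.\<close>
  have dens: "normal_density 0 (sqrt r) (2 * \<alpha> * r - z) * exp (2 * \<alpha> * (\<alpha> * r - z)) = normal_density 0 (sqrt r) z" for z
  proof -
    have "- (2 * \<alpha> * r - z)\<^sup>2 / (2 * r) + 2 * \<alpha> * (\<alpha> * r - z) = - z\<^sup>2 / (2 * r)"
      using assms(1) by (simp add: field_simps power2_eq_square)
    then show ?thesis using assms(1) by (simp add: normal_density_def mult_exp_exp)
  qed
  have "(\<integral>z. exp (2 * \<alpha> * (z - \<alpha> * r)) * f z \<partial>gauss_law r)
      = (\<integral>z. normal_density 0 (sqrt r) z * (exp (2 * \<alpha> * (z - \<alpha> * r)) * f z) \<partial>lborel)"
    using assms by (simp add: integral_gauss_law)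
  also have "\<dots> = (\<integral>z. normal_density 0 (sqrt r) (2 * \<alpha> * r - z) * (exp (2 * \<alpha> * (2 * \<alpha> * r - z - \<alpha> * r)) * f (2 * \<alpha> * r - z)) \<partial>lborel)"
    by (subst lborel_integral_real_affine[where c="-1" and t="2 * \<alpha> * r"]) auto
  also have "\<dots> = (\<integral>z. normal_density 0 (sqrt r) z * f (2 * \<alpha> * r - z) \<partial>lborel)"
  proof (rule Bochner_Integration.integral_cong[OF refl])
    fix z
    have "2 * \<alpha> * r - z - \<alpha> * r = \<alpha> * r - z" by simp
    then show "normal_density 0 (sqrt r) (2 * \<alpha> * r - z) * (exp (2 * \<alpha> * (2 * \<alpha> * r - z - \<alpha> * r)) * f (2 * \<alpha> * r - z)) = normal_density 0 (sqrt r) z * f (2 * \<alpha> * r - z)"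
      using dens[of z] by (metis mult.assoc)
  qed
  also have "\<dots> = (\<integral>z. f (2 * \<alpha> * r - z) \<partial>gauss_law r)"
    using assms by (simp add: integral_gauss_law)
  finally show ?thesis .
qed

lemma gauss_tail_chernoff:
  assumes "0 \<le> s" "0 \<le> u" "0 < s \<or> 0 < u"
  shows "gauss_tail s u \<le> exp (- u\<^sup>2 / (2 * s))"
proof (cases "s = 0")
  case True
  then show ?thesis by (simp add: gauss_tail_def gauss_law_def measure_return)
next
  case False
  with assms have s: "0 < s" by simp
  have "emeasure (gauss_law s) {u<..} = (\<integral>\<^sup>+y. ennreal (normal_density 0 (sqrt s) y) * indicator {u<..} y \<partial>lborel)"
    using s by (simp add: gauss_law_def emeasure_density)
  also have "\<dots> \<le> (\<integral>\<^sup>+y. ennreal (exp (- u\<^sup>2 / (2 * s)) * normal_density 0 (sqrt s) (y - u)) \<partial>lborel)"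
  proof (rule nn_integral_mono)
    fix y
    have "normal_density 0 (sqrt s) y \<le> exp (- u\<^sup>2 / (2 * s)) * normal_density 0 (sqrt s) (y - u)" if "u < y"
    proof -
      have "u * u \<le> u * y" using that assms by (intro mult_left_mono) auto
      then have "u\<^sup>2 + (y - u)\<^sup>2 \<le> y\<^sup>2" by (simp add: power2_eq_square algebra_simps)
      then have "- y\<^sup>2 / (2 * s) \<le> - u\<^sup>2 / (2 * s) + - (y - u)\<^sup>2 / (2 * s)"
        using s by (simp add: field_simps)
      then have "exp (- y\<^sup>2 / (2 * s)) \<le> exp (- u\<^sup>2 / (2 * s)) * exp (- (y - u)\<^sup>2 / (2 * s))"
        by (simp add: mult_exp_exp)
      from mult_left_mono[OF this, of "1 / sqrt (2 * pi * s)"] show ?thesis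
        using s by (simp add: normal_density_def mult_ac)
    qed
    then show "ennreal (normal_density 0 (sqrt s) y) * indicator {u<..} y
        \<le> ennreal (exp (- u\<^sup>2 / (2 * s)) * normal_density 0 (sqrt s) (y - u))"
      by (auto simp: indicator_def intro!: ennreal_leI)
  qed
  also have "\<dots> = ennreal (exp (- u\<^sup>2 / (2 * s))) * (\<integral>\<^sup>+y. ennreal (normal_density 0 (sqrt s) (y - u)) \<partial>lborel)"
    by (simp add: ennreal_mult nn_integral_cmult)
  also have "(\<integral>\<^sup>+y. ennreal (normal_density 0 (sqrt s) (y - u)) \<partial>lborel) = (\<integral>\<^sup>+y. ennreal (normal_density 0 (sqrt s) y) \<partial>lborel)"
    by (subst nn_integral_real_affine[where c=1 and t=u]) (auto simp: add.commute)
  also have "\<dots> = 1"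
    using s by (subst nn_integral_eq_integral) auto
  finally show ?thesis
    unfolding gauss_tail_def measure_def by (simp add: enn2real_leI)
qed

lemma gauss_tail_eq_integral:
  assumes "0 < s"
  shows "gauss_tail s u = (LBINT y. indicator {u<..} y * normal_density 0 (sqrt s) y)"
proof -
  interpret prob_space "gauss_law s" using assms by (intro prob_space_gauss_law) simp
  have "gauss_tail s u = (\<integral>y. indicator {u<..} y \<partial>gauss_law s)"
    by (simp add: gauss_tail_def)
  also have "\<dots> = (LBINT y. normal_density 0 (sqrt s) y * indicator {u<..} y)"
    using assms by (intro integral_gauss_law) auto
  finally show ?thesis by (simp add: mult.commute)
qed

lemma integrable_indicator_normal_density [simp]:
  fixes A :: "real set"
  assumes "0 < \<sigma>" "A \<in> sets borel"
  shows "integrable lborel (\<lambda>y. indicator A y * normal_density m \<sigma> y)"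
  using integrable_mult_indicator[of A lborel "normal_density m \<sigma>"] assms by simp

text \<open>Above \<open>c\<close> the density is at most \<open>1 / c\<close> whatever the variance,
  because \<open>q exp (- q^2 / 2)\<close> is bounded by 1. Uniformity in \<open>s\<close> down
  to 0 is the point of this estimate.\<close>
lemma gauss_tail_lipschitz:
  assumes "0 < s" "0 < c" "c \<le> u" "u \<le> v"
  shows "gauss_tail s u - gauss_tail s v \<le> (v - u) / c"
proof -
  have bound: "normal_density 0 (sqrt s) w \<le> 1 / c" if w: "c \<le> w" for w
  proof -
    define q where "q = w / sqrt s"
    have q: "0 \<le> q" "q\<^sup>2 = w\<^sup>2 / s" using w assms by (auto simp: q_def power_divide)
    have "q \<le> 1 + q\<^sup>2 / 2" using zero_le_power2[of "q - 1"] by (simp add: power2_eq_square algebra_simps)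
    also have "\<dots> \<le> exp (q\<^sup>2 / 2)" by (rule exp_ge_add_one_self)
    finally have e: "q * exp (- (q\<^sup>2 / 2)) \<le> 1" by (simp add: exp_minus field_simps)
    have "w * normal_density 0 (sqrt s) w = (q * exp (- (q\<^sup>2 / 2))) / sqrt (2 * pi)"
      using assms unfolding normal_density_def by (simp add: q(2)) (simp add: q_def real_sqrt_mult mult_ac)
    also have "\<dots> \<le> 1 / 1"
    proof (rule frac_le)
      have "1 \<le> 2 * pi" using pi_ge_two by linarith
      then show "1 \<le> sqrt (2 * pi)" by simp
    qed (use e in auto)
    finally have "w * normal_density 0 (sqrt s) w \<le> 1" by simp
    moreover have "c * normal_density 0 (sqrt s) w \<le> w * normal_density 0 (sqrt s) w"
      using w by (intro mult_right_mono) auto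
    ultimately show ?thesis using assms by (simp add: field_simps)
  qed
  have "gauss_tail s u - gauss_tail s v
      = (LBINT y. indicator {u<..} y * normal_density 0 (sqrt s) y - indicator {v<..} y * normal_density 0 (sqrt s) y)"
    using assms by (simp add: gauss_tail_eq_integral)
  also have "\<dots> \<le> (LBINT y. indicator {u..v} y * (1 / c))"
  proof (rule integral_mono)
    have "integrable lborel (indicator {u..v} :: real \<Rightarrow> real)" 
      by (rule integrable_real_indicator) (use assms in auto)
    then show "integrable lborel (\<lambda>y. indicator {u..v} y * (1 / c) :: real)" by (intro integrable_mult_left) auto
    fix y
    show "indicator {u<..} y * normal_density 0 (sqrt s) y - indicator {v<..} y * normal_density 0 (sqrt s) y
       \<le> indicator {u..v} y * (1 / c)"
      using bound[of y] assms by (auto simp: indicator_def)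
  qed (use assms in simp)
  also have "\<dots> = (v - u) / c" using assms by simp
  finally show ?thesis .
qed

lemma isCont_gauss_tail:
  assumes "0 < s" shows "isCont (gauss_tail s) u"
proof -
  interpret prob_space "gauss_law s" using assms by (intro prob_space_gauss_law) simp
  interpret R: real_distribution "gauss_law s" by unfold_locales simp
  have tail: "gauss_tail s = (\<lambda>u. 1 - cdf (gauss_law s) u)"
  proof
    fix u
    have "{u<..} = space (gauss_law s) - {..u}" by auto
    then show "gauss_tail s u = 1 - cdf (gauss_law s) u"
      unfolding gauss_tail_def cdf_def by (metis prob_compl sets_gauss_law atMost_borel)
  qed
  have "emeasure (gauss_law s) {u} = 0"
    using assms by (simp add: gauss_law_def emeasure_density nn_integral_null_set)
  then have "isCont (cdf (gauss_law s)) u" by (simp add: R.isCont_cdf measure_def)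
  then show ?thesis unfolding tail by (intro continuous_intros)
qed

lemma gauss_tail_shift:
  assumes "0 < t"
  shows "integrable lborel (\<lambda>y. indicator {a<..} y * normal_density 0 (sqrt t) (y + b))"
    and "gauss_tail t (a + b) = (LBINT y. indicator {a<..} y * normal_density 0 (sqrt t) (y + b))"
proof -
  have e: "indicator {a + b<..} (b + 1 * y) * normal_density 0 (sqrt t) (b + 1 * y)
     = indicator {a<..} y * normal_density 0 (sqrt t) (y + b)" for y :: real
    by (auto simp: indicator_def add.commute)
  have i: "integrable lborel (\<lambda>y. indicator {a + b<..} y * normal_density 0 (sqrt t) y)" using assms by simp
  have "integrable lborel (\<lambda>y. indicator {a + b<..} (b + 1 * y) * normal_density 0 (sqrt t) (b + 1 * y))"
    by (rule lborel_integrable_real_affine[OF i]) simp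
  then show "integrable lborel (\<lambda>y. indicator {a<..} y * normal_density 0 (sqrt t) (y + b))"
    unfolding e .
  have "gauss_tail t (a + b) = (LBINT y. indicator {a + b<..} (b + 1 * y) * normal_density 0 (sqrt t) (b + 1 * y))"
    unfolding gauss_tail_eq_integral[OF assms]
    by (subst lborel_integral_real_affine[where c=1 and t=b]) auto
  then show "gauss_tail t (a + b) = (LBINT y. indicator {a<..} y * normal_density 0 (sqrt t) (y + b))"
    unfolding e .
qed

section \<open>Survival probabilities by reflection\<close>

text \<open>The probability that Brownian motion with drift \<open>- \<alpha>\<close> started at \<open>x
  \<ge> 0\<close> is above \<open>a\<close> at time \<open>s\<close> without having hit 0: the
  free tail minus the reflected path, weighted by the Girsanov factor. The formula is kept for
  all real \<open>x\<close>, since its extension to \<open>x < 0\<close> satisfies the same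
  evolution equation and vanishes at \<open>x = 0\<close>.\<close>
definition killed_tail :: "real \<Rightarrow> real \<Rightarrow> real \<Rightarrow> real \<Rightarrow> real" where
  "killed_tail \<alpha> a s x =
     gauss_tail s (a + \<alpha> * s - x) - exp (2 * \<alpha> * x) * gauss_tail s (a + \<alpha> * s + x)"

lemma measurable_killed_tail [measurable]:
  assumes "0 \<le> s" shows "killed_tail \<alpha> a s \<in> borel_measurable borel"
proof -
  have [measurable]: "gauss_tail s \<in> borel_measurable borel" using assms by simp
  show ?thesis unfolding killed_tail_def[abs_def] by measurable
qed

lemma killed_tail_zero [simp]: "killed_tail \<alpha> a s 0 = 0"
  by (simp add: killed_tail_def)

text \<open>For large \<open>x\<close> the factor \<open>exp (2 \<alpha> x)\<close> has to be beaten by the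
  Gaussian tail, which it is because \<open>(\<alpha> s + x)^2 \<ge> 4 \<alpha> s x\<close>.\<close>
lemma killed_tail_correction_le_1:
  assumes "0 < \<alpha>" "0 \<le> s" "0 \<le> a"
  shows "exp (2 * \<alpha> * x) * gauss_tail s (a + \<alpha> * s + x) \<le> 1"
proof (cases "x \<le> 0")
  case True
  then have "exp (2 * \<alpha> * x) \<le> 1" using assms by (simp add: mult_nonneg_nonpos)
  then show ?thesis using gauss_tail_le_1[OF assms(2), of "a + \<alpha> * s + x"]
    by (intro mult_le_one) auto
next
  case False
  show ?thesis
  proof (cases "s = 0")
    case True
    then show ?thesis using False assms by (simp add: gauss_tail_def gauss_law_def measure_return)
  next
    case s0: False
    with assms have s: "0 < s" by simp
    let ?u = "a + \<alpha> * s + x"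
    have u: "0 \<le> ?u" using assms False s by simp
    have "4 * \<alpha> * s * x \<le> (\<alpha> * s + x)\<^sup>2"
      using zero_le_power2[of "\<alpha> * s - x"] by (simp add: power2_eq_square algebra_simps)
    also have "\<dots> \<le> ?u\<^sup>2" using assms False s by (intro power_mono) auto
    finally have "2 * \<alpha> * x + - ?u\<^sup>2 / (2 * s) \<le> 0" using s by (simp add: field_simps)
    then have "exp (2 * \<alpha> * x) * exp (- ?u\<^sup>2 / (2 * s)) \<le> 1" by (simp add: mult_exp_exp)
    moreover have "gauss_tail s ?u \<le> exp (- ?u\<^sup>2 / (2 * s))"
      using gauss_tail_chernoff[OF assms(2) u] s by simp
    ultimately show ?thesis by (smt (verit) exp_gt_zero mult_left_mono)
  qed
qed

lemma abs_killed_tail_le_1: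
  assumes "0 < \<alpha>" "0 \<le> s" "0 \<le> a"
  shows "\<bar>killed_tail \<alpha> a s x\<bar> \<le> 1"
proof -
  have "0 \<le> exp (2 * \<alpha> * x) * gauss_tail s (a + \<alpha> * s + x)" by simp
  moreover note killed_tail_correction_le_1[OF assms, of x]
  moreover have "0 \<le> gauss_tail s (a + \<alpha> * s - x)" by simp
  moreover note gauss_tail_le_1[OF assms(2), of "a + \<alpha> * s - x"]
  ultimately show ?thesis unfolding killed_tail_def by linarith
qed

text \<open>The martingale property behind everything: one Gaussian step of the drifted walk turns remaining
  time \<open>s\<close> into \<open>r + s\<close>. The free term is the convolution identity for
  \<open>gauss_tail\<close>; the reflected term is the same identity after tilting.\<close>
lemma killed_tail_semigroup:
  assumes "0 < \<alpha>" "0 \<le> a" "0 \<le> s" "0 < r"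
  shows "(\<integral>z. killed_tail \<alpha> a s (x + z - \<alpha> * r) \<partial>gauss_law r) = killed_tail \<alpha> a (r + s) x"
proof -
  interpret R: prob_space "gauss_law r" using assms by (intro prob_space_gauss_law) simp
  have [measurable]: "gauss_tail s \<in> borel_measurable borel" using assms by simp
  let ?A = "\<lambda>z. gauss_tail s (a + \<alpha> * s - (x + z - \<alpha> * r))"
  let ?B = "\<lambda>z. exp (2 * \<alpha> * (x + z - \<alpha> * r)) * gauss_tail s (a + \<alpha> * s + (x + z - \<alpha> * r))"
  have A: "integrable (gauss_law r) ?A"
    by (rule R.integrable_const_bound[where B=1]) (use gauss_tail_le_1 assms in auto)
  have B: "integrable (gauss_law r) ?B"
    by (rule R.integrable_const_bound[where B=1]) (use killed_tail_correction_le_1 assms in auto)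
  have "(\<integral>z. ?A z \<partial>gauss_law r) = (\<integral>z. gauss_tail s ((a + \<alpha> * (r + s) - x) - z) \<partial>gauss_law r)"
    by (rule Bochner_Integration.integral_cong) (auto simp: algebra_simps)
  then have A': "(\<integral>z. ?A z \<partial>gauss_law r) = gauss_tail (r + s) (a + \<alpha> * (r + s) - x)"
    using gauss_tail_semigroup assms by simp
  have "(\<integral>z. ?B z \<partial>gauss_law r) = (\<integral>z. exp (2 * \<alpha> * x) * (exp (2 * \<alpha> * (z - \<alpha> * r)) * gauss_tail s (a + \<alpha> * s + (x + z - \<alpha> * r))) \<partial>gauss_law r)"
    by (rule Bochner_Integration.integral_cong)
      (auto simp: mult_exp_exp distrib_left right_diff_distrib simp flip: mult.assoc)
  also have "\<dots> = exp (2 * \<alpha> * x) * (\<integral>z. exp (2 * \<alpha> * (z - \<alpha> * r)) * gauss_tail s (a + \<alpha> * s + (x + z - \<alpha> * r)) \<partial>gauss_law r)"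
    by simp
  also have "(\<integral>z. exp (2 * \<alpha> * (z - \<alpha> * r)) * gauss_tail s (a + \<alpha> * s + (x + z - \<alpha> * r)) \<partial>gauss_law r)
     = (\<integral>z. gauss_tail s (a + \<alpha> * s + (x + (2 * \<alpha> * r - z) - \<alpha> * r)) \<partial>gauss_law r)"
    using assms by (intro gauss_law_exponential_tilt) auto
  also have "\<dots> = (\<integral>z. gauss_tail s ((a + \<alpha> * (r + s) + x) - z) \<partial>gauss_law r)"
    by (rule Bochner_Integration.integral_cong) (auto simp: algebra_simps)
  also have "\<dots> = gauss_tail (r + s) (a + \<alpha> * (r + s) + x)"
    using gauss_tail_semigroup assms by simp
  finally show ?thesis
    unfolding killed_tail_def using A A' B by simp
qed

text \<open>The level \<open>a > 0\<close> keeps both arguments of \<open>gauss_tail\<close> above \<open>a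
  / 2\<close>, so the bound does not depend on \<open>s\<close>. It controls the error made when
  the walk overshoots 0 between two grid points.\<close>
lemma killed_tail_boundary:
  assumes "0 < \<alpha>" "0 \<le> s" "0 < a" "- (a / 2) \<le> x" "x \<le> 0"
  shows "\<bar>killed_tail \<alpha> a s x\<bar> \<le> (4 / a + 2 * \<alpha>) * \<bar>x\<bar>"
proof (cases "s = 0")
  case True
  then have "killed_tail \<alpha> a s x = 0"
    using assms by (simp add: killed_tail_def gauss_tail_def gauss_law_def measure_return)
  moreover have "0 \<le> (4 / a + 2 * \<alpha>) * \<bar>x\<bar>" using assms by (intro mult_nonneg_nonneg) auto
  ultimately show ?thesis by simp
next
  case False
  with assms have s: "0 < s" by simp
  let ?u = "a + \<alpha> * s + x" and ?v = "a + \<alpha> * s - x"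
  have as: "0 < \<alpha> * s" using assms s by simp
  have "a / 2 \<le> ?u" using assms(4) as by linarith
  then have d: "gauss_tail s ?u - gauss_tail s ?v \<le> (?v - ?u) / (a / 2)"
    using assms s by (intro gauss_tail_lipschitz) auto
  have "(?v - ?u) / (a / 2) = 4 / a * \<bar>x\<bar>" using assms by (simp add: field_simps)
  with d have d: "gauss_tail s ?u - gauss_tail s ?v \<le> 4 / a * \<bar>x\<bar>" by simp
  have d0: "0 \<le> gauss_tail s ?u - gauss_tail s ?v"
    using gauss_tail_antimono[of s ?u ?v] assms by simp
  have e1: "1 - exp (2 * \<alpha> * x) \<le> 2 * \<alpha> * \<bar>x\<bar>"
  proof -
    have "2 * \<alpha> * \<bar>x\<bar> = - (2 * \<alpha> * x)" using assms(5) by simp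
    then show ?thesis using exp_ge_add_one_self[of "2 * \<alpha> * x"] by linarith
  qed
  have e0: "0 \<le> 1 - exp (2 * \<alpha> * x)" using assms by (simp add: mult_nonneg_nonpos)
  have "0 \<le> (1 - exp (2 * \<alpha> * x)) * gauss_tail s ?u" using e0 by simp
  moreover have "(1 - exp (2 * \<alpha> * x)) * gauss_tail s ?u \<le> 2 * \<alpha> * \<bar>x\<bar> * 1"
    using e0 e1 gauss_tail_le_1[OF assms(2)] assms(1) by (intro mult_mono) auto
  moreover have "killed_tail \<alpha> a s x = (1 - exp (2 * \<alpha> * x)) * gauss_tail s ?u - (gauss_tail s ?u - gauss_tail s ?v)"
    by (simp add: killed_tail_def algebra_simps)
  ultimately show ?thesis using d d0 by (simp add: distrib_right abs_le_iff) 
qed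

lemma isCont_killed_tail:
  assumes "0 < s" shows "isCont (killed_tail \<alpha> a s) x"
  unfolding killed_tail_def[abs_def]
  by (intro continuous_intros isCont_o2[OF _ isCont_gauss_tail[OF assms]])

lemma isCont_killed_tail_level:
  assumes "0 < s" shows "isCont (\<lambda>a. killed_tail \<alpha> a s x) a"
  unfolding killed_tail_def[abs_def]
  by (intro continuous_intros isCont_o2[OF _ isCont_gauss_tail[OF assms]])

lemma killed_tail_chernoff:
  assumes "0 < t" "0 \<le> a"
  shows "killed_tail \<alpha> a t x \<le> exp (- (max 0 (\<alpha> * t - x))\<^sup>2 / (2 * t))"
proof -
  have "killed_tail \<alpha> a t x \<le> gauss_tail t (a + \<alpha> * t - x)" by (simp add: killed_tail_def)
  also have "\<dots> \<le> exp (- (max 0 (\<alpha> * t - x))\<^sup>2 / (2 * t))"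
  proof (cases "\<alpha> * t - x \<le> 0")
    case True
    then show ?thesis using gauss_tail_le_1[of t] assms by (simp add: max_def)
  next
    case False
    have "gauss_tail t (a + \<alpha> * t - x) \<le> gauss_tail t (\<alpha> * t - x)"
      using assms by (intro gauss_tail_antimono) auto
    also have "\<dots> \<le> exp (- (\<alpha> * t - x)\<^sup>2 / (2 * t))"
      using False assms by (intro gauss_tail_chernoff) auto
    finally show ?thesis using False by (simp add: max_def)
  qed
  finally show ?thesis .
qed

text \<open>What is left of the killed transition density, integrated over \<open>y > a\<close>, once the
  factors that do not involve \<open>y\<close> are pulled out; \<open>z\<close> stands for the
  rescaled starting point \<open>x / t\<close>.\<close>
definition reflected_mass :: "real \<Rightarrow> real \<Rightarrow> real \<Rightarrow> real \<Rightarrow> real" where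
  "reflected_mass \<alpha> a t z = (LBINT y. indicator {a<..} y * (exp (- \<alpha> * y - y\<^sup>2 / (2 * t)) * sinh (z * y)))"

text \<open>Expanding the two squares, the direct and the reflected density share the factor \<open>exp (-
  (x - \<alpha> t)^2 / (2 t) - \<alpha> y - y^2 / (2 t))\<close> and differ in \<open>exp (x y /
  t)\<close> against \<open>exp (- x y / t)\<close>, whence the hyperbolic sine.\<close>
lemma killed_tail_eq_reflected_mass:
  assumes t: "0 < t"
  shows "killed_tail \<alpha> a t x = sqrt (2 / (pi * t)) * exp (- (x - \<alpha> * t)\<^sup>2 / (2 * t)) * reflected_mass \<alpha> a t (x / t)"
proof -
  define c where "c = sqrt (2 / (pi * t)) * exp (- (x - \<alpha> * t)\<^sup>2 / (2 * t))"
  have c2: "sqrt (2 / (pi * t)) = 2 * (1 / sqrt (2 * pi * t))"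
    by (rule real_sqrt_unique) (use t in \<open>auto simp: power_mult_distrib power_divide\<close>)
  have dens: "normal_density 0 (sqrt t) (y + (\<alpha> * t - x)) - exp (2 * \<alpha> * x) * normal_density 0 (sqrt t) (y + (\<alpha> * t + x))
      = c * (exp (- \<alpha> * y - y\<^sup>2 / (2 * t)) * sinh (x / t * y))" for y
  proof -
    let ?e = "- (x - \<alpha> * t)\<^sup>2 / (2 * t) + (- \<alpha> * y - y\<^sup>2 / (2 * t))"
    have 1: "- (y + (\<alpha> * t - x))\<^sup>2 / (2 * t) = ?e + x / t * y"
      using t by (simp add: field_simps power2_eq_square)
    have 2: "2 * \<alpha> * x + - (y + (\<alpha> * t + x))\<^sup>2 / (2 * t) = ?e + - (x / t * y)"
      using t by (simp add: field_simps power2_eq_square)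
    have "exp (- (y + (\<alpha> * t - x))\<^sup>2 / (2 * t)) = exp ?e * exp (x / t * y)"
      unfolding 1 by (rule exp_add)
    moreover have "exp (2 * \<alpha> * x) * exp (- (y + (\<alpha> * t + x))\<^sup>2 / (2 * t)) = exp ?e * exp (- (x / t * y))"
      unfolding mult_exp_exp 2 by (rule refl)
    moreover have "exp ?e = exp (- (x - \<alpha> * t)\<^sup>2 / (2 * t)) * exp (- \<alpha> * y - y\<^sup>2 / (2 * t))"
      by (rule exp_add)
    ultimately show ?thesis
      using t unfolding normal_density_def c_def c2 sinh_field_def
      by (simp add: algebra_simps)
  qed
  have "killed_tail \<alpha> a t x = gauss_tail t (a + (\<alpha> * t - x)) - exp (2 * \<alpha> * x) * gauss_tail t (a + (\<alpha> * t + x))"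
    by (simp add: killed_tail_def algebra_simps)
  also have "\<dots> = (LBINT y. indicator {a<..} y * normal_density 0 (sqrt t) (y + (\<alpha> * t - x))
       - exp (2 * \<alpha> * x) * (indicator {a<..} y * normal_density 0 (sqrt t) (y + (\<alpha> * t + x))))"
    unfolding gauss_tail_shift(2)[OF t] using gauss_tail_shift(1)[OF t] by simp
  also have "\<dots> = (LBINT y. c * (indicator {a<..} y * (exp (- \<alpha> * y - y\<^sup>2 / (2 * t)) * sinh (x / t * y))))"
  proof (rule Bochner_Integration.integral_cong[OF refl])
    fix y
    show "indicator {a<..} y * normal_density 0 (sqrt t) (y + (\<alpha> * t - x))
       - exp (2 * \<alpha> * x) * (indicator {a<..} y * normal_density 0 (sqrt t) (y + (\<alpha> * t + x)))
       = c * (indicator {a<..} y * (exp (- \<alpha> * y - y\<^sup>2 / (2 * t)) * sinh (x / t * y)))"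
      using dens[of y] by (simp add: indicator_def)
  qed
  also have "\<dots> = c * reflected_mass \<alpha> a t (x / t)"
    by (simp add: reflected_mass_def)
  finally show ?thesis by (simp add: c_def)
qed

section \<open>Brownian increments and the initial value\<close>

text \<open>Conditioning on the first \<open>k + 1\<close> of a sequence of independent variables: the next
  one can be integrated out under its own law.\<close>
lemma (in prob_space) integral_next_independent:
  fixes \<xi> :: "nat \<Rightarrow> 'a \<Rightarrow> real" and f :: "(nat \<Rightarrow> real) \<times> real \<Rightarrow> real"
  assumes ind: "indep_vars (\<lambda>_. borel) \<xi> {..Suc k}"
    and f [measurable]: "f \<in> borel_measurable ((\<Pi>\<^sub>M i\<in>{..k}. borel) \<Otimes>\<^sub>M borel)"
    and bound: "\<And>x. \<bar>f x\<bar> \<le> C"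
  shows "(\<integral>\<omega>. f (\<lambda>i\<in>{..k}. \<xi> i \<omega>, \<xi> (Suc k) \<omega>) \<partial>M) =
    (\<integral>\<omega>. (\<integral>z. f (\<lambda>i\<in>{..k}. \<xi> i \<omega>, z) \<partial>distr M borel (\<xi> (Suc k))) \<partial>M)"
proof -
  let ?P = "\<Pi>\<^sub>M i\<in>{..k}. (borel :: real measure)"
  let ?X = "\<lambda>\<omega>. \<lambda>i\<in>{..k}. \<xi> i \<omega>"
  \<comment> \<open>The next variable is first taken as a tuple with one coordinate, so that past and
    next step have values of the same type.\<close>
  let ?Q = "\<Pi>\<^sub>M i\<in>{Suc k}. (borel :: real measure)"
  let ?Y = "\<lambda>\<omega>. \<lambda>i\<in>{Suc k}. \<xi> i \<omega>"
  have "indep_var ?P ?X ?Q ?Y"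
    by (rule indep_var_restrict[OF ind]) auto
  then have [measurable]: "random_variable ?P ?X" "random_variable ?Q ?Y"
    and eq: "distr M ?P ?X \<Otimes>\<^sub>M distr M ?Q ?Y = distr M (?P \<Otimes>\<^sub>M ?Q) (\<lambda>\<omega>. (?X \<omega>, ?Y \<omega>))"
    by (auto simp: indep_var_distribution_eq)
  have [measurable]: "random_variable borel (\<xi> (Suc k))"
    using ind by (auto simp: indep_vars_def)
  have last: "(\<lambda>y. y (Suc k)) \<in> borel_measurable ?Q" by (rule measurable_component_singleton) simp
  note [measurable] = last
  interpret X: prob_space "distr M ?P ?X" by (rule prob_space_distr) simp
  interpret Y: prob_space "distr M ?Q ?Y" by (rule prob_space_distr) simp
  interpret XY: pair_prob_space "distr M ?P ?X" "distr M ?Q ?Y" ..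
  let ?f = "\<lambda>(x, y). f (x, y (Suc k))"
  have int: "integrable (distr M ?P ?X \<Otimes>\<^sub>M distr M ?Q ?Y) ?f"
    by (rule XY.integrable_const_bound[where B=C]) (use bound in auto)
  have "(\<integral>\<omega>. f (?X \<omega>, \<xi> (Suc k) \<omega>) \<partial>M) = (\<integral>x. ?f x \<partial>(distr M ?P ?X \<Otimes>\<^sub>M distr M ?Q ?Y))"
    unfolding eq by (subst integral_distr) auto
  also have "\<dots> = (\<integral>x. (\<integral>y. f (x, y (Suc k)) \<partial>distr M ?Q ?Y) \<partial>distr M ?P ?X)"
    using XY.integral_fst'[OF int] by simp
  also have "\<dots> = (\<integral>\<omega>. (\<integral>y. f (?X \<omega>, y (Suc k)) \<partial>distr M ?Q ?Y) \<partial>M)"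
    by (subst integral_distr) auto
  also have "\<dots> = (\<integral>\<omega>. (\<integral>z. f (?X \<omega>, z) \<partial>distr M borel (\<xi> (Suc k))) \<partial>M)"
  proof (rule Bochner_Integration.integral_cong[OF refl])
    fix \<omega> assume "\<omega> \<in> space M"
    then have [measurable]: "?X \<omega> \<in> space ?P" by (auto simp: space_PiM)
    then have [measurable]: "(\<lambda>z. f (?X \<omega>, z)) \<in> borel_measurable borel" by simp
    show "(\<integral>y. f (?X \<omega>, y (Suc k)) \<partial>distr M ?Q ?Y) = (\<integral>z. f (?X \<omega>, z) \<partial>distr M borel (\<xi> (Suc k)))"
      by (subst (1 2) integral_distr) auto
  qed
  finally show ?thesis .
qed

lemma brownian_with_initial_lawD:
  assumes "brownian_with_initial_law \<mu> M X0 B"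
  shows "prob_space M" "X0 \<in> borel_measurable M" "distr M borel X0 = \<mu>"
    and "\<And>t. 0 \<le> t \<Longrightarrow> B t \<in> borel_measurable M"
    and "\<And>\<omega>. \<omega> \<in> space M \<Longrightarrow> B 0 \<omega> = 0"
    and "\<And>\<omega>. \<omega> \<in> space M \<Longrightarrow> continuous_on {0..} (\<lambda>t. B t \<omega>)"
  using assms by (simp_all add: brownian_with_initial_law_def standard_brownian_motion_def)

lemma brownian_increment_law:
  assumes "brownian_with_initial_law \<mu> M X0 B" "0 \<le> s" "0 < h"
  shows "distr M borel (\<lambda>\<omega>. B (s + h) \<omega> - B s \<omega>) = gauss_law h"
proof -
  have "distributed M lborel (\<lambda>\<omega>. B (s + h) \<omega> - B s \<omega>) (normal_density 0 (sqrt (s + h - s)))"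
    using assms unfolding brownian_with_initial_law_def standard_brownian_motion_def
    by (metis less_add_same_cancel1)
  then have "distr M lborel (\<lambda>\<omega>. B (s + h) \<omega> - B s \<omega>) = gauss_law h"
    using assms by (simp add: distributed_def gauss_law_def)
  moreover have "distr M lborel (\<lambda>\<omega>. B (s + h) \<omega> - B s \<omega>) = distr M borel (\<lambda>\<omega>. B (s + h) \<omega> - B s \<omega>)"
    by (rule distr_cong) auto
  ultimately show ?thesis by simp
qed

text \<open>Independence of \<open>X0\<close> from the whole path and of the increments among themselves
  combine into mutual independence, since an event of the increments belongs to the
  sigma-algebra of the path. The initial value is placed at index 0 of the family, so that the
  drifted walk is a partial sum.\<close>
lemma brownian_increments_indep_initial:
  assumes brown: "brownian_with_initial_law \<mu> M X0 B"
    and s: "0 \<le> s 0" "\<And>i. i < n \<Longrightarrow> s i \<le> s (Suc i)"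
  shows "prob_space.indep_vars M (\<lambda>_. borel)
     (\<lambda>i. case i of 0 \<Rightarrow> X0 | Suc j \<Rightarrow> (\<lambda>\<omega>. B (s (Suc j)) \<omega> - B (s j) \<omega>)) {..n}"
proof -
  interpret prob_space M by (rule brownian_with_initial_lawD[OF brown])
  note [measurable] = brownian_with_initial_lawD(2,4)[OF brown]
  have s0: "0 \<le> s i" if "i \<le> n" for i
    using that by (induction i) (use s in \<open>auto intro: order_trans\<close>)
  define \<xi> where "\<xi> = (\<lambda>i. case i of 0 \<Rightarrow> X0 | Suc j \<Rightarrow> (\<lambda>\<omega>. B (s (Suc j)) \<omega> - B (s j) \<omega>))"
  have \<xi>0: "\<xi> 0 = X0" and \<xi>S: "\<xi> (Suc j) = (\<lambda>\<omega>. B (s (Suc j)) \<omega> - B (s j) \<omega>)" for j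
    by (auto simp: \<xi>_def)
  have meas: "random_variable borel (\<xi> i)" if "i \<le> n" for i
    using that s0 by (cases i) (auto simp: \<xi>0 \<xi>S)
  let ?path = "\<lambda>\<omega>. \<lambda>t\<in>{0..}. B t \<omega>"
  let ?VX = "vimage_algebra (space M) X0 borel"
  let ?V = "vimage_algebra (space M) ?path (PiM {0..} (\<lambda>_. borel))"
  have ind: "indep_set (sets ?VX) (sets ?V)"
    using brown unfolding brownian_with_initial_law_def by blast
  have inc: "indep_vars (\<lambda>_. borel) (\<lambda>j. \<xi> (Suc j)) {..<n}"
    using brown s unfolding brownian_with_initial_law_def standard_brownian_motion_def \<xi>S by blast
  have path: "?path \<in> measurable ?V (PiM {0..} (\<lambda>_. borel))"
    by (rule measurable_vimage_algebra1) (auto simp: space_PiM)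
  have BV: "B t \<in> borel_measurable ?V" if "0 \<le> t" for t
    using measurable_compose[OF path measurable_component_singleton[of t "{0..}"]] that by simp
  have "indep_sets (\<lambda>i. {\<xi> i -` A \<inter> space M |A. A \<in> sets borel}) {..n}"
  proof (subst indep_sets_finite)
    show "\<And>i. i \<in> {..n} \<Longrightarrow> {\<xi> i -` A \<inter> space M |A. A \<in> sets borel} \<subseteq> events"
      using meas by (auto intro: measurable_sets)
    show "\<And>i. i \<in> {..n} \<Longrightarrow> space M \<in> {\<xi> i -` A \<inter> space M |A. A \<in> sets borel}"
      by (auto intro!: exI[of _ UNIV])
    show "\<forall>A\<in>Pi {..n} (\<lambda>i. {\<xi> i -` A \<inter> space M |A. A \<in> sets borel}).
        prob (\<Inter>j\<in>{..n}. A j) = (\<Prod>j\<in>{..n}. prob (A j))"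
    proof
      fix A assume "A \<in> Pi {..n} (\<lambda>i. {\<xi> i -` A \<inter> space M |A. A \<in> sets borel})"
      then have "\<forall>i\<in>{..n}. \<exists>C. C \<in> sets borel \<and> A i = \<xi> i -` C \<inter> space M"
        unfolding Pi_iff by blast
      then obtain C where C: "\<And>i. i \<le> n \<Longrightarrow> C i \<in> sets borel \<and> A i = \<xi> i -` C i \<inter> space M"
        by (metis atMost_iff)
      show "prob (\<Inter>j\<in>{..n}. A j) = (\<Prod>j\<in>{..n}. prob (A j))"
      proof (cases "n = 0")
        case True then show ?thesis by simp
      next
        case False
        have A0: "A 0 \<in> sets ?VX"
          using C[of 0] in_vimage_algebra[of "C 0" borel X0 "space M"] by (simp add: \<xi>0)
        have AS: "A (Suc j) \<in> sets ?V" if "j < n" for j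
        proof -
          have "\<xi> (Suc j) \<in> borel_measurable ?V"
            unfolding \<xi>S using s0 that by (intro borel_measurable_diff BV) auto
          then have "\<xi> (Suc j) -` C (Suc j) \<inter> space ?V \<in> sets ?V"
            using C[of "Suc j"] that by (intro measurable_sets) auto
          then show ?thesis using C[of "Suc j"] that by simp
        qed
        have rest: "(\<Inter>j\<in>{..<n}. A (Suc j)) \<in> sets ?V"
          using False AS by (intro sets.finite_INT) auto
        have "{..n} = insert 0 (Suc ` {..<n})" by (metis lessThan_Suc_atMost lessThan_Suc_eq_insert_0)
        then have "prob (\<Inter>j\<in>{..n}. A j) = prob (A 0 \<inter> (\<Inter>j\<in>{..<n}. A (Suc j)))"
          by simp
        also have "\<dots> = prob (A 0) * prob (\<Inter>j\<in>{..<n}. A (Suc j))"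
          by (rule indep_setD[OF ind A0 rest])
        also have "prob (\<Inter>j\<in>{..<n}. A (Suc j)) = prob (\<Inter>j\<in>{..<n}. \<xi> (Suc j) -` C (Suc j) \<inter> space M)"
          using C by (intro arg_cong[where f=prob] INF_cong) auto
        also have "\<dots> = (\<Prod>j\<in>{..<n}. prob (\<xi> (Suc j) -` C (Suc j) \<inter> space M))"
          using False C by (intro indep_varsD_finite[OF inc]) auto
        also have "\<dots> = (\<Prod>j\<in>{..<n}. prob (A (Suc j)))"
          using C by (intro prod.cong) auto
        also have "prob (A 0) * \<dots> = (\<Prod>j\<in>{..n}. prob (A j))"
          by (simp only: lessThan_Suc_atMost[symmetric] prod.lessThan_Suc_shift)
        finally show ?thesis .
      qed
    qed
  qed auto
  then show ?thesis
    unfolding \<xi>_def[symmetric] indep_vars_def2 using meas by auto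
qed

text \<open>Used to shift the starting point downwards.\<close>
lemma brownian_with_initial_law_map:
  assumes brown: "brownian_with_initial_law \<mu> M X0 B" and g [measurable]: "g \<in> borel_measurable borel"
  shows "brownian_with_initial_law (distr \<mu> borel g) M (\<lambda>\<omega>. g (X0 \<omega>)) B"
proof -
  interpret prob_space M by (rule brownian_with_initial_lawD[OF brown])
  note [measurable] = brownian_with_initial_lawD(2,4)[OF brown]
  have "distr M borel (\<lambda>\<omega>. g (X0 \<omega>)) = distr \<mu> borel g"
    unfolding brownian_with_initial_lawD(3)[OF brown, symmetric]
    by (subst distr_distr) (auto simp: comp_def)
  moreover have "sets (vimage_algebra (space M) (\<lambda>\<omega>. g (X0 \<omega>)) borel) \<subseteq> sets (vimage_algebra (space M) X0 borel)"
  proof -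
    have "(\<lambda>\<omega>. g (X0 \<omega>)) \<in> borel_measurable (vimage_algebra (space M) X0 borel)"
      by (intro measurable_compose[OF measurable_vimage_algebra1 g]) auto
    then show ?thesis
      by (auto simp: sets_vimage_algebra2 dest: measurable_sets)
  qed
  ultimately show ?thesis
    using brown unfolding brownian_with_initial_law_def indep_sets2_eq
    by (auto simp: subset_eq)
qed

lemma drifted_path_measurable:
  assumes "brownian_with_initial_law \<mu> M X0 B" "0 \<le> t"
  shows "drifted_path \<alpha> X0 B t \<in> borel_measurable M"
proof -
  note [measurable] = brownian_with_initial_lawD(2)[OF assms(1)] brownian_with_initial_lawD(4)[OF assms]
  show ?thesis unfolding drifted_path_def[abs_def] by measurable
qed

lemma drifted_path_continuous:
  assumes "brownian_with_initial_law \<mu> M X0 B" "\<omega> \<in> space M"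
  shows "continuous_on {0..} (\<lambda>t. drifted_path \<alpha> X0 B t \<omega>)"
  unfolding drifted_path_def by (intro continuous_intros brownian_with_initial_lawD(6)[OF assms])

section \<open>Survival along a time grid\<close>

definition positive_on_grid :: "(real \<Rightarrow> 'a \<Rightarrow> real) \<Rightarrow> real \<Rightarrow> nat \<Rightarrow> 'a \<Rightarrow> bool" where
  "positive_on_grid Y h k \<omega> \<longleftrightarrow> (\<forall>i\<le>k. 0 < Y (real i * h) \<omega>)"

lemma positive_on_grid_measurable:
  assumes "\<And>u. 0 \<le> u \<Longrightarrow> Y u \<in> borel_measurable M" "0 \<le> h"
  shows "Measurable.pred M (positive_on_grid Y h k)"
proof -
  have [measurable]: "Y (real i * h) \<in> borel_measurable M" for i
    using assms by auto
  show ?thesis unfolding positive_on_grid_def[abs_def] by measurable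
qed

lemma positive_on_grid_Suc:
  "positive_on_grid Y h (Suc k) \<omega> \<longleftrightarrow> positive_on_grid Y h k \<omega> \<and> 0 < Y (real (Suc k) * h) \<omega>"
  by (auto simp: positive_on_grid_def le_Suc_eq)

text \<open>While the walk is alive, the drifted path after one step has the law of one Gaussian step from
  its current position, so \<open>killed_tail_semigroup\<close> applies conditionally on the
  past.\<close>
lemma grid_step:
  assumes brown: "brownian_with_initial_law \<mu> M X0 B"
    and "0 < \<alpha>" "0 \<le> a" "0 < h" "0 \<le> s"
  defines "Y \<equiv> drifted_path \<alpha> X0 B"
  shows "(\<integral>\<omega>. of_bool (positive_on_grid Y h k \<omega>) * killed_tail \<alpha> a s (Y (real (Suc k) * h) \<omega>) \<partial>M)
    = (\<integral>\<omega>. of_bool (positive_on_grid Y h k \<omega>) * killed_tail \<alpha> a (s + h) (Y (real k * h) \<omega>) \<partial>M)"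
proof -
  interpret prob_space M by (rule brownian_with_initial_lawD[OF brown])
  define \<xi> where "\<xi> = (\<lambda>i. case i of 0 \<Rightarrow> X0
     | Suc j \<Rightarrow> (\<lambda>\<omega>. B (real (Suc j) * h) \<omega> - B (real j * h) \<omega>))"
  have \<xi>0: "\<xi> 0 = X0" and \<xi>S: "\<xi> (Suc j) = (\<lambda>\<omega>. B (real (Suc j) * h) \<omega> - B (real j * h) \<omega>)" for j
    by (auto simp: \<xi>_def)
  have ind: "indep_vars (\<lambda>_. borel) \<xi> {..Suc k}"
    unfolding \<xi>_def by (rule brownian_increments_indep_initial[OF brown]) (use assms in auto)
  have law: "distr M borel (\<xi> (Suc k)) = gauss_law h"
    unfolding \<xi>S using brownian_increment_law[OF brown, of "real k * h" h] assms
    by (simp add: algebra_simps)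
  define g where "g i x = x 0 + (\<Sum>j<i. x (Suc j) - \<alpha> * h)" for i and x :: "nat \<Rightarrow> real"
  have gY: "g i (\<lambda>i\<in>{..k}. \<xi> i \<omega>) = Y (real i * h) \<omega>" if "i \<le> k" "\<omega> \<in> space M" for i \<omega>
    using that(1)
  proof (induction i)
    case 0
    then show ?case using brownian_with_initial_lawD(5)[OF brown that(2)]
      by (simp add: g_def \<xi>0 Y_def drifted_path_def)
  next
    case (Suc i)
    have "g (Suc i) (\<lambda>i\<in>{..k}. \<xi> i \<omega>) = g i (\<lambda>i\<in>{..k}. \<xi> i \<omega>) + \<xi> (Suc i) \<omega> - \<alpha> * h"
      using Suc.prems by (simp add: g_def)
    also have "\<dots> = Y (real i * h) \<omega> + \<xi> (Suc i) \<omega> - \<alpha> * h"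
      using Suc.IH Suc.prems by (metis Suc_leD)
    also have "\<dots> = Y (real (Suc i) * h) \<omega>" by (simp add: Y_def drifted_path_def \<xi>S algebra_simps)
    finally show ?case .
  qed
  have last: "Y (real (Suc k) * h) \<omega> = Y (real k * h) \<omega> + \<xi> (Suc k) \<omega> - \<alpha> * h" for \<omega>
    by (simp add: Y_def drifted_path_def \<xi>S algebra_simps)
  let ?P = "\<Pi>\<^sub>M i\<in>{..k}. (borel :: real measure)"
  have [measurable]: "g i \<in> borel_measurable ?P" if "i \<le> k" for i
    unfolding g_def using that by (intro borel_measurable_add borel_measurable_sum borel_measurable_diff) auto
  have gk: "g k \<in> borel_measurable ?P" by simp
  note [measurable] = gk
  have [measurable]: "Measurable.pred ?P (\<lambda>x. \<forall>i\<in>{..k}. 0 < g i x)" by simp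
  have [measurable]: "killed_tail \<alpha> a s \<in> borel_measurable borel" using assms by simp
  let ?f = "\<lambda>(x, z). of_bool (\<forall>i\<in>{..k}. 0 < g i x) * killed_tail \<alpha> a s (g k x + z - \<alpha> * h)"
  have alive: "(\<forall>i\<in>{..k}. 0 < g i (\<lambda>i\<in>{..k}. \<xi> i \<omega>)) = positive_on_grid Y h k \<omega>" if "\<omega> \<in> space M" for \<omega>
    using gY that by (auto simp: positive_on_grid_def)
  have "(\<integral>\<omega>. of_bool (positive_on_grid Y h k \<omega>) * killed_tail \<alpha> a s (Y (real (Suc k) * h) \<omega>) \<partial>M)
     = (\<integral>\<omega>. ?f (\<lambda>i\<in>{..k}. \<xi> i \<omega>, \<xi> (Suc k) \<omega>) \<partial>M)"
    using alive gY last by (intro Bochner_Integration.integral_cong) auto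
  also have "\<dots> = (\<integral>\<omega>. (\<integral>z. ?f (\<lambda>i\<in>{..k}. \<xi> i \<omega>, z) \<partial>distr M borel (\<xi> (Suc k))) \<partial>M)"
  proof (rule integral_next_independent[OF ind, where C=1])
    show "?f \<in> borel_measurable (?P \<Otimes>\<^sub>M borel)" by measurable
    show "\<bar>?f x\<bar> \<le> 1" for x
      using abs_killed_tail_le_1[of \<alpha> s a] assms by (cases x) (auto simp: abs_mult)
  qed
  also have "\<dots> = (\<integral>\<omega>. of_bool (positive_on_grid Y h k \<omega>) * killed_tail \<alpha> a (s + h) (Y (real k * h) \<omega>) \<partial>M)"
    unfolding law
  proof (rule Bochner_Integration.integral_cong[OF refl])
    fix \<omega> assume w: "\<omega> \<in> space M"
    show "(\<integral>z. ?f (\<lambda>i\<in>{..k}. \<xi> i \<omega>, z) \<partial>gauss_law h) 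
       = of_bool (positive_on_grid Y h k \<omega>) * killed_tail \<alpha> a (s + h) (Y (real k * h) \<omega>)"
      using alive[OF w] gY[OF _ w, of k] killed_tail_semigroup[of \<alpha> a s h "Y (real k * h) \<omega>"] assms(2-5)
      by (simp add: add.commute[of s h])
  qed
  finally show ?thesis .
qed

text \<open>The value of \<open>killed_tail\<close>, with the time then remaining, at the first grid point
  where the path is not positive, zero if there is none or if the path starts non-positive. The
  difference of the two indicators singles out that grid point.\<close>
definition exit_error :: "real \<Rightarrow> real \<Rightarrow> (real \<Rightarrow> 'a \<Rightarrow> real) \<Rightarrow> real \<Rightarrow> nat \<Rightarrow> 'a \<Rightarrow> real" where
  "exit_error \<alpha> a Y h n \<omega> = (\<Sum>k<n. (of_bool (positive_on_grid Y h k \<omega>) - of_bool (positive_on_grid Y h (Suc k) \<omega>))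
      * killed_tail \<alpha> a (real (n - Suc k) * h) (Y (real (Suc k) * h) \<omega>))"

text \<open>At most one summand is nonzero, as the indicators decrease in \<open>k\<close> and their
  differences telescope.\<close>
lemma abs_exit_error_le:
  assumes c: "\<And>k. k < n \<Longrightarrow> positive_on_grid Y h k \<omega> \<Longrightarrow> \<not> positive_on_grid Y h (Suc k) \<omega> \<Longrightarrow>
       \<bar>killed_tail \<alpha> a (real (n - Suc k) * h) (Y (real (Suc k) * h) \<omega>)\<bar> \<le> c" and "0 \<le> c"
  shows "\<bar>exit_error \<alpha> a Y h n \<omega>\<bar> \<le> c"
proof -
  let ?e = "\<lambda>k. of_bool (positive_on_grid Y h k \<omega>) - of_bool (positive_on_grid Y h (Suc k) \<omega>) :: real"
  have "\<bar>exit_error \<alpha> a Y h n \<omega>\<bar> \<le> (\<Sum>k<n. c * ?e k)"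
    unfolding exit_error_def
  proof (rule order_trans[OF sum_abs sum_mono])
    fix k assume "k \<in> {..<n}"
    then show "\<bar>?e k * killed_tail \<alpha> a (real (n - Suc k) * h) (Y (real (Suc k) * h) \<omega>)\<bar> \<le> c * ?e k"
      using c[of k] by (auto simp: positive_on_grid_Suc)
  qed
  also have "\<dots> = c * (of_bool (positive_on_grid Y h 0 \<omega>) - of_bool (positive_on_grid Y h n \<omega>))"
    using sum_lessThan_telescope'[of "\<lambda>k. of_bool (positive_on_grid Y h k \<omega>) :: real" n]
    by (simp only: sum_distrib_left[symmetric])
  also have "\<dots> \<le> c * 1" using assms(2) by (intro mult_left_mono) auto
  finally show ?thesis by simp
qed

text \<open>Optional stopping on the grid, written as a telescoping sum. At the terminal time
  \<open>killed_tail\<close> is the indicator of \<open>{a<..}\<close> on positive arguments, so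
  the surviving part is a probability.\<close>
lemma grid_identity:
  assumes brown: "brownian_with_initial_law \<mu> M X0 B"
    and "0 < \<alpha>" "0 \<le> a" "0 < h"
  defines "Y \<equiv> drifted_path \<alpha> X0 B"
  shows "measure M {\<omega> \<in> space M. positive_on_grid Y h n \<omega> \<and> a < Y (real n * h) \<omega>}
    = (\<integral>x. indicator {0<..} x * killed_tail \<alpha> a (real n * h) x \<partial>\<mu>) - (\<integral>\<omega>. exit_error \<alpha> a Y h n \<omega> \<partial>M)"
    and "exit_error \<alpha> a Y h n \<in> borel_measurable M"
proof -
  interpret prob_space M by (rule brownian_with_initial_lawD[OF brown])
  have Y [measurable]: "Y (real i * h) \<in> borel_measurable M" for i
    unfolding Y_def using assms by (intro drifted_path_measurable[OF brown]) auto
  have [measurable]: "Measurable.pred M (positive_on_grid Y h k)" for k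
    unfolding Y_def using assms by (intro positive_on_grid_measurable drifted_path_measurable[OF brown]) auto
  have [measurable]: "killed_tail \<alpha> a (real j * h) \<in> borel_measurable borel" for j
    using assms by simp
  show "exit_error \<alpha> a Y h n \<in> borel_measurable M"
    unfolding exit_error_def[abs_def] by measurable
  let ?p = "\<lambda>k \<omega>. killed_tail \<alpha> a (real (n - k) * h) (Y (real k * h) \<omega>)"
  let ?A = "\<lambda>k \<omega>. of_bool (positive_on_grid Y h k \<omega>) :: real"
  have bound: "\<bar>?p k \<omega>\<bar> \<le> 1" for k \<omega>
    using assms by (intro abs_killed_tail_le_1) auto
  have int: "integrable M (\<lambda>\<omega>. ?A i \<omega> * ?p k \<omega>)" for i k
    by (rule integrable_const_bound[where B=1]) (use bound in \<open>auto simp: abs_mult\<close>)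
  have step: "(\<integral>\<omega>. ?A k \<omega> * ?p (Suc k) \<omega> \<partial>M) = (\<integral>\<omega>. ?A k \<omega> * ?p k \<omega> \<partial>M)" if "k < n" for k
  proof -
    have "real (n - Suc k) * h + h = real (n - k) * h" using that
      by (metis Suc_diff_Suc add.commute distrib_left mult.commute mult.right_neutral of_nat_Suc)
    then show ?thesis
      using grid_step[OF brown assms(2,3,4), of "real (n - Suc k) * h" k] assms(4)
      unfolding Y_def by simp
  qed
  have "(\<integral>\<omega>. exit_error \<alpha> a Y h n \<omega> \<partial>M) = (\<Sum>k<n. \<integral>\<omega>. ?A k \<omega> * ?p (Suc k) \<omega> - ?A (Suc k) \<omega> * ?p (Suc k) \<omega> \<partial>M)"
    unfolding exit_error_def left_diff_distrib 
    by (rule Bochner_Integration.integral_sum) (rule Bochner_Integration.integrable_diff[OF int int])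
  also have "\<dots> = (\<Sum>k<n. (\<integral>\<omega>. ?A k \<omega> * ?p k \<omega> \<partial>M) - (\<integral>\<omega>. ?A (Suc k) \<omega> * ?p (Suc k) \<omega> \<partial>M))"
    by (intro sum.cong refl, subst Bochner_Integration.integral_diff[OF int int]) (use step in auto)
  also have "\<dots> = (\<integral>\<omega>. ?A 0 \<omega> * ?p 0 \<omega> \<partial>M) - (\<integral>\<omega>. ?A n \<omega> * ?p n \<omega> \<partial>M)"
    by (rule sum_lessThan_telescope')
  also have "(\<integral>\<omega>. ?A n \<omega> * ?p n \<omega> \<partial>M) = (\<integral>\<omega>. indicator {\<omega> \<in> space M. positive_on_grid Y h n \<omega> \<and> a < Y (real n * h) \<omega>} \<omega> \<partial>M)"
  proof (rule Bochner_Integration.integral_cong[OF refl])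
    fix \<omega> assume w: "\<omega> \<in> space M"
    show "?A n \<omega> * ?p n \<omega> = indicator {\<omega> \<in> space M. positive_on_grid Y h n \<omega> \<and> a < Y (real n * h) \<omega>} \<omega>"
    proof (cases "positive_on_grid Y h n \<omega>")
      case True
      then have "0 < Y (real n * h) \<omega>" by (auto simp: positive_on_grid_def)
      with True w show ?thesis using assms(3)
        by (simp add: killed_tail_def gauss_tail_def gauss_law_def measure_return indicator_def)
    qed simp
  qed
  also have "\<dots> = measure M {\<omega> \<in> space M. positive_on_grid Y h n \<omega> \<and> a < Y (real n * h) \<omega>}"
    by simp
  also have "(\<integral>\<omega>. ?A 0 \<omega> * ?p 0 \<omega> \<partial>M) = (\<integral>\<omega>. indicator {0<..} (X0 \<omega>) * killed_tail \<alpha> a (real n * h) (X0 \<omega>) \<partial>M)"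
  proof (rule Bochner_Integration.integral_cong[OF refl])
    fix \<omega> assume w: "\<omega> \<in> space M"
    have "Y 0 \<omega> = X0 \<omega>" using brownian_with_initial_lawD(5)[OF brown w] by (simp add: Y_def drifted_path_def)
    then show "?A 0 \<omega> * ?p 0 \<omega> = indicator {0<..} (X0 \<omega>) * killed_tail \<alpha> a (real n * h) (X0 \<omega>)"
      by (simp add: positive_on_grid_def indicator_def)
  qed
  also have "\<dots> = (\<integral>x. indicator {0<..} x * killed_tail \<alpha> a (real n * h) x \<partial>\<mu>)"
    unfolding brownian_with_initial_lawD(3)[OF brown, symmetric]
    using brownian_with_initial_lawD(2)[OF brown] by (subst integral_distr) auto
  finally show "measure M {\<omega> \<in> space M. positive_on_grid Y h n \<omega> \<and> a < Y (real n * h) \<omega>}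
    = (\<integral>x. indicator {0<..} x * killed_tail \<alpha> a (real n * h) x \<partial>\<mu>) - (\<integral>\<omega>. exit_error \<alpha> a Y h n \<omega> \<partial>M)"
    by simp
qed

text \<open>By uniform continuity the overshoot below 0 is at most the oscillation of the path over one
  mesh, and \<open>killed_tail_boundary\<close> is linear in the overshoot.\<close>
lemma exit_error_tendsto_0:
  assumes "0 < \<alpha>" "0 < a" "0 < t" and cont: "continuous_on {0..t} (\<lambda>u. Y u \<omega>)"
  shows "(\<lambda>m. exit_error \<alpha> a Y (t / 2 ^ m) (2 ^ m) \<omega>) \<longlonglongrightarrow> 0"
proof (rule LIMSEQ_I)
  fix e :: real assume e: "0 < e"
  define c where "c = 4 / a + 2 * \<alpha>"
  have c: "0 < c" using assms by (simp add: c_def add_pos_pos)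
  \<comment> \<open>An overshoot of at most \<open>a / 2\<close> lies in the range of the boundary
    estimate.\<close>
  define \<eta> where "\<eta> = min (a / 2) (e / (2 * c))"
  have \<eta>: "0 < \<eta>" "\<eta> \<le> a / 2" "c * \<eta> < e"
  proof -
    show "0 < \<eta>" "\<eta> \<le> a / 2" using e c assms by (auto simp: \<eta>_def)
    have "c * \<eta> \<le> c * (e / (2 * c))" using c by (intro mult_left_mono) (auto simp: \<eta>_def)
    also have "\<dots> < e" using c e by simp
    finally show "c * \<eta> < e" .
  qed
  have "uniformly_continuous_on {0..t} (\<lambda>u. Y u \<omega>)"
    using cont by (intro compact_uniformly_continuous) auto
  then obtain \<delta> where \<delta>: "0 < \<delta>"
    "\<And>u v. u \<in> {0..t} \<Longrightarrow> v \<in> {0..t} \<Longrightarrow> dist v u < \<delta> \<Longrightarrow> dist (Y v \<omega>) (Y u \<omega>) < \<eta>"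
    using \<eta>(1) unfolding uniformly_continuous_on_def by metis
  have "(\<lambda>m. t / 2 ^ m) \<longlonglongrightarrow> 0" by real_asymp
  then have "\<forall>\<^sub>F m in sequentially. t / 2 ^ m < \<delta>" using \<delta>(1) by (rule order_tendstoD)
  then obtain N where N: "\<And>m. N \<le> m \<Longrightarrow> t / 2 ^ m < \<delta>" by (auto simp: eventually_sequentially)
  have "norm (exit_error \<alpha> a Y (t / 2 ^ m) (2 ^ m) \<omega> - 0) < e" if m: "N \<le> m" for m
  proof -
    let ?h = "t / 2 ^ m"
    have h: "0 < ?h" "real (2 ^ m) * ?h = t" using assms by auto
    have "\<bar>exit_error \<alpha> a Y ?h (2 ^ m) \<omega>\<bar> \<le> c * \<eta>"
    proof (rule abs_exit_error_le)
      fix k :: nat assume k: "k < 2 ^ m" "positive_on_grid Y ?h k \<omega>" "\<not> positive_on_grid Y ?h (Suc k) \<omega>"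
      let ?u = "real k * ?h" and ?v = "real (Suc k) * ?h"
      have v0: "0 \<le> ?v" using h by (intro mult_nonneg_nonneg) auto
      have "?v \<le> real (2 ^ m) * ?h" using k(1) h by (intro mult_right_mono) (auto simp del: of_nat_power)
      then have v: "?v \<in> {0..t}" unfolding h(2) using v0 by (simp only: atLeastAtMost_iff)
      have d: "?v - ?u = ?h" by (simp add: algebra_simps add_divide_distrib)
      then have "?u \<le> t" using v h(1) unfolding atLeastAtMost_iff by linarith
      moreover have "0 \<le> ?u" using h by (intro mult_nonneg_nonneg) auto
      ultimately have u: "?u \<in> {0..t}" by (simp only: atLeastAtMost_iff)
      have pos: "0 < Y ?u \<omega>" using k(2) by (auto simp: positive_on_grid_def)
      have neg: "Y ?v \<omega> \<le> 0" using k(2,3) by (auto simp: positive_on_grid_Suc)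
      have "dist (Y ?v \<omega>) (Y ?u \<omega>) < \<eta>"
        using \<delta>(2)[OF u v] N[OF m] d h by (simp add: dist_real_def)
      then have near: "- \<eta> \<le> Y ?v \<omega>" using pos neg by (simp add: dist_real_def)
      have "\<bar>killed_tail \<alpha> a (real (2 ^ m - Suc k) * ?h) (Y ?v \<omega>)\<bar> \<le> c * \<bar>Y ?v \<omega>\<bar>"
        unfolding c_def using near neg \<eta> assms h by (intro killed_tail_boundary mult_nonneg_nonneg) linarith+
      also have "\<dots> \<le> c * \<eta>" using near neg c by (intro mult_left_mono) auto
      finally show "\<bar>killed_tail \<alpha> a (real (2 ^ m - Suc k) * ?h) (Y ?v \<omega>)\<bar> \<le> c * \<eta>" .
    qed (use c \<eta> in auto)
    then show ?thesis using \<eta>(3) by simp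
  qed
  then show "\<exists>N. \<forall>m\<ge>N. norm (exit_error \<alpha> a Y (t / 2 ^ m) (2 ^ m) \<omega> - 0) < e" by blast
qed

lemma grid_survival_limit:
  assumes brown: "brownian_with_initial_law \<mu> M X0 B" and "0 < \<alpha>" "0 < a" "0 < t"
  defines "Y \<equiv> drifted_path \<alpha> X0 B"
  shows "(\<lambda>m. measure M {\<omega> \<in> space M. positive_on_grid Y (t / 2 ^ m) (2 ^ m) \<omega> \<and> a < Y t \<omega>})
    \<longlonglongrightarrow> (\<integral>x. indicator {0<..} x * killed_tail \<alpha> a t x \<partial>\<mu>)"
proof -
  interpret prob_space M by (rule brownian_with_initial_lawD[OF brown])
  have h: "0 < t / 2 ^ m" "real (2 ^ m) * (t / 2 ^ m) = t" for m using assms by auto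
  have "(\<lambda>m. \<integral>\<omega>. exit_error \<alpha> a Y (t / 2 ^ m) (2 ^ m) \<omega> \<partial>M) \<longlonglongrightarrow> (\<integral>\<omega>. 0 \<partial>M)"
  proof (rule integral_dominated_convergence[where w="\<lambda>_. 1"])
    show "AE \<omega> in M. (\<lambda>m. exit_error \<alpha> a Y (t / 2 ^ m) (2 ^ m) \<omega>) \<longlonglongrightarrow> 0"
      unfolding Y_def
      by (intro AE_I2 exit_error_tendsto_0 assms continuous_on_subset[OF drifted_path_continuous[OF brown]]) auto
    show "AE \<omega> in M. norm (exit_error \<alpha> a Y (t / 2 ^ m) (2 ^ m) \<omega>) \<le> 1" for m
      unfolding real_norm_def
      by (intro AE_I2 abs_exit_error_le abs_killed_tail_le_1 mult_nonneg_nonneg of_nat_0_le_iff)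
        (use assms in auto)
    show "exit_error \<alpha> a Y (t / 2 ^ m) (2 ^ m) \<in> borel_measurable M" for m
      unfolding Y_def using assms by (intro grid_identity(2)[OF brown]) auto
  qed auto
  then have "(\<lambda>m. (\<integral>x. indicator {0<..} x * killed_tail \<alpha> a t x \<partial>\<mu>)
      - (\<integral>\<omega>. exit_error \<alpha> a Y (t / 2 ^ m) (2 ^ m) \<omega> \<partial>M)) \<longlonglongrightarrow> (\<integral>x. indicator {0<..} x * killed_tail \<alpha> a t x \<partial>\<mu>) - 0"
    by (intro tendsto_diff tendsto_const) simp
  moreover have "measure M {\<omega> \<in> space M. positive_on_grid Y (t / 2 ^ m) (2 ^ m) \<omega> \<and> a < Y t \<omega>}
     = (\<integral>x. indicator {0<..} x * killed_tail \<alpha> a t x \<partial>\<mu>) - (\<integral>\<omega>. exit_error \<alpha> a Y (t / 2 ^ m) (2 ^ m) \<omega> \<partial>M)" for m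
    using grid_identity(1)[OF brown assms(2) less_imp_le[OF assms(3)] h(1)[of m], of "2 ^ m"] 
    unfolding h(2) Y_def .
  ultimately show ?thesis by simp
qed

section \<open>Survival in continuous time\<close>

lemma dyadic_grid_dense:
  assumes "0 < t" "u \<in> {0..t}"
  obtains v :: "nat \<Rightarrow> nat" where "\<And>m. v m \<le> 2 ^ m" "(\<lambda>m. real (v m) * (t / 2 ^ m)) \<longlonglongrightarrow> u"
proof
  define v where "v m = nat \<lfloor>u * 2 ^ m / t\<rfloor>" for m :: nat
  have nn: "0 \<le> u * 2 ^ m / t" for m using assms by auto
  have rv: "real (v m) = of_int \<lfloor>u * 2 ^ m / t\<rfloor>" for m using nn[of m] by (simp add: v_def)
  have ub: "real (v m) \<le> u * 2 ^ m / t" and lb: "u * 2 ^ m / t - 1 \<le> real (v m)" for m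
    unfolding rv by linarith+
  show "v m \<le> 2 ^ m" for m
  proof -
    have "u * 2 ^ m / t \<le> t * 2 ^ m / t" using assms by (intro divide_right_mono mult_right_mono) auto
    also have "t * 2 ^ m / t = real (2 ^ m)" using assms by simp
    finally have "real (v m) \<le> real (2 ^ m)" using ub[of m] by (rule order_trans[rotated])
    then show ?thesis unfolding of_nat_le_iff .
  qed
  show "(\<lambda>m. real (v m) * (t / 2 ^ m)) \<longlonglongrightarrow> u"
  proof (rule tendsto_sandwich)
    show "\<forall>\<^sub>F m in sequentially. u - t / 2 ^ m \<le> real (v m) * (t / 2 ^ m)"
    proof (intro always_eventually allI)
      fix m
      have "(u * 2 ^ m / t - 1) * (t / 2 ^ m) \<le> real (v m) * (t / 2 ^ m)"
        using lb[of m] assms by (intro mult_right_mono) auto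
      then show "u - t / 2 ^ m \<le> real (v m) * (t / 2 ^ m)"
        using assms by (simp add: left_diff_distrib diff_divide_distrib)
    qed
    show "\<forall>\<^sub>F m in sequentially. real (v m) * (t / 2 ^ m) \<le> u"
    proof (intro always_eventually allI)
      fix m
      have "real (v m) * (t / 2 ^ m) \<le> u * 2 ^ m / t * (t / 2 ^ m)"
        using ub[of m] assms by (intro mult_right_mono) auto
      then show "real (v m) * (t / 2 ^ m) \<le> u" using assms by simp
    qed
    show "(\<lambda>m. u - t / 2 ^ m) \<longlonglongrightarrow> u" by real_asymp
  qed auto
qed

text \<open>The margin \<open>1 / (j + 1)\<close> makes the passage to the limit lossless: a continuous path
  that is positive on a compact interval is bounded away from 0, and conversely a margin on a
  dense set of times survives in the closure.\<close>
lemma positive_path_iff_dyadic: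
  assumes "0 < t" and cont: "continuous_on {0..} (\<lambda>u. Y u \<omega> :: real)"
  shows "(\<forall>u\<in>{0..t}. 0 < Y u \<omega>) \<and> a < Y t \<omega> \<longleftrightarrow>
    (\<exists>j. \<forall>m. positive_on_grid (\<lambda>u \<omega>. Y u \<omega> - 1 / real (Suc j)) (t / 2 ^ m) (2 ^ m) \<omega> \<and> a < Y t \<omega> - 1 / real (Suc j))"
    (is "?L \<longleftrightarrow> ?R")
proof
  assume L: ?L
  have cont': "continuous_on {0..t} (\<lambda>u. Y u \<omega>)" by (rule continuous_on_subset[OF cont]) auto
  then obtain u where u: "u \<in> {0..t}" "\<And>v. v \<in> {0..t} \<Longrightarrow> Y u \<omega> \<le> Y v \<omega>"
    using continuous_attains_inf[of "{0..t}" "\<lambda>u. Y u \<omega>"] assms by auto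
  have "0 < min (Y u \<omega>) (Y t \<omega> - a)" using L u by auto
  then obtain j where j: "1 / real (Suc j) < min (Y u \<omega>) (Y t \<omega> - a)"
    using nat_approx_posE by metis
  have "positive_on_grid (\<lambda>u \<omega>. Y u \<omega> - 1 / real (Suc j)) (t / 2 ^ m) (2 ^ m) \<omega>" for m
    unfolding positive_on_grid_def
  proof (intro allI impI)
    fix i :: nat assume "i \<le> 2 ^ m"
    then have "real i \<le> 2 ^ m" by (metis of_nat_le_iff of_nat_numeral of_nat_power)
    then have "real i * (t / 2 ^ m) \<le> 2 ^ m * (t / 2 ^ m)" using assms by (intro mult_right_mono) auto
    then have "real i * (t / 2 ^ m) \<in> {0..t}" using assms by simp
    from u(2)[OF this] j show "0 < Y (real i * (t / 2 ^ m)) \<omega> - 1 / real (Suc j)" by simp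
  qed
  then show ?R using j by (intro exI[of _ j]) auto
next
  assume ?R
  then obtain j where j: "\<And>m. positive_on_grid (\<lambda>u \<omega>. Y u \<omega> - 1 / real (Suc j)) (t / 2 ^ m) (2 ^ m) \<omega>"
    "a < Y t \<omega> - 1 / real (Suc j)" by blast
  have pos: "0 < 1 / real (Suc j)" by simp
  have "0 < Y u \<omega>" if u: "u \<in> {0..t}" for u
  proof -
    obtain v :: "nat \<Rightarrow> nat" where v: "\<And>m. v m \<le> 2 ^ m" "(\<lambda>m. real (v m) * (t / 2 ^ m)) \<longlonglongrightarrow> u"
      using dyadic_grid_dense[OF assms(1) u] by blast
    have "(\<lambda>m. Y (real (v m) * (t / 2 ^ m)) \<omega>) \<longlonglongrightarrow> Y u \<omega>"
      by (rule continuous_on_tendsto_compose[OF cont v(2)]) (use u assms in auto)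
    moreover have "1 / real (Suc j) \<le> Y (real (v m) * (t / 2 ^ m)) \<omega>" for m
      using j(1)[of m] v(1)[of m] by (force simp: positive_on_grid_def)
    ultimately have "1 / real (Suc j) \<le> Y u \<omega>" by (intro LIMSEQ_le_const) auto
    then show ?thesis using pos by linarith
  qed
  then show ?L using j(2) pos by (smt (verit))
qed

lemma positive_on_dyadic_grid_Suc:
  assumes "positive_on_grid Y (t / 2 ^ Suc m) (2 ^ Suc m) \<omega>"
  shows "positive_on_grid Y (t / 2 ^ m) (2 ^ m) \<omega>"
  unfolding positive_on_grid_def
proof (intro allI impI)
  fix i :: nat assume "i \<le> 2 ^ m"
  then have "2 * i \<le> 2 ^ Suc m" by simp
  then have "0 < Y (real (2 * i) * (t / 2 ^ Suc m)) \<omega>" using assms unfolding positive_on_grid_def by blast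
  then show "0 < Y (real i * (t / 2 ^ m)) \<omega>" by simp
qed

text \<open>The dyadic description is a countable combination of events at fixed times.\<close>
lemma positive_path_event_measurable:
  fixes Y :: "real \<Rightarrow> 'a \<Rightarrow> real"
  assumes "0 < t" and meas: "\<And>u. 0 \<le> u \<Longrightarrow> Y u \<in> borel_measurable M"
    and cont: "\<And>\<omega>. \<omega> \<in> space M \<Longrightarrow> continuous_on {0..} (\<lambda>u. Y u \<omega> :: real)"
  shows "{\<omega> \<in> space M. (\<forall>u\<in>{0..t}. 0 < Y u \<omega>) \<and> a < Y t \<omega>} \<in> sets M"
proof -
  have [measurable]: "Y t \<in> borel_measurable M" using meas[of t] assms(1) by simp
  have [measurable]: "Measurable.pred M (positive_on_grid (\<lambda>u \<omega>. Y u \<omega> - 1 / real (Suc j)) (t / 2 ^ m) (2 ^ m))" for j m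
    using assms by (intro positive_on_grid_measurable) auto
  have "{\<omega> \<in> space M. (\<forall>u\<in>{0..t}. 0 < Y u \<omega>) \<and> a < Y t \<omega>} = {\<omega> \<in> space M.
     \<exists>j. \<forall>m. positive_on_grid (\<lambda>u \<omega>. Y u \<omega> - 1 / real (Suc j)) (t / 2 ^ m) (2 ^ m) \<omega> \<and> a < Y t \<omega> - 1 / real (Suc j)}"
    using positive_path_iff_dyadic[where Y=Y and a=a, OF assms(1) cont] by (intro Collect_cong conj_cong refl) 
  also have "\<dots> \<in> sets M" by measurable
  finally show ?thesis .
qed

text \<open>The event is the increasing limit in \<open>j\<close> of events with margin \<open>1 / (j +
  1)\<close>, each of which is the decreasing limit of its dyadic grid versions. The inner limit
  is \<open>grid_survival_limit\<close> for the process started at \<open>X0 - 1 / (j +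
  1)\<close>; the outer one follows from continuity of \<open>killed_tail\<close> in the
  starting point.\<close>
lemma positive_path_prob_pos_level:
  assumes brown: "brownian_with_initial_law \<mu> M X0 B" and "0 < \<alpha>" "0 < a" "0 < t"
  defines "Y \<equiv> drifted_path \<alpha> X0 B"
  shows "measure M {\<omega> \<in> space M. (\<forall>u\<in>{0..t}. 0 < Y u \<omega>) \<and> a < Y t \<omega>}
    = (\<integral>x. indicator {0<..} x * killed_tail \<alpha> a t x \<partial>\<mu>)"
proof -
  interpret prob_space M by (rule brownian_with_initial_lawD[OF brown])
  have X0 [measurable]: "X0 \<in> borel_measurable M" by (rule brownian_with_initial_lawD[OF brown])
  have \<mu>: "\<mu> = distr M borel X0" using brownian_with_initial_lawD(3)[OF brown] by simp
  have "prob_space \<mu>" unfolding \<mu> by (rule prob_space_distr) simp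
  then interpret m: prob_space \<mu> .
  have sets_\<mu> [measurable_cong]: "sets \<mu> = sets borel" by (simp add: \<mu>)
  let ?e = "\<lambda>j. 1 / real (Suc j)"
  let ?Y = "\<lambda>j u \<omega>. Y u \<omega> - ?e j"
  define G where "G j m = {\<omega> \<in> space M. positive_on_grid (?Y j) (t / 2 ^ m) (2 ^ m) \<omega> \<and> a < ?Y j t \<omega>}" for j m
  define Q where "Q \<epsilon> = (\<integral>x. indicator {0<..} (x - \<epsilon>) * killed_tail \<alpha> a t (x - \<epsilon>) \<partial>\<mu>)" for \<epsilon>
  have [measurable]: "killed_tail \<alpha> a t \<in> borel_measurable borel" using assms by simp
  have [measurable]: "Y t \<in> borel_measurable M"
    unfolding Y_def by (intro drifted_path_measurable[OF brown]) (use assms in simp)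
  have [measurable]: "Measurable.pred M (positive_on_grid (?Y j) (t / 2 ^ m) (2 ^ m))" for j m
    unfolding Y_def using assms by (intro positive_on_grid_measurable borel_measurable_diff drifted_path_measurable[OF brown]) auto
  have G [measurable]: "G j m \<in> events" for j m unfolding G_def by measurable
  have G_lim: "(\<lambda>m. prob (G j m)) \<longlonglongrightarrow> Q (?e j)" for j
  proof -
    have brown': "brownian_with_initial_law (distr \<mu> borel (\<lambda>x. x - ?e j)) M (\<lambda>\<omega>. X0 \<omega> - ?e j) B"
      by (rule brownian_with_initial_law_map[OF brown]) simp
    have shift: "drifted_path \<alpha> (\<lambda>\<omega>. X0 \<omega> - ?e j) B = ?Y j"
      by (intro ext) (simp add: Y_def drifted_path_def)
    have "(\<lambda>m. prob (G j m)) \<longlonglongrightarrow> (\<integral>x. indicator {0<..} x * killed_tail \<alpha> a t x \<partial>distr \<mu> borel (\<lambda>x. x - ?e j))"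
      using grid_survival_limit[OF brown' assms(2-4)] unfolding shift G_def .
    also have "(\<integral>x. indicator {0<..} x * killed_tail \<alpha> a t x \<partial>distr \<mu> borel (\<lambda>x. x - ?e j)) = Q (?e j)"
      unfolding Q_def by (rule integral_distr) auto
    finally show ?thesis .
  qed
  have "decseq (G j)" for j
  proof (intro decseq_SucI subsetI)
    fix m \<omega> assume "\<omega> \<in> G j (Suc m)"
    then show "\<omega> \<in> G j m" using positive_on_dyadic_grid_Suc[of "?Y j" t m \<omega>] unfolding G_def by blast
  qed
  then have "(\<lambda>m. prob (G j m)) \<longlonglongrightarrow> prob (\<Inter>m. G j m)" for j
    by (intro finite_Lim_measure_decseq) auto
  then have F: "prob (\<Inter>m. G j m) = Q (?e j)" for j
    using G_lim LIMSEQ_unique by blast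
  have "incseq (\<lambda>j. \<Inter>m. G j m)"
  proof (intro incseq_SucI INF_mono subsetI bexI)
    fix j m \<omega> assume "\<omega> \<in> G j m"
    moreover have "?e (Suc j) \<le> ?e j" by (simp add: frac_le)
    then have "0 < ?Y j u \<omega> \<Longrightarrow> 0 < ?Y (Suc j) u \<omega>" "a < ?Y j u \<omega> \<Longrightarrow> a < ?Y (Suc j) u \<omega>" for u
      by linarith+
    ultimately show "\<omega> \<in> G (Suc j) m" unfolding G_def positive_on_grid_def by blast
  qed simp
  then have lim: "(\<lambda>j. prob (\<Inter>m. G j m)) \<longlonglongrightarrow> prob (\<Union>j. \<Inter>m. G j m)"
    by (intro finite_Lim_measure_incseq) auto
  have event: "(\<Union>j. \<Inter>m. G j m) = {\<omega> \<in> space M. (\<forall>u\<in>{0..t}. 0 < Y u \<omega>) \<and> a < Y t \<omega>}"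
  proof -
    have "\<omega> \<in> (\<Union>j. \<Inter>m. G j m) \<longleftrightarrow> (\<forall>u\<in>{0..t}. 0 < Y u \<omega>) \<and> a < Y t \<omega>" if w: "\<omega> \<in> space M" for \<omega>
      using positive_path_iff_dyadic[where Y=Y and a=a and t=t and \<omega>=\<omega>] assms(4) drifted_path_continuous[OF brown w, of \<alpha>] w
      unfolding G_def Y_def by auto
    moreover have "(\<Union>j. \<Inter>m. G j m) \<subseteq> space M" unfolding G_def by blast
    ultimately show ?thesis by blast
  qed
  have "(\<lambda>j. Q (?e j)) \<longlonglongrightarrow> (\<integral>x. indicator {0<..} x * killed_tail \<alpha> a t x \<partial>\<mu>)"
    unfolding Q_def
  proof (rule integral_dominated_convergence[where w="\<lambda>_. 1"])
    show "AE x in \<mu>. (\<lambda>j. indicator {0<..} (x - ?e j) * killed_tail \<alpha> a t (x - ?e j)) \<longlonglongrightarrow> indicator {0<..} x * killed_tail \<alpha> a t x"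
    proof (rule AE_I2)
      fix x :: real
      have e0: "?e \<longlonglongrightarrow> 0" by real_asymp
      show "(\<lambda>j. indicator {0<..} (x - ?e j) * killed_tail \<alpha> a t (x - ?e j)) \<longlonglongrightarrow> indicator {0<..} x * killed_tail \<alpha> a t x"
      proof (cases "0 < x")
        case True
        have "(\<lambda>j. x - ?e j) \<longlonglongrightarrow> x - 0" by (intro tendsto_intros e0)
        then have "(\<lambda>j. killed_tail \<alpha> a t (x - ?e j)) \<longlonglongrightarrow> killed_tail \<alpha> a t x"
          using isCont_tendsto_compose[OF isCont_killed_tail[OF assms(4)]] by simp
        moreover have "\<forall>\<^sub>F j in sequentially. killed_tail \<alpha> a t (x - ?e j) = indicator {0<..} (x - ?e j) * killed_tail \<alpha> a t (x - ?e j)"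
          using order_tendstoD(2)[OF e0 True] by eventually_elim simp
        ultimately show ?thesis using True by (auto intro: Lim_transform_eventually)
      next
        case False
        moreover have "\<not> 0 < x - ?e j" for j
        proof -
          have "0 < ?e j" by simp
          with False show ?thesis by linarith
        qed
        ultimately show ?thesis by simp
      qed
    qed
    show "AE x in \<mu>. norm (indicator {0<..} (x - ?e j) * killed_tail \<alpha> a t (x - ?e j)) \<le> 1" for j
      using abs_killed_tail_le_1[of \<alpha> t a] assms by (intro AE_I2) (auto simp: abs_mult indicator_def)
  qed auto
  from LIMSEQ_unique[OF lim[unfolded F event] this] show ?thesis .
qed

text \<open>The level \<open>a = 0\<close>, where \<open>killed_tail_boundary\<close> is not available, is
  reached by monotone limits from positive levels.\<close>
lemma positive_path_prob:
  assumes brown: "brownian_with_initial_law \<mu> M X0 B" and nonneg: "AE x in \<mu>. 0 \<le> x"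
    and "0 < \<alpha>" "0 \<le> a" "0 < t"
  defines "Y \<equiv> drifted_path \<alpha> X0 B"
  shows "measure M {\<omega> \<in> space M. (\<forall>u\<in>{0..t}. 0 < Y u \<omega>) \<and> a < Y t \<omega>} = (\<integral>x. killed_tail \<alpha> a t x \<partial>\<mu>)"
proof -
  interpret prob_space M by (rule brownian_with_initial_lawD[OF brown])
  have X0 [measurable]: "X0 \<in> borel_measurable M" by (rule brownian_with_initial_lawD[OF brown])
  have \<mu>: "\<mu> = distr M borel X0" using brownian_with_initial_lawD(3)[OF brown] by simp
  have "prob_space \<mu>" unfolding \<mu> by (rule prob_space_distr) simp
  then interpret m: prob_space \<mu> .
  have sets_\<mu> [measurable_cong]: "sets \<mu> = sets borel" by (simp add: \<mu>)
  have [measurable]: "killed_tail \<alpha> b t \<in> borel_measurable borel" for b using assms by simp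
  have event: "{\<omega> \<in> space M. (\<forall>u\<in>{0..t}. 0 < Y u \<omega>) \<and> b < Y t \<omega>} \<in> events" for b
    unfolding Y_def using assms
    by (intro positive_path_event_measurable drifted_path_measurable[OF brown] drifted_path_continuous[OF brown])
  have pos: "measure M {\<omega> \<in> space M. (\<forall>u\<in>{0..t}. 0 < Y u \<omega>) \<and> b < Y t \<omega>} = (\<integral>x. killed_tail \<alpha> b t x \<partial>\<mu>)"
    if "0 < b" for b
  proof -
    have "(\<integral>x. indicator {0<..} x * killed_tail \<alpha> b t x \<partial>\<mu>) = (\<integral>x. killed_tail \<alpha> b t x \<partial>\<mu>)"
    proof (rule integral_cong_AE)
      show "AE x in \<mu>. indicator {0<..} x * killed_tail \<alpha> b t x = killed_tail \<alpha> b t x"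
        using nonneg
      proof eventually_elim
        case (elim x)
        then show ?case by (cases "x = 0") auto
      qed
    qed auto
    then show ?thesis
      using positive_path_prob_pos_level[OF brown assms(3) that assms(5)] unfolding Y_def by simp
  qed
  show ?thesis
  proof (cases "a = 0")
    case False
    then show ?thesis using pos[of a] assms by simp
  next
    case True
    let ?e = "\<lambda>j. 1 / real (Suc j)"
    let ?E = "\<lambda>b. {\<omega> \<in> space M. (\<forall>u\<in>{0..t}. 0 < Y u \<omega>) \<and> b < Y t \<omega>}"
    have e0: "?e \<longlonglongrightarrow> 0" by real_asymp
    have "incseq (\<lambda>j. ?E (?e j))"
    proof (intro incseq_SucI subsetI)
      fix j \<omega> assume "\<omega> \<in> ?E (?e j)"
      moreover have "?e (Suc j) \<le> ?e j" by (simp add: frac_le)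
      then have "?e j < Y t \<omega> \<Longrightarrow> ?e (Suc j) < Y t \<omega>" by linarith
      ultimately show "\<omega> \<in> ?E (?e (Suc j))" by blast
    qed
    then have lim: "(\<lambda>j. prob (?E (?e j))) \<longlonglongrightarrow> prob (\<Union>j. ?E (?e j))"
      using event by (intro finite_Lim_measure_incseq) auto
    have union: "(\<Union>j. ?E (?e j)) = ?E 0"
    proof
      show "?E 0 \<subseteq> (\<Union>j. ?E (?e j))"
      proof
        fix \<omega> assume w: "\<omega> \<in> ?E 0"
        then have "0 < Y t \<omega>" by simp
        then obtain j where "?e j < Y t \<omega>" using nat_approx_posE by metis
        with w show "\<omega> \<in> (\<Union>j. ?E (?e j))" by blast
      qed
      show "(\<Union>j. ?E (?e j)) \<subseteq> ?E 0" using assms(5) by auto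
    qed
    have level: "prob (?E (?e j)) = (\<integral>x. killed_tail \<alpha> (?e j) t x \<partial>\<mu>)" for j by (rule pos) simp
    have "(\<lambda>j. \<integral>x. killed_tail \<alpha> (?e j) t x \<partial>\<mu>) \<longlonglongrightarrow> (\<integral>x. killed_tail \<alpha> 0 t x \<partial>\<mu>)"
    proof (rule integral_dominated_convergence[where w="\<lambda>_. 1"])
      show "AE x in \<mu>. (\<lambda>j. killed_tail \<alpha> (?e j) t x) \<longlonglongrightarrow> killed_tail \<alpha> 0 t x"
        using isCont_tendsto_compose[OF isCont_killed_tail_level[OF assms(5)] e0] by (intro AE_I2)
      show "AE x in \<mu>. norm (killed_tail \<alpha> (?e j) t x) \<le> 1" for j
        using abs_killed_tail_le_1[of \<alpha> t "?e j"] assms by (intro AE_I2) auto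
    qed auto
    from LIMSEQ_unique[OF lim[unfolded level union] this] show ?thesis unfolding True .
  qed
qed

section \<open>The conditional law at a fixed time\<close>

text \<open>The infimum of the zeros is attained, so it exceeds \<open>t\<close> strictly: a path without
  zeros up to \<open>t\<close> has none shortly after \<open>t\<close> either.\<close>
lemma less_hitting_time_iff:
  assumes brown: "brownian_with_initial_law \<mu> M X0 B" and w: "\<omega> \<in> space M" and t: "0 < t"
  shows "ereal t < hitting_time \<alpha> X0 B \<omega> \<longleftrightarrow> (\<forall>u\<in>{0..t}. drifted_path \<alpha> X0 B u \<omega> \<noteq> 0)"
proof
  assume less: "ereal t < hitting_time \<alpha> X0 B \<omega>"
  show "\<forall>u\<in>{0..t}. drifted_path \<alpha> X0 B u \<omega> \<noteq> 0"
  proof (intro ballI notI)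
    fix u assume "u \<in> {0..t}" "drifted_path \<alpha> X0 B u \<omega> = 0"
    then have "hitting_time \<alpha> X0 B \<omega> \<le> ereal u"
      unfolding hitting_time_def by (intro Inf_lower) auto
    also have "\<dots> \<le> ereal t" using \<open>u \<in> {0..t}\<close> by simp
    finally show False using less by simp
  qed
next
  let ?Y = "\<lambda>u. drifted_path \<alpha> X0 B u \<omega>"
  assume nz: "\<forall>u\<in>{0..t}. ?Y u \<noteq> 0"
  have cont: "continuous_on {0..} ?Y" by (rule drifted_path_continuous[OF brown w])
  have "\<exists>d>0. \<forall>u\<in>{0..}. dist u t < d \<longrightarrow> ?Y u \<noteq> 0"
  proof -
    have "\<forall>\<^sub>F u in at t within {0..}. ?Y u \<noteq> 0"
      using cont nz t by (intro tendsto_imp_eventually_ne[of _ "?Y t"]) (auto simp: continuous_on_def)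
    then obtain d where "0 < d" "\<forall>u\<in>{0..}. u \<noteq> t \<and> dist u t < d \<longrightarrow> ?Y u \<noteq> 0"
      unfolding eventually_at by blast
    then show ?thesis using nz t by (intro exI[of _ d]) auto
  qed
  then obtain d where d: "0 < d" "\<And>u. 0 \<le> u \<Longrightarrow> dist u t < d \<Longrightarrow> ?Y u \<noteq> 0" by auto
  have "ereal (t + d) \<le> hitting_time \<alpha> X0 B \<omega>"
    unfolding hitting_time_def
  proof (rule Inf_greatest)
    fix z assume "z \<in> ereal ` {t. 0 \<le> t \<and> ?Y t = 0}"
    then obtain u where u: "z = ereal u" "0 \<le> u" "?Y u = 0" by auto
    have "t < u" using nz u by (meson atLeastAtMost_iff not_le)
    moreover have "\<not> dist u t < d" using d(2) u by blast
    ultimately show "ereal (t + d) \<le> z" using u by (simp add: dist_real_def)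
  qed
  then show "ereal t < hitting_time \<alpha> X0 B \<omega>" using d(1) by (metis less_add_same_cancel1 less_ereal.simps(1) order_less_le_trans)
qed

lemma nonvanishing_path_sign:
  assumes brown: "brownian_with_initial_law \<mu> M X0 B" and w: "\<omega> \<in> space M" and t: "0 < t"
    and nz: "\<forall>u\<in>{0..t}. drifted_path \<alpha> X0 B u \<omega> \<noteq> 0"
  shows "(\<forall>u\<in>{0..t}. 0 < drifted_path \<alpha> X0 B u \<omega>) \<and> 0 < X0 \<omega> \<or>
    (\<forall>u\<in>{0..t}. drifted_path \<alpha> X0 B u \<omega> < 0) \<and> X0 \<omega> < 0"
proof -
  let ?Y = "\<lambda>u. drifted_path \<alpha> X0 B u \<omega>"
  have cont: "continuous_on {0..u} ?Y" for u by (rule continuous_on_subset[OF drifted_path_continuous[OF brown w]]) auto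
  have Y0: "?Y 0 = X0 \<omega>" using brownian_with_initial_lawD(5)[OF brown w] by (simp add: drifted_path_def)
  have "0 < ?Y u" if start: "0 < ?Y 0" "u \<in> {0..t}" for u
  proof (rule ccontr)
    assume "\<not> 0 < ?Y u"
    then obtain v where "0 \<le> v" "v \<le> u" "?Y v = 0"
      using IVT2'[of ?Y u 0 0] cont[of u] start by fastforce
    then show False using nz start by auto
  qed
  moreover have "?Y u < 0" if start: "?Y 0 < 0" "u \<in> {0..t}" for u
  proof (rule ccontr)
    assume "\<not> ?Y u < 0"
    then obtain v where "0 \<le> v" "v \<le> u" "?Y v = 0"
      using IVT'[of ?Y 0 0 u] cont[of u] start by fastforce
    then show False using nz start by auto
  qed
  moreover have "?Y 0 \<noteq> 0" using nz t by auto
  ultimately show ?thesis unfolding Y0 by (metis linorder_neqE_linordered_idom)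
qed

text \<open>A path without zeros up to \<open>t\<close> is either positive or negative throughout, and
  negative paths have probability 0 because \<open>X0\<close> is almost surely non-negative.
  They still have to be shown to form an event, as they belong to the conditioning set.\<close>
lemma cdf_conditional_law:
  assumes brown: "brownian_with_initial_law \<mu> M X0 B" and nonneg: "AE x in \<mu>. 0 \<le> x"
    and "0 < \<alpha>" "0 < t" and survive: "0 < (\<integral>x. killed_tail \<alpha> 0 t x \<partial>\<mu>)"
  shows "cdf (conditional_law \<alpha> M X0 B t) y =
    1 - (\<integral>x. killed_tail \<alpha> (max 0 y) t x \<partial>\<mu>) / (\<integral>x. killed_tail \<alpha> 0 t x \<partial>\<mu>)"
proof -
  interpret prob_space M by (rule brownian_with_initial_lawD[OF brown])
  have X0 [measurable]: "X0 \<in> borel_measurable M" by (rule brownian_with_initial_lawD[OF brown])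
  have \<mu>: "\<mu> = distr M borel X0" using brownian_with_initial_lawD(3)[OF brown] by simp
  let ?Y = "drifted_path \<alpha> X0 B"
  define A where "A = {\<omega> \<in> space M. ereal t < hitting_time \<alpha> X0 B \<omega>}"
  let ?E = "\<lambda>b. {\<omega> \<in> space M. (\<forall>u\<in>{0..t}. 0 < ?Y u \<omega>) \<and> b < ?Y t \<omega>}"
  let ?N = "{\<omega> \<in> space M. (\<forall>u\<in>{0..t}. 0 < - ?Y u \<omega>) \<and> 0 < - ?Y t \<omega>}"
  have E [measurable]: "?E b \<in> events" for b
    by (intro positive_path_event_measurable drifted_path_measurable[OF brown] drifted_path_continuous[OF brown] assms)
  have N [measurable]: "?N \<in> events"
    by (intro positive_path_event_measurable borel_measurable_uminus continuous_on_minus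
       drifted_path_measurable[OF brown] drifted_path_continuous[OF brown] assms)
  have [measurable]: "?Y t \<in> borel_measurable M"
    by (intro drifted_path_measurable[OF brown]) (use assms in simp)
  have A_eq: "A = ?E 0 \<union> ?N"
  proof (intro set_eqI iffI)
    fix \<omega> assume "\<omega> \<in> A"
    then have w: "\<omega> \<in> space M" and "ereal t < hitting_time \<alpha> X0 B \<omega>" by (auto simp: A_def)
    then have "\<forall>u\<in>{0..t}. ?Y u \<omega> \<noteq> 0" using less_hitting_time_iff[OF brown w assms(4)] by blast
    from nonvanishing_path_sign[OF brown w assms(4) this] show "\<omega> \<in> ?E 0 \<union> ?N"
      using w assms(4) by auto
  next
    fix \<omega> assume "\<omega> \<in> ?E 0 \<union> ?N"
    then have w: "\<omega> \<in> space M" and "\<forall>u\<in>{0..t}. ?Y u \<omega> \<noteq> 0" by fastforce+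
    then show "\<omega> \<in> A" using less_hitting_time_iff[OF brown w assms(4)] by (auto simp: A_def)
  qed
  then have A [measurable]: "A \<in> events" using E N by auto
  have X0_nonneg: "AE \<omega> in M. 0 \<le> X0 \<omega>"
    using nonneg unfolding \<mu> by (subst (asm) AE_distr_iff) auto
  have tail: "prob {\<omega> \<in> A. b < ?Y t \<omega>} = (\<integral>x. killed_tail \<alpha> (max 0 b) t x \<partial>\<mu>)" for b
  proof -
    have "prob {\<omega> \<in> A. b < ?Y t \<omega>} = prob (?E (max 0 b))"
    proof (rule finite_measure_eq_AE)
      show "AE \<omega> in M. (\<omega> \<in> {\<omega> \<in> A. b < ?Y t \<omega>}) = (\<omega> \<in> ?E (max 0 b))"
        using X0_nonneg AE_space
      proof eventually_elim
        case (elim \<omega>)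
        have "\<not> (\<forall>u\<in>{0..t}. 0 < - ?Y u \<omega>)"
          using brownian_with_initial_lawD(5)[OF brown elim(2)] elim(1) assms(4)
          by (auto simp: drifted_path_def intro!: bexI[of _ 0])
        then show ?case unfolding A_eq using elim(2) assms(4) by auto
      qed
      have "{\<omega> \<in> A. b < ?Y t \<omega>} = A \<inter> {\<omega> \<in> space M. b < ?Y t \<omega>}" by (auto simp: A_def)
      then show "{\<omega> \<in> A. b < ?Y t \<omega>} \<in> events" by simp
    qed (use E in blast)
    also have "\<dots> = (\<integral>x. killed_tail \<alpha> (max 0 b) t x \<partial>\<mu>)"
      by (rule positive_path_prob[OF brown nonneg]) (use assms in auto)
    finally show ?thesis .
  qed
  have "prob A = prob {\<omega> \<in> A. 0 < ?Y t \<omega>}"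
  proof (rule finite_measure_eq_AE)
    show "AE \<omega> in M. (\<omega> \<in> A) = (\<omega> \<in> {\<omega> \<in> A. 0 < ?Y t \<omega>})"
      using X0_nonneg AE_space
    proof eventually_elim
      case (elim \<omega>)
      have "\<not> (\<forall>u\<in>{0..t}. 0 < - ?Y u \<omega>)"
        using brownian_with_initial_lawD(5)[OF brown elim(2)] elim(1) assms(4)
        by (auto simp: drifted_path_def intro!: bexI[of _ 0])
      then show ?case unfolding A_eq using elim(2) assms(4) by auto
    qed
    have "{\<omega> \<in> A. 0 < ?Y t \<omega>} = A \<inter> {\<omega> \<in> space M. 0 < ?Y t \<omega>}" by (auto simp: A_def)
    then show "{\<omega> \<in> A. 0 < ?Y t \<omega>} \<in> events" by simp
  qed (use A in blast)
  then have PA: "prob A = (\<integral>x. killed_tail \<alpha> 0 t x \<partial>\<mu>)" using tail[of 0] by simp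
  have absorbed: "absorbed_process \<alpha> X0 B t \<omega> = (if \<omega> \<in> A then ?Y t \<omega> else 0)" if "\<omega> \<in> space M" for \<omega>
    using that by (simp add: absorbed_process_def A_def)
  have abs_meas: "absorbed_process \<alpha> X0 B t \<in> borel_measurable M"
    by (subst measurable_cong[OF absorbed]) auto
  have "cdf (conditional_law \<alpha> M X0 B t) y
      = measure (uniform_measure M A) (absorbed_process \<alpha> X0 B t -` {..y} \<inter> space M)"
    unfolding cdf_def conditional_law_def A_def[symmetric]
    using abs_meas by (subst measure_distr) auto
  also have "\<dots> = prob (A \<inter> (absorbed_process \<alpha> X0 B t -` {..y} \<inter> space M)) / prob A"
    using survive PA abs_meas by (intro measure_uniform_measure) (auto simp: emeasure_eq_measure intro: measurable_sets)
  also have "A \<inter> (absorbed_process \<alpha> X0 B t -` {..y} \<inter> space M) = A - {\<omega> \<in> A. y < ?Y t \<omega>}"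
    using absorbed by (auto simp: A_def)
  also have "prob (A - {\<omega> \<in> A. y < ?Y t \<omega>}) = prob A - prob {\<omega> \<in> A. y < ?Y t \<omega>}"
  proof (rule finite_measure_Diff)
    have "{\<omega> \<in> A. y < ?Y t \<omega>} = A \<inter> {\<omega> \<in> space M. y < ?Y t \<omega>}" by (auto simp: A_def)
    then show "{\<omega> \<in> A. y < ?Y t \<omega>} \<in> events" by simp
  qed auto
  finally show ?thesis
    unfolding tail PA using survive by (simp add: diff_divide_distrib)
qed

section \<open>The limiting mass and the quasi-stationary law\<close>

text \<open>The limit of \<open>reflected_mass\<close> as \<open>t\<close> tends to infinity; for \<open>0 <
  z < \<alpha>\<close> it is proportional to the tail of the quasi-stationary law with parameter
  \<open>z\<close>.\<close>
definition limit_mass :: "real \<Rightarrow> real \<Rightarrow> real \<Rightarrow> real" where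
  "limit_mass \<alpha> a z = (LBINT y. indicator {a<..} y * (exp (- \<alpha> * y) * sinh (z * y)))"

lemma has_bochner_integral_exp_tail:
  fixes a c :: real assumes "0 < c"
  shows "has_bochner_integral lborel (\<lambda>y. indicator {a<..} y * exp (- c * y)) (exp (- c * a) / c)"
proof (rule has_bochner_integral_nn_integral)
  have "(\<integral>\<^sup>+y. ennreal (indicator {a<..} y * exp (- c * y)) \<partial>lborel)
     = (\<integral>\<^sup>+y. ennreal (exp (- c * y)) * indicator {a..} y \<partial>lborel)"
  proof (rule nn_integral_cong_AE)
    show "AE y in lborel. ennreal (indicator {a<..} y * exp (- c * y)) = ennreal (exp (- c * y)) * indicator {a..} y"
      using AE_lborel_singleton[of a] by eventually_elim (auto simp: indicator_def)
  qed
  also have "\<dots> = ennreal (0 - (- exp (- c * a) / c))"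
  proof (rule nn_integral_FTC_atLeast)
    show "DERIV (\<lambda>y. - exp (- c * y) / c) x :> exp (- c * x)" for x
      using assms by (auto intro!: derivative_eq_intros)
    show "((\<lambda>y. - exp (- c * y) / c) \<longlongrightarrow> 0) at_top" using assms by real_asymp
  qed auto
  finally show "(\<integral>\<^sup>+y. ennreal (indicator {a<..} y * exp (- c * y)) \<partial>lborel) = ennreal (exp (- c * a) / c)"
    by simp
qed (use assms in auto)

lemma has_bochner_integral_limit_mass:
  fixes a z \<alpha> :: real
  assumes "\<bar>z\<bar> < \<alpha>"
  shows "has_bochner_integral lborel (\<lambda>y. indicator {a<..} y * (exp (- \<alpha> * y) * sinh (z * y)))
    ((exp (- (\<alpha> - z) * a) / (\<alpha> - z) - exp (- (\<alpha> + z) * a) / (\<alpha> + z)) / 2)"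
proof -
  have c: "0 < \<alpha> - z" "0 < \<alpha> + z" using assms by auto
  have "has_bochner_integral lborel
     (\<lambda>y. (indicator {a<..} y * exp (- (\<alpha> - z) * y) - indicator {a<..} y * exp (- (\<alpha> + z) * y)) / 2)
     ((exp (- (\<alpha> - z) * a) / (\<alpha> - z) - exp (- (\<alpha> + z) * a) / (\<alpha> + z)) / 2)"
    by (intro has_bochner_integral_divide_zero has_bochner_integral_diff has_bochner_integral_exp_tail c)
  moreover have "(indicator {a<..} y * exp (- (\<alpha> - z) * y) - indicator {a<..} y * exp (- (\<alpha> + z) * y)) / 2
     = indicator {a<..} y * (exp (- \<alpha> * y) * sinh (z * y))" for y
  proof -
    have "exp (- (\<alpha> - z) * y) = exp (- \<alpha> * y) * exp (z * y)" "exp (- (\<alpha> + z) * y) = exp (- \<alpha> * y) * exp (- (z * y))"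
      unfolding mult_exp_exp by (simp_all add: algebra_simps)
    then show ?thesis by (simp add: sinh_field_def indicator_def right_diff_distrib)
  qed
  ultimately show ?thesis by simp
qed

lemma limit_mass_eq:
  fixes a z \<alpha> :: real
  assumes "\<bar>z\<bar> < \<alpha>"
  shows "limit_mass \<alpha> a z = (exp (- (\<alpha> - z) * a) / (\<alpha> - z) - exp (- (\<alpha> + z) * a) / (\<alpha> + z)) / 2"
  unfolding limit_mass_def by (rule has_bochner_integral_integral_eq[OF has_bochner_integral_limit_mass[OF assms]])

lemma limit_mass_0:
  fixes z \<alpha> :: real
  assumes "\<bar>z\<bar> < \<alpha>"
  shows "limit_mass \<alpha> 0 z = z / (\<alpha>\<^sup>2 - z\<^sup>2)"
proof -
  have "\<alpha> - z \<noteq> 0" "\<alpha> + z \<noteq> 0" using assms by auto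
  then have "(1 / (\<alpha> - z) - 1 / (\<alpha> + z)) / 2 = z / ((\<alpha> - z) * (\<alpha> + z))"
    by (subst diff_frac_eq) auto
  then have "limit_mass \<alpha> 0 z = z / ((\<alpha> - z) * (\<alpha> + z))"
    unfolding limit_mass_eq[OF assms] by simp
  then show ?thesis by (simp add: power2_eq_square algebra_simps)
qed

lemma limit_mass_pos: "0 < z \<Longrightarrow> z < \<alpha> \<Longrightarrow> 0 < limit_mass \<alpha> 0 z"
  by (simp add: limit_mass_0 power_strict_mono)

lemma limit_mass_nonneg: "0 \<le> a \<Longrightarrow> 0 \<le> z \<Longrightarrow> 0 \<le> limit_mass \<alpha> a z"
  unfolding limit_mass_def by (intro integral_nonneg_AE AE_I2) (auto simp: indicator_def)

lemma isCont_limit_mass: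
  fixes a z \<alpha> :: real
  assumes "\<bar>z\<bar> < \<alpha>"
  shows "isCont (limit_mass \<alpha> a) z"
proof -
  have "\<forall>\<^sub>F w in nhds z. limit_mass \<alpha> a w = (exp (- (\<alpha> - w) * a) / (\<alpha> - w) - exp (- (\<alpha> + w) * a) / (\<alpha> + w)) / 2"
  proof (rule eventually_mono[OF eventually_nhds_in_open[of "{- \<alpha><..<\<alpha>}"]])
    show "z \<in> {- \<alpha><..<\<alpha>}" using assms by auto
    fix w assume "w \<in> {- \<alpha><..<\<alpha>}"
    then show "limit_mass \<alpha> a w = (exp (- (\<alpha> - w) * a) / (\<alpha> - w) - exp (- (\<alpha> + w) * a) / (\<alpha> + w)) / 2"
      by (intro limit_mass_eq) auto
  qed auto
  moreover have "isCont (\<lambda>w. (exp (- (\<alpha> - w) * a) / (\<alpha> - w) - exp (- (\<alpha> + w) * a) / (\<alpha> + w)) / 2) z"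
    using assms by (intro continuous_intros) auto
  ultimately show ?thesis by (simp only: isCont_cong)
qed

lemma limit_mass_integrand_bounds:
  fixes a y z w \<alpha> :: real assumes "0 \<le> a" "0 \<le> z" "z \<le> w"
  shows "0 \<le> indicator {a<..} y * (exp (- \<alpha> * y - y\<^sup>2 / (2 * t)) * sinh (z * y))"
    and "0 < t \<Longrightarrow> indicator {a<..} y * (exp (- \<alpha> * y - y\<^sup>2 / (2 * t)) * sinh (z * y))
      \<le> indicator {a<..} y * (exp (- \<alpha> * y) * sinh (w * y))"
    and "indicator {a<..} y * (exp (- \<alpha> * y - y\<^sup>2 / (2 * t)) * sinh (z * y))
      \<le> indicator {a<..} y * (exp (- \<alpha> * y - y\<^sup>2 / (2 * t)) * sinh (w * y))"
proof -
  have s: "0 \<le> sinh (z * y)" "sinh (z * y) \<le> sinh (w * y)" if "a < y"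
    using that assms by (auto intro!: mult_right_mono)
  show "0 \<le> indicator {a<..} y * (exp (- \<alpha> * y - y\<^sup>2 / (2 * t)) * sinh (z * y))"
    using s by (simp add: indicator_def)
  show "indicator {a<..} y * (exp (- \<alpha> * y - y\<^sup>2 / (2 * t)) * sinh (z * y))
      \<le> indicator {a<..} y * (exp (- \<alpha> * y - y\<^sup>2 / (2 * t)) * sinh (w * y))"
    using s by (simp add: indicator_def)
  assume "0 < t"
  then have "exp (- \<alpha> * y - y\<^sup>2 / (2 * t)) \<le> exp (- \<alpha> * y)" by simp
  then show "indicator {a<..} y * (exp (- \<alpha> * y - y\<^sup>2 / (2 * t)) * sinh (z * y))
      \<le> indicator {a<..} y * (exp (- \<alpha> * y) * sinh (w * y))"
    using s by (auto simp: indicator_def intro!: mult_mono)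
qed

lemma integrable_reflected_mass:
  fixes a z t \<alpha> :: real
  assumes "0 \<le> a" "0 \<le> z" "z < \<alpha>" "0 < t"
  shows "integrable lborel (\<lambda>y. indicator {a<..} y * (exp (- \<alpha> * y - y\<^sup>2 / (2 * t)) * sinh (z * y)))"
proof (rule Bochner_Integration.integrable_bound)
  show "integrable lborel (\<lambda>y. indicator {a<..} y * (exp (- \<alpha> * y) * sinh (z * y)))"
    using assms by (intro integrable.intros[OF has_bochner_integral_limit_mass]) auto
  show "(\<lambda>y. indicator {a<..} y * (exp (- \<alpha> * y - y\<^sup>2 / (2 * t)) * sinh (z * y))) \<in> borel_measurable lborel"
    by (simp add: sinh_field_def)
  show "AE y in lborel. norm (indicator {a<..} y * (exp (- \<alpha> * y - y\<^sup>2 / (2 * t)) * sinh (z * y)))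
      \<le> norm (indicator {a<..} y * (exp (- \<alpha> * y) * sinh (z * y)))"
  proof (rule AE_I2)
    fix y
    show "norm (indicator {a<..} y * (exp (- \<alpha> * y - y\<^sup>2 / (2 * t)) * sinh (z * y)))
      \<le> norm (indicator {a<..} y * (exp (- \<alpha> * y) * sinh (z * y)))"
      using limit_mass_integrand_bounds(1,2)[where a=a and z=z and w=z and y=y and \<alpha>=\<alpha> and t=t] assms by simp
  qed
qed

lemma reflected_mass_nonneg: "0 \<le> a \<Longrightarrow> 0 \<le> z \<Longrightarrow> 0 \<le> reflected_mass \<alpha> a t z"
  unfolding reflected_mass_def by (intro integral_nonneg_AE AE_I2 limit_mass_integrand_bounds(1)) auto

lemma reflected_mass_mono:
  assumes "0 \<le> a" "0 \<le> z" "z \<le> w" "w < \<alpha>" "0 < t"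
  shows "reflected_mass \<alpha> a t z \<le> reflected_mass \<alpha> a t w"
  unfolding reflected_mass_def
  using assms by (intro integral_mono integrable_reflected_mass limit_mass_integrand_bounds(3)) auto

lemma reflected_mass_le_limit_mass:
  assumes "0 \<le> a" "0 \<le> z" "z < \<alpha>" "0 < t"
  shows "reflected_mass \<alpha> a t z \<le> limit_mass \<alpha> a z"
  unfolding reflected_mass_def limit_mass_def
  using assms by (intro integral_mono integrable_reflected_mass limit_mass_integrand_bounds(2)
      integrable.intros[OF has_bochner_integral_limit_mass]) auto

lemma reflected_mass_tendsto:
  assumes "0 \<le> a" "0 \<le> z" "z < \<alpha>"
  shows "((\<lambda>t. reflected_mass \<alpha> a t z) \<longlongrightarrow> limit_mass \<alpha> a z) at_top"
  unfolding reflected_mass_def limit_mass_def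
proof (rule integral_dominated_convergence_at_top)
  show "integrable lborel (\<lambda>y. indicator {a<..} y * (exp (- \<alpha> * y) * sinh (z * y)))"
    using assms by (intro integrable.intros[OF has_bochner_integral_limit_mass]) auto
  show "\<forall>\<^sub>F t in at_top. AE y in lborel. norm (indicator {a<..} y * (exp (- \<alpha> * y - y\<^sup>2 / (2 * t)) * sinh (z * y)))
      \<le> indicator {a<..} y * (exp (- \<alpha> * y) * sinh (z * y))"
    using eventually_gt_at_top[of 0]
  proof eventually_elim
    case (elim t)
    then show ?case
      unfolding real_norm_def abs_of_nonneg[OF limit_mass_integrand_bounds(1)[OF assms(1,2) order_refl]]
      using assms by (intro AE_I2 limit_mass_integrand_bounds(2)) auto
  qed
  show "AE y in lborel. ((\<lambda>t. indicator {a<..} y * (exp (- \<alpha> * y - y\<^sup>2 / (2 * t)) * sinh (z * y))) \<longlongrightarrow>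
      indicator {a<..} y * (exp (- \<alpha> * y) * sinh (z * y))) at_top"
  proof (rule AE_I2)
    fix y
    have "((\<lambda>t. - \<alpha> * y - y\<^sup>2 / (2 * t)) \<longlongrightarrow> - \<alpha> * y) at_top" by real_asymp
    then show "((\<lambda>t. indicator {a<..} y * (exp (- \<alpha> * y - y\<^sup>2 / (2 * t)) * sinh (z * y))) \<longlongrightarrow>
      indicator {a<..} y * (exp (- \<alpha> * y) * sinh (z * y))) at_top"
      by (intro tendsto_intros)
  qed
qed (simp_all add: sinh_field_def)

lemma cdf_qsd:
  assumes "0 < \<gamma>" "\<gamma> < \<alpha>"
  shows "cdf (qsd \<alpha> \<gamma>) y = 1 - limit_mass \<alpha> (max 0 y) \<gamma> / limit_mass \<alpha> 0 \<gamma>"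
proof -
  let ?c = "(\<alpha>\<^sup>2 - \<gamma>\<^sup>2) / \<gamma>"
  have c: "0 < ?c" using assms by (simp add: power_strict_mono)
  have \<gamma>: "\<bar>\<gamma>\<bar> < \<alpha>" using assms by simp
  have c_eq: "?c = 1 / limit_mass \<alpha> 0 \<gamma>" using assms by (simp add: limit_mass_0)
  let ?h = "\<lambda>a x. indicator {a<..} x * (exp (- \<alpha> * x) * sinh (\<gamma> * x))"
  have int: "integrable lborel (?h a)" for a
    by (rule integrable.intros[OF has_bochner_integral_limit_mass[OF \<gamma>]])
  have nn: "0 \<le> ?h 0 x - ?h (max 0 y) x" for x
    using assms by (auto simp: indicator_def)
  have "emeasure (qsd \<alpha> \<gamma>) {..y} = (\<integral>\<^sup>+x. ennreal (?c * (?h 0 x - ?h (max 0 y) x)) \<partial>lborel)"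
    unfolding qsd_def
  proof (subst emeasure_density)
    show "(\<integral>\<^sup>+x. ennreal (indicator {0<..} x * (?c * exp (- \<alpha> * x) * sinh (\<gamma> * x))) * indicator {..y} x \<partial>lborel)
      = (\<integral>\<^sup>+x. ennreal (?c * (?h 0 x - ?h (max 0 y) x)) \<partial>lborel)"
      by (intro nn_integral_cong) (auto simp: indicator_def mult.assoc)
  qed (auto simp: sinh_field_def)
  also have "\<dots> = ennreal (\<integral>x. ?c * (?h 0 x - ?h (max 0 y) x) \<partial>lborel)"
  proof (rule nn_integral_eq_integral)
    show "integrable lborel (\<lambda>x. ?c * (?h 0 x - ?h (max 0 y) x))"
      using int by (intro integrable_mult_right Bochner_Integration.integrable_diff)
    show "AE x in lborel. 0 \<le> ?c * (?h 0 x - ?h (max 0 y) x)"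
      using c nn by (intro AE_I2 mult_nonneg_nonneg) auto
  qed
  also have "(\<integral>x. ?c * (?h 0 x - ?h (max 0 y) x) \<partial>lborel) = ?c * (limit_mass \<alpha> 0 \<gamma> - limit_mass \<alpha> (max 0 y) \<gamma>)"
    unfolding limit_mass_def using int
    by (subst integral_mult_right_zero, subst Bochner_Integration.integral_diff) auto
  finally have em: "emeasure (qsd \<alpha> \<gamma>) {..y} = ennreal (?c * (limit_mass \<alpha> 0 \<gamma> - limit_mass \<alpha> (max 0 y) \<gamma>))" .
  have "limit_mass \<alpha> (max 0 y) \<gamma> \<le> limit_mass \<alpha> 0 \<gamma>"
    unfolding limit_mass_def by (intro integral_mono int) (use nn in \<open>simp add: algebra_simps\<close>)
  then have "0 \<le> ?c * (limit_mass \<alpha> 0 \<gamma> - limit_mass \<alpha> (max 0 y) \<gamma>)"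
    using c by (intro mult_nonneg_nonneg) auto
  then have "cdf (qsd \<alpha> \<gamma>) y = ?c * (limit_mass \<alpha> 0 \<gamma> - limit_mass \<alpha> (max 0 y) \<gamma>)"
    unfolding cdf_def measure_def em by (rule enn2real_ennreal)
  then show ?thesis unfolding c_eq using limit_mass_pos[OF assms] by (simp add: field_simps)
qed

section \<open>Concentration of the starting point\<close>

text \<open>Equal to \<open>tilt_weight\<close> divided by its maximum \<open>exp (\<alpha>^2 t / 2)\<close>
  over all \<open>x\<close>; normalised in this way it also appears in
  \<open>killed_tail\<close>.\<close>
definition gauss_weight :: "real \<Rightarrow> real \<Rightarrow> real \<Rightarrow> real" where
  "gauss_weight \<alpha> t x = exp (- (x - \<alpha> * t)\<^sup>2 / (2 * t))"

text \<open>Dominates both \<open>gauss_weight\<close> and \<open>killed_tail\<close>, so that a single tail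
  estimate serves both limits.\<close>
definition chernoff_weight :: "real \<Rightarrow> real \<Rightarrow> real \<Rightarrow> real" where
  "chernoff_weight \<alpha> t x = exp (- (max 0 (\<alpha> * t - x))\<^sup>2 / (2 * t))"

lemma measurable_weights [measurable]:
  "chernoff_weight \<alpha> t \<in> borel_measurable borel" "gauss_weight \<alpha> t \<in> borel_measurable borel"
  unfolding chernoff_weight_def[abs_def] gauss_weight_def[abs_def] by measurable

lemma chernoff_weight_le_1: "0 < t \<Longrightarrow> chernoff_weight \<alpha> t x \<le> 1"
  by (simp add: chernoff_weight_def)

lemma chernoff_weight_pos: "0 < chernoff_weight \<alpha> t x" by (simp add: chernoff_weight_def)

lemma gauss_weight_pos: "0 < gauss_weight \<alpha> t x" by (simp add: gauss_weight_def)

lemma gauss_weight_le_1: "0 < t \<Longrightarrow> gauss_weight \<alpha> t x \<le> 1"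
  by (simp add: gauss_weight_def)

lemma gauss_weight_le_chernoff: "0 < t \<Longrightarrow> gauss_weight \<alpha> t x \<le> chernoff_weight \<alpha> t x"
  by (auto simp: gauss_weight_def chernoff_weight_def max_def power2_commute intro!: divide_right_mono)

lemma tilt_weight_eq_gauss_weight:
  assumes "0 < t"
  shows "tilt_weight \<alpha> t x = exp (\<alpha>\<^sup>2 * t / 2) * gauss_weight \<alpha> t x"
proof -
  have "- x\<^sup>2 / (2 * t) + \<alpha> * x = \<alpha>\<^sup>2 * t / 2 + - (x - \<alpha> * t)\<^sup>2 / (2 * t)"
    using assms by (simp add: field_simps power2_eq_square)
  then show ?thesis unfolding tilt_weight_def gauss_weight_def mult_exp_exp by simp
qed

lemma max_quadratic_ge_tangent:
  fixes c u :: real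
  assumes "0 \<le> c"
  shows "c * u - c\<^sup>2 / 2 \<le> (max 0 u)\<^sup>2 / 2"
proof -
  have "c * u \<le> c * max 0 u" using assms by (intro mult_left_mono) auto
  moreover have "0 \<le> (max 0 u - c)\<^sup>2" by simp
  ultimately show ?thesis by (simp add: power2_diff field_simps)
qed

text \<open>The exponent is convex in \<open>x / t\<close>, hence above its tangent at \<open>b\<close>,
  which has slope \<open>\<alpha> - b\<close> in absolute value. On either side of \<open>b
  t\<close> the slope may be replaced by a \<open>\<kappa>\<close> that makes the bound weaker
  there. The gain is that one and the same \<open>\<kappa>\<close> can be used on both sides of
  the minimum.\<close>
lemma chernoff_weight_tilt:
  assumes t: "0 < t" and c: "0 \<le> \<alpha> - b"
    and side: "b * t \<le> x \<and> \<alpha> - b \<le> \<kappa> \<or> x \<le> b * t \<and> \<kappa> \<le> \<alpha> - b"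
  shows "chernoff_weight \<alpha> t x \<le> exp (- t * ((\<alpha> - b)\<^sup>2 / 2 + \<kappa> * b)) * exp (\<kappa> * x)"
proof -
  let ?c = "(\<alpha> - b) * t"
  have "0 \<le> ?c" using c t by simp
  note max_quadratic_ge_tangent[OF this, of "\<alpha> * t - x"]
  then have "- (max 0 (\<alpha> * t - x))\<^sup>2 / (2 * t) \<le> (?c\<^sup>2 / 2 - ?c * (\<alpha> * t - x)) / t"
    using t by (simp add: field_simps)
  also have "\<dots> = - t * (\<alpha> - b)\<^sup>2 / 2 + (\<alpha> - b) * (x - b * t)"
    using t by (simp add: field_simps power2_eq_square)
  also have "(\<alpha> - b) * (x - b * t) \<le> \<kappa> * (x - b * t)"
    using side by (auto intro: mult_right_mono mult_right_mono_neg)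
  finally show ?thesis
    unfolding chernoff_weight_def mult_exp_exp by (simp add: algebra_simps)
qed

locale exponential_tail = real_distribution \<mu> for \<mu> :: "real measure" +
  fixes \<rho> :: real
  assumes nonneg: "AE x in \<mu>. 0 \<le> x"
    and rate: "((\<lambda>x. - ln (measure \<mu> {x..}) / x) \<longlongrightarrow> \<rho>) at_top"
    and rate_pos: "0 < \<rho>"

context exponential_tail
begin

text \<open>The positive lower bound on the quotient excludes the case of a vanishing tail, in which
  \<open>ln 0 = 0\<close> would carry no information.\<close>
lemma tail_bounds:
  assumes "0 < \<epsilon>" "\<epsilon> < \<rho>"
  shows "\<forall>\<^sub>F x in at_top. exp (- (\<rho> + \<epsilon>) * x) \<le> prob {x..} \<and> prob {x..} \<le> exp (- (\<rho> - \<epsilon>) * x)"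
proof -
  have "\<forall>\<^sub>F x in at_top. - ln (prob {x..}) / x < \<rho> + \<epsilon>"
    by (rule order_tendstoD(2)[OF rate]) (use assms in simp)
  moreover have "\<forall>\<^sub>F x in at_top. \<rho> - \<epsilon> < - ln (prob {x..}) / x"
    by (rule order_tendstoD(1)[OF rate]) (use assms in simp)
  ultimately show ?thesis using eventually_gt_at_top[of 0]
  proof eventually_elim
    case (elim x)
    then have up: "- ln (prob {x..}) < (\<rho> + \<epsilon>) * x" and lo: "(\<rho> - \<epsilon>) * x < - ln (prob {x..})"
      by (simp_all add: field_simps)
    have "0 < (\<rho> - \<epsilon>) * x" using elim assms by simp
    with lo have "prob {x..} \<noteq> 0" by auto
    then have p: "0 < prob {x..}" by (simp add: less_le)
    have "exp (- (\<rho> + \<epsilon>) * x) \<le> exp (ln (prob {x..}))"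
      unfolding exp_le_cancel_iff mult_minus_left using up by linarith
    moreover have "exp (ln (prob {x..})) \<le> exp (- (\<rho> - \<epsilon>) * x)"
      unfolding exp_le_cancel_iff mult_minus_left using lo by linarith
    ultimately show ?case using p by simp
  qed
qed

text \<open>Summation over unit intervals: on \<open>[n, n + 1)\<close> the integrand is at most \<open>exp
  (\<kappa> (n + 1))\<close>, and the mass beyond \<open>n\<close> decays at a rate exceeding
  \<open>\<kappa>\<close>.\<close>
lemma exponential_moment:
  assumes "0 \<le> \<kappa>" "\<kappa> < \<rho>"
  shows "integrable \<mu> (\<lambda>x. exp (\<kappa> * x))"
proof (rule integrableI_bounded)
  \<comment> \<open>The tail rate \<open>\<rho> - \<epsilon> = \<kappa> + \<epsilon>\<close> lies
    midway between \<open>\<kappa>\<close> and \<open>\<rho>\<close>.\<close>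
  define \<epsilon> where "\<epsilon> = (\<rho> - \<kappa>) / 2"
  have \<epsilon>: "0 < \<epsilon>" "\<epsilon> < \<rho>" "\<rho> - \<epsilon> = \<kappa> + \<epsilon>" using assms by (auto simp: \<epsilon>_def field_simps)
  let ?a = "\<lambda>n. exp (\<kappa> * real (Suc n)) * prob {real n..}"
  have "\<forall>\<^sub>F n in sequentially. prob {real n..} \<le> exp (- (\<rho> - \<epsilon>) * real n)"
    using eventually_compose_filterlim[OF tail_bounds[OF \<epsilon>(1,2)] filterlim_real_sequentially]
    by (rule eventually_mono) auto
  then have "\<forall>\<^sub>F n in sequentially. norm (?a n) \<le> exp \<kappa> * exp (- \<epsilon>) ^ n"
  proof eventually_elim
    case (elim n)
    have "?a n \<le> exp (\<kappa> * real (Suc n)) * exp (- (\<rho> - \<epsilon>) * real n)"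
      using elim by (intro mult_left_mono) auto
    also have "\<dots> = exp \<kappa> * exp (real n * - \<epsilon>)"
      unfolding \<epsilon>(3) mult_exp_exp by (simp add: algebra_simps)
    also have "\<dots> = exp \<kappa> * exp (- \<epsilon>) ^ n" by (simp only: exp_of_nat_mult)
    finally show ?case by simp
  qed
  moreover have "summable (\<lambda>n. exp \<kappa> * exp (- \<epsilon>) ^ n)"
    using \<epsilon>(1) by (intro summable_mult summable_geometric) simp
  ultimately have summable: "summable ?a" by (rule summable_comparison_test_ev)
  define f where "f n x = ennreal (exp (\<kappa> * real (Suc n))) * indicator {real n..} x" for n and x :: real
  have "(\<integral>\<^sup>+x. ennreal (norm (exp (\<kappa> * x))) \<partial>\<mu>) \<le> (\<integral>\<^sup>+x. (\<Sum>n. f n x) \<partial>\<mu>)"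
  proof (rule nn_integral_mono_AE)
    show "AE x in \<mu>. ennreal (norm (exp (\<kappa> * x))) \<le> (\<Sum>n. f n x)"
      using nonneg
    proof eventually_elim
      case (elim x)
      define n where "n = nat \<lfloor>x\<rfloor>"
      have n: "real n \<le> x" "x \<le> real (Suc n)" using elim by (auto simp: n_def) linarith
      have "\<kappa> * x \<le> \<kappa> * real (Suc n)" using n assms by (intro mult_left_mono) auto
      then have "ennreal (norm (exp (\<kappa> * x))) \<le> f n x"
        using n by (simp add: f_def ennreal_leI)
      also have "\<dots> = (\<Sum>i\<in>{n}. f i x)" by simp
      also have "\<dots> \<le> (\<Sum>i. f i x)" by (rule sum_le_suminf) auto
      finally show ?case .
    qed
  qed
  also have "\<dots> = (\<Sum>n. ennreal (?a n))"
    unfolding f_def by (subst nn_integral_suminf) (auto simp: nn_integral_cmult emeasure_eq_measure ennreal_mult)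
  also have "\<dots> < \<infinity>"
    using summable by (subst suminf_ennreal2) auto
  finally show "(\<integral>\<^sup>+x. ennreal (norm (exp (\<kappa> * x))) \<partial>\<mu>) < \<infinity>" .
qed simp

definition total_weight :: "real \<Rightarrow> real \<Rightarrow> real" where
  "total_weight \<alpha> t = (\<integral>x. gauss_weight \<alpha> t x \<partial>\<mu>)"

definition far :: "real \<Rightarrow> real \<Rightarrow> real \<Rightarrow> real set" where
  "far \<alpha> \<delta> t = {x. \<delta> * t \<le> \<bar>x - (\<alpha> - \<rho>) * t\<bar>}"

definition far_weight :: "real \<Rightarrow> real \<Rightarrow> real \<Rightarrow> real" where
  "far_weight \<alpha> \<delta> t = (\<integral>x. indicator (far \<alpha> \<delta> t) x * chernoff_weight \<alpha> t x \<partial>\<mu>)"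

text \<open>The minimum over \<open>z\<close> of the exponent \<open>(\<alpha> - z)^2 / 2 + \<rho>
  z\<close>, attained at \<open>z = \<alpha> - \<rho>\<close>.\<close>
definition cost :: "real \<Rightarrow> real" where
  "cost \<alpha> = \<rho>\<^sup>2 / 2 + \<rho> * (\<alpha> - \<rho>)"

lemma far_measurable [measurable]: "far \<alpha> \<delta> t \<in> sets borel"
  unfolding far_def by measurable

lemma integrable_weights:
  assumes "0 < t"
  shows "integrable \<mu> (gauss_weight \<alpha> t)"
    and "A \<in> sets borel \<Longrightarrow> integrable \<mu> (\<lambda>x. indicator A x * chernoff_weight \<alpha> t x)"
    and "A \<in> sets borel \<Longrightarrow> integrable \<mu> (\<lambda>x. indicator A x * gauss_weight \<alpha> t x)"
  using assms gauss_weight_le_1[of t \<alpha>] gauss_weight_pos[of \<alpha> t] chernoff_weight_le_1[of t \<alpha>] chernoff_weight_pos[of \<alpha> t]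
  by (auto intro!: integrable_const_bound[where B=1] simp: abs_mult indicator_def less_imp_le abs_of_pos)

lemma total_weight_pos: "0 < t \<Longrightarrow> 0 < total_weight \<alpha> t"
proof -
  assume t: "0 < t"
  have "total_weight \<alpha> t \<noteq> 0"
  proof
    assume "total_weight \<alpha> t = 0"
    then have "AE x in \<mu>. gauss_weight \<alpha> t x = 0"
      using integral_nonneg_eq_0_iff_AE[OF integrable_weights(1)[OF t, of \<alpha>]] gauss_weight_pos[of \<alpha> t]
      by (simp add: total_weight_def less_imp_le)
    then have "AE x in \<mu>. False" using gauss_weight_pos[of \<alpha> t] by (auto elim!: AE_mp simp: less_imp_neq[symmetric])
    then show False by simp
  qed
  moreover have "0 \<le> total_weight \<alpha> t"
    unfolding total_weight_def by (intro integral_nonneg_AE AE_I2 less_imp_le gauss_weight_pos)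
  ultimately show ?thesis by simp
qed

text \<open>Tangents at the two points \<open>\<gamma> + \<delta>\<close> and \<open>\<gamma> -
  \<delta>\<close>, where the exponent exceeds its minimum by \<open>\<delta>^2 / 2\<close>.
  Half of this gain pays for taking \<open>\<kappa>\<close> slightly below
  \<open>\<rho>\<close>, which is needed for the exponential moment to be finite.\<close>
lemma far_weight_upper:
  assumes "0 < \<delta>" "\<delta> \<le> \<rho>" "\<delta> \<le> \<alpha> - \<rho>"
  obtains C where "\<And>t. 0 < t \<Longrightarrow> far_weight \<alpha> \<delta> t \<le> C * exp (- t * (cost \<alpha> + \<delta>\<^sup>2 / 4))"
proof
  define \<gamma> where "\<gamma> = \<alpha> - \<rho>"
  \<comment> \<open>This \<open>r\<close> makes the loss \<open>r (\<gamma> + \<delta>)\<close> equal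
    to \<open>\<delta>^2 / 4\<close>, and \<open>\<kappa>\<close> stays between the
    two slopes \<open>\<rho> - \<delta>\<close> and \<open>\<rho> + \<delta>\<close>.\<close>
  define r where "r = \<delta>\<^sup>2 / (4 * (\<gamma> + \<delta>))"
  define \<kappa> where "\<kappa> = \<rho> - r"
  have \<gamma>: "0 < \<gamma>" "\<delta> \<le> \<gamma>" "\<alpha> = \<rho> + \<gamma>" using assms by (auto simp: \<gamma>_def)
  have r: "0 < r" "r \<le> \<delta>" "r * (\<gamma> + \<delta>) = \<delta>\<^sup>2 / 4"
    using assms \<gamma> by (auto simp: r_def field_simps power2_eq_square)
  have \<kappa>: "0 \<le> \<kappa>" "\<kappa> < \<rho>" "\<rho> - \<delta> \<le> \<kappa>" "\<kappa> \<le> \<rho> + \<delta>" using r assms by (auto simp: \<kappa>_def)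
  fix t :: real assume t: "0 < t"
  let ?K = "exp (- t * (cost \<alpha> + \<delta>\<^sup>2 / 4))"
  have right: "(\<alpha> - (\<gamma> + \<delta>))\<^sup>2 / 2 + \<kappa> * (\<gamma> + \<delta>) = cost \<alpha> + \<delta>\<^sup>2 / 4"
  proof -
    have "\<kappa> * (\<gamma> + \<delta>) = \<rho> * (\<gamma> + \<delta>) - \<delta>\<^sup>2 / 4" using r(3) by (simp add: \<kappa>_def left_diff_distrib)
    then show ?thesis unfolding cost_def \<gamma>(3) by (simp add: power2_eq_square field_simps)
  qed
  have left: "cost \<alpha> + \<delta>\<^sup>2 / 4 \<le> (\<alpha> - (\<gamma> - \<delta>))\<^sup>2 / 2 + \<kappa> * (\<gamma> - \<delta>)"
  proof -
    have "r * (\<gamma> - \<delta>) \<le> r * (\<gamma> + \<delta>)" using r assms by (intro mult_left_mono) auto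
    then have "\<rho> * (\<gamma> - \<delta>) - \<delta>\<^sup>2 / 4 \<le> \<kappa> * (\<gamma> - \<delta>)" using r(3) by (simp add: \<kappa>_def left_diff_distrib)
    then show ?thesis unfolding cost_def \<gamma>(3) by (simp add: power2_eq_square field_simps)
  qed
  have bound: "chernoff_weight \<alpha> t x \<le> ?K * exp (\<kappa> * x)" if "x \<in> far \<alpha> \<delta> t" for x
  proof (cases "(\<gamma> + \<delta>) * t \<le> x")
    case True
    then have "chernoff_weight \<alpha> t x \<le> exp (- t * ((\<alpha> - (\<gamma> + \<delta>))\<^sup>2 / 2 + \<kappa> * (\<gamma> + \<delta>))) * exp (\<kappa> * x)"
      using \<kappa> assms \<gamma> by (intro chernoff_weight_tilt t) auto
    then show ?thesis unfolding right .
  next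
    case False
    then have "x \<le> (\<gamma> - \<delta>) * t"
      using that by (auto simp: far_def \<gamma>_def[symmetric] algebra_simps abs_if split: if_splits)
    then have "chernoff_weight \<alpha> t x \<le> exp (- t * ((\<alpha> - (\<gamma> - \<delta>))\<^sup>2 / 2 + \<kappa> * (\<gamma> - \<delta>))) * exp (\<kappa> * x)"
      using \<kappa> assms \<gamma> by (intro chernoff_weight_tilt t) auto
    also have "\<dots> \<le> ?K * exp (\<kappa> * x)"
      using left t by (intro mult_right_mono) (auto intro: mult_left_mono)
    finally show ?thesis .
  qed
  have "far_weight \<alpha> \<delta> t \<le> (\<integral>x. ?K * exp (\<kappa> * x) \<partial>\<mu>)"
    unfolding far_weight_def
  proof (rule integral_mono)
    show "integrable \<mu> (\<lambda>x. ?K * exp (\<kappa> * x))" using exponential_moment[OF \<kappa>(1,2)] by simp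
    show "integrable \<mu> (\<lambda>x. indicator (far \<alpha> \<delta> t) x * chernoff_weight \<alpha> t x)"
      by (rule integrable_weights[OF t]) simp
    show "indicator (far \<alpha> \<delta> t) x * chernoff_weight \<alpha> t x \<le> ?K * exp (\<kappa> * x)" for x
      using bound[of x] by (auto simp: indicator_def)
  qed
  then show "far_weight \<alpha> \<delta> t \<le> (\<integral>x. exp (\<kappa> * x) \<partial>\<mu>) * ?K" by (simp add: mult.commute)
qed

text \<open>Between \<open>\<gamma> t\<close> and \<open>\<alpha> t\<close> the weight is at least its value
  \<open>exp (- t \<rho>^2 / 2)\<close> at \<open>\<gamma> t\<close>, and the mass of that
  interval is about \<open>exp (- \<rho> \<gamma> t)\<close>, because the tail beyond
  \<open>\<alpha> t\<close> is exponentially smaller.\<close>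
lemma total_weight_lower:
  assumes "\<rho> < \<alpha>" "0 < \<eta>"
  shows "\<forall>\<^sub>F t in at_top. exp (- t * (cost \<alpha> + \<eta>)) \<le> total_weight \<alpha> t"
proof -
  define \<gamma> where "\<gamma> = \<alpha> - \<rho>"
  have \<gamma>: "0 < \<gamma>" "\<alpha> = \<rho> + \<gamma>" using assms by (auto simp: \<gamma>_def)
  \<comment> \<open>The second entry keeps the loss \<open>\<epsilon> \<gamma>\<close> at most
    \<open>\<eta> / 2\<close>; the third keeps the decay rate of the tail at
    \<open>\<alpha> t\<close> strictly above that of the tail at \<open>\<gamma>
    t\<close>.\<close>
  define \<epsilon> where "\<epsilon> = min (\<rho> / 2) (min (\<eta> / (2 * \<gamma>)) (\<rho>\<^sup>2 / (2 * (\<alpha> + \<gamma>))))"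
  have \<epsilon>: "0 < \<epsilon>" "\<epsilon> < \<rho>" using \<gamma> rate_pos assms by (auto simp: \<epsilon>_def min_def)
  have "\<epsilon> \<le> \<eta> / (2 * \<gamma>)" by (auto simp: \<epsilon>_def)
  then have \<epsilon>\<eta>: "\<epsilon> * \<gamma> \<le> \<eta> / 2" using \<gamma> by (simp add: field_simps)
  have "\<epsilon> \<le> \<rho>\<^sup>2 / (2 * (\<alpha> + \<gamma>))" by (auto simp: \<epsilon>_def)
  then have "\<epsilon> * (\<alpha> + \<gamma>) \<le> \<rho>\<^sup>2 / 2" using \<gamma> rate_pos by (simp add: field_simps)
  moreover define k where "k = (\<rho> - \<epsilon>) * \<alpha> - (\<rho> + \<epsilon>) * \<gamma>"
  moreover have "k = \<rho>\<^sup>2 - \<epsilon> * (\<alpha> + \<gamma>)" unfolding k_def \<gamma>(2) by (simp add: power2_eq_square algebra_simps)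
  moreover have "0 < \<rho>\<^sup>2" using rate_pos by simp
  ultimately have k: "0 < k" by linarith
  have scale: "filterlim (\<lambda>t. c * t) at_top at_top" if "0 < c" for c :: real using that by real_asymp
  have \<alpha>: "0 < \<alpha>" using \<gamma> rate_pos by simp
  have "\<forall>\<^sub>F t in at_top. exp (- (\<rho> + \<epsilon>) * (\<gamma> * t)) \<le> prob {\<gamma> * t..}"
    by (rule eventually_mono[OF eventually_compose_filterlim[OF tail_bounds[OF \<epsilon>] scale[OF \<gamma>(1)]]]) blast
  moreover have "\<forall>\<^sub>F t in at_top. prob {\<alpha> * t..} \<le> exp (- (\<rho> - \<epsilon>) * (\<alpha> * t))"
    by (rule eventually_mono[OF eventually_compose_filterlim[OF tail_bounds[OF \<epsilon>] scale[OF \<alpha>]]]) blast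
  moreover have "\<forall>\<^sub>F t in at_top. exp (- k * t) \<le> 1 / 2" using k by real_asymp
  moreover have "\<forall>\<^sub>F t in at_top. exp (- (\<eta> / 2) * t) \<le> 1 / 2" using assms(2) by real_asymp
  ultimately show ?thesis using eventually_gt_at_top[of 0]
  proof eventually_elim
    case (elim t)
    note t = elim(5)
    have "exp (- t * (cost \<alpha> + \<eta>)) \<le> exp (- t * \<rho>\<^sup>2 / 2) * exp (- (\<rho> + \<epsilon>) * (\<gamma> * t)) * exp (- (\<eta> / 2) * t)"
    proof -
      have "t * (\<epsilon> * \<gamma>) \<le> t * (\<eta> / 2)" using \<epsilon>\<eta> t by (intro mult_left_mono) auto
      then show ?thesis unfolding mult_exp_exp exp_le_cancel_iff cost_def \<gamma>_def[symmetric] by (simp add: algebra_simps)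
    qed
    also have "\<dots> \<le> exp (- t * \<rho>\<^sup>2 / 2) * exp (- (\<rho> + \<epsilon>) * (\<gamma> * t)) * (1 - exp (- k * t))"
      using elim by (intro mult_left_mono) auto
    also have "\<dots> = exp (- t * \<rho>\<^sup>2 / 2) * (exp (- (\<rho> + \<epsilon>) * (\<gamma> * t)) - exp (- (\<rho> - \<epsilon>) * (\<alpha> * t)))"
    proof -
      have "exp (- (\<rho> + \<epsilon>) * (\<gamma> * t)) * exp (- k * t) = exp (- (\<rho> - \<epsilon>) * (\<alpha> * t))"
        unfolding mult_exp_exp k_def by (simp add: algebra_simps)
      then show ?thesis by (simp add: right_diff_distrib mult.assoc)
    qed
    also have "\<dots> \<le> exp (- t * \<rho>\<^sup>2 / 2) * (prob {\<gamma> * t..} - prob {\<alpha> * t..})"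
      using elim by (intro mult_left_mono) auto
    also have "prob {\<gamma> * t..} - prob {\<alpha> * t..} = prob ({\<gamma> * t..} - {\<alpha> * t..})"
      using \<gamma> rate_pos t by (intro finite_measure_Diff[symmetric]) auto
    also have "exp (- t * \<rho>\<^sup>2 / 2) * \<dots> = (\<integral>x. exp (- t * \<rho>\<^sup>2 / 2) * indicator ({\<gamma> * t..} - {\<alpha> * t..}) x \<partial>\<mu>)"
      by simp
    also have "\<dots> \<le> total_weight \<alpha> t"
      unfolding total_weight_def
    proof (rule integral_mono)
      show "integrable \<mu> (gauss_weight \<alpha> t)" by (rule integrable_weights[OF t])
      show "exp (- t * \<rho>\<^sup>2 / 2) * indicator ({\<gamma> * t..} - {\<alpha> * t..}) x \<le> gauss_weight \<alpha> t x" for x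
      proof (cases "x \<in> {\<gamma> * t..} - {\<alpha> * t..}")
        case True
        then have "\<bar>x - \<alpha> * t\<bar> \<le> \<bar>\<rho> * t\<bar>" using \<gamma> rate_pos t by (auto simp: algebra_simps)
        then have "(x - \<alpha> * t)\<^sup>2 \<le> (\<rho> * t)\<^sup>2" by (simp only: abs_le_square_iff)
        then have "- t * \<rho>\<^sup>2 / 2 \<le> - (x - \<alpha> * t)\<^sup>2 / (2 * t)"
          using t by (simp add: field_simps power2_eq_square)
        then show ?thesis using True by (simp add: gauss_weight_def)
      qed (simp add: gauss_weight_def)
    qed (auto intro!: integrable_real_indicator simp: less_top[symmetric])
    finally show ?case .
  qed
qed

text \<open>The factor \<open>sqrt t\<close> compensates the prefactor \<open>sqrt (2 / (\<pi> t))\<close>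
  of \<open>killed_tail\<close>.\<close>
lemma far_weight_negligible:
  assumes "0 < \<delta>" "\<delta> \<le> \<rho>" "\<delta> \<le> \<alpha> - \<rho>"
  shows "((\<lambda>t. sqrt t * (far_weight \<alpha> \<delta> t / total_weight \<alpha> t)) \<longlongrightarrow> 0) at_top"
proof -
  obtain C where C: "\<And>t. 0 < t \<Longrightarrow> far_weight \<alpha> \<delta> t \<le> C * exp (- t * (cost \<alpha> + \<delta>\<^sup>2 / 4))"
    using far_weight_upper[OF assms] by blast
  have "\<forall>\<^sub>F t in at_top. exp (- t * (cost \<alpha> + \<delta>\<^sup>2 / 8)) \<le> total_weight \<alpha> t"
    using assms by (intro total_weight_lower) auto
  then have upper: "\<forall>\<^sub>F t in at_top. sqrt t * (far_weight \<alpha> \<delta> t / total_weight \<alpha> t) \<le> C * (sqrt t * exp (- (\<delta>\<^sup>2 / 8) * t))"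
    using eventually_gt_at_top[of 0]
  proof eventually_elim
    case (elim t)
    have "0 \<le> far_weight \<alpha> \<delta> t"
      unfolding far_weight_def by (intro integral_nonneg_AE AE_I2) (simp add: less_imp_le[OF chernoff_weight_pos])
    then have "far_weight \<alpha> \<delta> t / total_weight \<alpha> t \<le> (C * exp (- t * (cost \<alpha> + \<delta>\<^sup>2 / 4))) / exp (- t * (cost \<alpha> + \<delta>\<^sup>2 / 8))"
      using elim C[of t] by (intro frac_le) auto
    also have "\<dots> = C * (exp (- t * (cost \<alpha> + \<delta>\<^sup>2 / 4)) / exp (- t * (cost \<alpha> + \<delta>\<^sup>2 / 8)))" by simp
    also have "\<dots> = C * exp (- (\<delta>\<^sup>2 / 8) * t)"
      unfolding exp_diff[symmetric] by (simp add: algebra_simps)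
    finally have "sqrt t * (far_weight \<alpha> \<delta> t / total_weight \<alpha> t) \<le> sqrt t * (C * exp (- (\<delta>\<^sup>2 / 8) * t))"
      using elim by (intro mult_left_mono) auto
    then show ?case by (simp add: mult_ac)
  qed
  have lower: "\<forall>\<^sub>F t in at_top. 0 \<le> sqrt t * (far_weight \<alpha> \<delta> t / total_weight \<alpha> t)"
    using eventually_gt_at_top[of 0]
    by eventually_elim (auto simp: far_weight_def total_weight_def chernoff_weight_pos gauss_weight_pos less_imp_le
       intro!: mult_nonneg_nonneg divide_nonneg_nonneg integral_nonneg_AE AE_I2)
  have "((\<lambda>t. C * (sqrt t * exp (- (\<delta>\<^sup>2 / 8) * t))) \<longlongrightarrow> 0) at_top"
  proof -
    have "0 < \<delta>\<^sup>2 / 8" using assms by simp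
    then show ?thesis by real_asymp
  qed
  then show ?thesis by (rule tendsto_sandwich[OF lower upper tendsto_const])
qed

lemma far_ratio_tendsto_0:
  assumes "0 < \<delta>" "\<delta> \<le> \<rho>" "\<delta> \<le> \<alpha> - \<rho>"
  shows "((\<lambda>t. far_weight \<alpha> \<delta> t / total_weight \<alpha> t) \<longlongrightarrow> 0) at_top"
proof -
  have "((\<lambda>t. 1 / sqrt t * (sqrt t * (far_weight \<alpha> \<delta> t / total_weight \<alpha> t))) \<longlongrightarrow> 0 * 0) at_top"
    by (intro tendsto_mult far_weight_negligible assms) real_asymp
  moreover have "\<forall>\<^sub>F t in at_top. 1 / sqrt t * (sqrt t * (far_weight \<alpha> \<delta> t / total_weight \<alpha> t)) = far_weight \<alpha> \<delta> t / total_weight \<alpha> t"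
    using eventually_gt_at_top[of 0] by eventually_elim simp
  ultimately show ?thesis by (simp add: Lim_transform_eventually)
qed

section \<open>Convergence of the tilted and of the conditional laws\<close>

lemma tilted_cdf_eq:
  assumes t: "0 < t"
  shows "tilted_cdf \<alpha> \<mu> t z = (\<integral>x. indicator {0..z * t} x * gauss_weight \<alpha> t x \<partial>\<mu>) / total_weight \<alpha> t"
proof -
  let ?E = "exp (\<alpha>\<^sup>2 * t / 2)"
  have set: "(LINT x:A|\<mu>. tilt_weight \<alpha> t x) = ?E * (\<integral>x. indicator A x * gauss_weight \<alpha> t x \<partial>\<mu>)" for A
  proof -
    have "(LINT x:A|\<mu>. tilt_weight \<alpha> t x) = (\<integral>x. ?E * (indicator A x * gauss_weight \<alpha> t x) \<partial>\<mu>)"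
      unfolding set_lebesgue_integral_def tilt_weight_eq_gauss_weight[OF t]
      by (intro Bochner_Integration.integral_cong refl) simp
    then show ?thesis by simp
  qed
  have "(\<integral>x. indicator {0..} x * gauss_weight \<alpha> t x \<partial>\<mu>) = total_weight \<alpha> t"
    unfolding total_weight_def
    by (rule integral_cong_AE) (use nonneg in \<open>auto simp: indicator_def\<close>)
  then show ?thesis by (simp add: tilted_cdf_def tilt_const_def set)
qed

text \<open>For \<open>x \<ge> 0\<close> the indicators of \<open>x \<le> z t\<close> and of \<open>\<gamma>
  \<le> z\<close> can only differ at a far point, if \<open>\<delta>\<close> is at most the
  distance between \<open>z\<close> and \<open>\<gamma>\<close>.\<close>
lemma tilted_cdf_concentrates:
  assumes "\<rho> < \<alpha>" "z \<noteq> \<alpha> - \<rho>"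
  shows "((\<lambda>t. tilted_cdf \<alpha> \<mu> t z) \<longlongrightarrow> of_bool (\<alpha> - \<rho> \<le> z)) at_top"
proof -
  define \<gamma> where "\<gamma> = \<alpha> - \<rho>"
  \<comment> \<open>The first two entries are the range in which the far weight is known to be
    negligible.\<close>
  define \<delta> where "\<delta> = min \<rho> (min \<gamma> \<bar>z - \<gamma>\<bar>)"
  have \<delta>: "0 < \<delta>" "\<delta> \<le> \<rho>" "\<delta> \<le> \<alpha> - \<rho>" "\<delta> \<le> \<bar>z - \<gamma>\<bar>"
    using assms rate_pos by (auto simp: \<delta>_def \<gamma>_def)
  have bound: "\<bar>tilted_cdf \<alpha> \<mu> t z - of_bool (\<gamma> \<le> z)\<bar> \<le> far_weight \<alpha> \<delta> t / total_weight \<alpha> t" if t: "0 < t" for t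
  proof -
    have "\<delta> * t \<le> \<bar>z - \<gamma>\<bar> * t" using \<delta> t by (intro mult_right_mono) auto
    also have "\<dots> = \<bar>z * t - \<gamma> * t\<bar>" using t by (simp add: abs_mult left_diff_distrib[symmetric])
    finally have gap: "\<delta> * t \<le> \<bar>z * t - \<gamma> * t\<bar>" .
    have "\<gamma> \<le> z \<longleftrightarrow> \<gamma> * t \<le> z * t" using t by simp
    then have pointwise: "\<bar>indicator {0..z * t} x - of_bool (\<gamma> \<le> z)\<bar> \<le> (indicator (far \<alpha> \<delta> t) x :: real)" if "0 \<le> x" for x
      using that gap by (auto simp: indicator_def far_def \<gamma>_def[symmetric])
    have le: "\<bar>indicator {0..z * t} x * gauss_weight \<alpha> t x - of_bool (\<gamma> \<le> z) * gauss_weight \<alpha> t x\<bar>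
       \<le> indicator (far \<alpha> \<delta> t) x * chernoff_weight \<alpha> t x" if "0 \<le> x" for x
    proof -
      have "\<bar>indicator {0..z * t} x - of_bool (\<gamma> \<le> z)\<bar> * gauss_weight \<alpha> t x \<le> indicator (far \<alpha> \<delta> t) x * chernoff_weight \<alpha> t x"
        using pointwise[OF that] gauss_weight_le_chernoff[OF t] gauss_weight_pos[of \<alpha> t x]
        by (intro mult_mono) (auto simp: less_imp_le)
      then show ?thesis using gauss_weight_pos[of \<alpha> t x]
        by (simp add: left_diff_distrib[symmetric] abs_mult)
    qed
    have "tilted_cdf \<alpha> \<mu> t z - of_bool (\<gamma> \<le> z)
       = (\<integral>x. indicator {0..z * t} x * gauss_weight \<alpha> t x - of_bool (\<gamma> \<le> z) * gauss_weight \<alpha> t x \<partial>\<mu>) / total_weight \<alpha> t"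
      using integrable_weights[OF t] total_weight_pos[OF t, of \<alpha>]
      by (simp add: tilted_cdf_eq[OF t] total_weight_def[symmetric] diff_divide_distrib)
    also have "\<bar>\<dots>\<bar> \<le> far_weight \<alpha> \<delta> t / total_weight \<alpha> t"
      unfolding abs_divide abs_of_pos[OF total_weight_pos[OF t]]
    proof (rule divide_right_mono)
      show "\<bar>\<integral>x. indicator {0..z * t} x * gauss_weight \<alpha> t x - of_bool (\<gamma> \<le> z) * gauss_weight \<alpha> t x \<partial>\<mu>\<bar> \<le> far_weight \<alpha> \<delta> t"
        unfolding far_weight_def
      proof (rule order_trans[OF integral_abs_bound integral_mono_AE])
        show "integrable \<mu> (\<lambda>x. \<bar>indicator {0..z * t} x * gauss_weight \<alpha> t x - of_bool (\<gamma> \<le> z) * gauss_weight \<alpha> t x\<bar>)"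
          using integrable_weights[OF t] by (intro integrable_abs Bochner_Integration.integrable_diff integrable_mult_right) auto
        show "AE x in \<mu>. \<bar>indicator {0..z * t} x * gauss_weight \<alpha> t x - of_bool (\<gamma> \<le> z) * gauss_weight \<alpha> t x\<bar>
          \<le> indicator (far \<alpha> \<delta> t) x * chernoff_weight \<alpha> t x"
          using nonneg by eventually_elim (rule le)
      qed (rule integrable_weights[OF t], simp)
    qed (use total_weight_pos[OF t] in \<open>simp add: less_imp_le\<close>)
    finally show ?thesis .
  qed
  have "((\<lambda>t. tilted_cdf \<alpha> \<mu> t z - of_bool (\<gamma> \<le> z)) \<longlongrightarrow> 0) at_top"
    by (rule Lim_null_comparison[OF _ far_ratio_tendsto_0[OF \<delta>(1-3)]])
      (unfold real_norm_def, rule eventually_mono[OF eventually_gt_at_top[of 0] bound])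
  then show ?thesis unfolding \<gamma>_def by (simp add: LIM_zero_iff)
qed

text \<open>The probability of surviving until \<open>t\<close> above level \<open>a\<close>, divided by a
  normalisation that does not depend on \<open>a\<close> and hence cancels in the conditional
  law.\<close>
definition scaled_survival :: "real \<Rightarrow> real \<Rightarrow> real \<Rightarrow> real" where
  "scaled_survival \<alpha> a t = (\<integral>x. killed_tail \<alpha> a t x \<partial>\<mu>) / (sqrt (2 / (pi * t)) * total_weight \<alpha> t)"

lemma integrable_killed_tail:
  assumes "0 < \<alpha>" "0 \<le> a" "0 < t" shows "integrable \<mu> (killed_tail \<alpha> a t)"
proof -
  have [measurable]: "killed_tail \<alpha> a t \<in> borel_measurable borel" using assms by simp
  show ?thesis
    by (rule integrable_const_bound[where B=1]) (use abs_killed_tail_le_1[of \<alpha> t a] assms in auto)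
qed

lemma near_bounds:
  assumes "x \<notin> far \<alpha> \<delta> t" "0 < t"
  shows "\<alpha> - \<rho> - \<delta> \<le> x / t" "x / t \<le> \<alpha> - \<rho> + \<delta>"
  using assms by (auto simp: far_def field_simps abs_if split: if_splits)

text \<open>On near points \<open>reflected_mass\<close> is bounded by its limit at the right end; far
  points are charged to \<open>far_weight\<close> through \<open>killed_tail_chernoff\<close>.\<close>
lemma scaled_survival_upper:
  assumes "0 \<le> a" "0 < \<delta>" "\<delta> < \<rho>" "\<delta> \<le> \<alpha> - \<rho>" "0 < t"
  shows "scaled_survival \<alpha> a t \<le> limit_mass \<alpha> a (\<alpha> - \<rho> + \<delta>)
     + sqrt (pi / 2) * (sqrt t * (far_weight \<alpha> \<delta> t / total_weight \<alpha> t))"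
proof -
  let ?s = "sqrt (2 / (pi * t))" and ?L = "total_weight \<alpha> t" and ?H = "limit_mass \<alpha> a (\<alpha> - \<rho> + \<delta>)"
  have s: "0 < ?s" using assms by simp
  have L: "0 < ?L" using assms by (intro total_weight_pos)
  have H: "0 \<le> ?H" using assms by (intro limit_mass_nonneg) auto
  have \<alpha>: "0 < \<alpha>" using assms by simp
  have "(\<integral>x. killed_tail \<alpha> a t x \<partial>\<mu>) \<le> (\<integral>x. ?s * ?H * gauss_weight \<alpha> t x + indicator (far \<alpha> \<delta> t) x * chernoff_weight \<alpha> t x \<partial>\<mu>)"
  proof (rule integral_mono)
    show "integrable \<mu> (\<lambda>x. ?s * ?H * gauss_weight \<alpha> t x + indicator (far \<alpha> \<delta> t) x * chernoff_weight \<alpha> t x)"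
      using integrable_weights[OF assms(5)] by (intro Bochner_Integration.integrable_add integrable_mult_right) auto
    fix x
    have g: "0 < gauss_weight \<alpha> t x" by (rule gauss_weight_pos)
    show "killed_tail \<alpha> a t x \<le> ?s * ?H * gauss_weight \<alpha> t x + indicator (far \<alpha> \<delta> t) x * chernoff_weight \<alpha> t x"
    proof (cases "x \<in> far \<alpha> \<delta> t")
      case True
      have "killed_tail \<alpha> a t x \<le> chernoff_weight \<alpha> t x"
        unfolding chernoff_weight_def by (rule killed_tail_chernoff) (use assms in auto)
      moreover have "0 \<le> ?s * ?H * gauss_weight \<alpha> t x" using s H g by simp
      ultimately show ?thesis using True by simp
    next
      case False
      note near = near_bounds[OF False assms(5)]
      have "reflected_mass \<alpha> a t (x / t) \<le> reflected_mass \<alpha> a t (\<alpha> - \<rho> + \<delta>)"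
        using near assms by (intro reflected_mass_mono) auto
      also have "\<dots> \<le> ?H" using assms by (intro reflected_mass_le_limit_mass) auto
      finally have "killed_tail \<alpha> a t x \<le> ?s * gauss_weight \<alpha> t x * ?H"
        unfolding killed_tail_eq_reflected_mass[OF assms(5)] gauss_weight_def[symmetric]
        using s g by (intro mult_left_mono) auto
      then show ?thesis using False by (simp add: mult_ac)
    qed
  qed (use \<alpha> assms in \<open>intro integrable_killed_tail, auto\<close>)
  also have "\<dots> = ?s * ?H * ?L + far_weight \<alpha> \<delta> t"
    unfolding far_weight_def total_weight_def
    using integrable_weights[OF assms(5)] by (subst Bochner_Integration.integral_add) auto
  finally have le: "scaled_survival \<alpha> a t \<le> (?s * ?H * ?L + far_weight \<alpha> \<delta> t) / (?s * ?L)"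
    unfolding scaled_survival_def using s L by (intro divide_right_mono) auto
  have divide_split: "(s * H * L + f) / (s * L) = H + 1 / s * (f / L)" if "0 < s" "0 < L" for s H L f :: real
    using that by (simp add: field_simps)
  note le
  also have "(?s * ?H * ?L + far_weight \<alpha> \<delta> t) / (?s * ?L) = ?H + 1 / ?s * (far_weight \<alpha> \<delta> t / ?L)"
    using divide_split[OF s L] .
  also have "1 / ?s = sqrt (pi / 2) * sqrt t"
    by (simp add: real_sqrt_mult real_sqrt_divide)
  finally show ?thesis by (simp add: mult.assoc)
qed

text \<open>Far points are discarded, and on near points \<open>reflected_mass\<close> is at least its value
  at the left end.\<close>
lemma scaled_survival_lower:
  assumes "0 \<le> a" "0 < \<delta>" "\<delta> < \<rho>" "\<delta> \<le> \<alpha> - \<rho>" "0 < t"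
  shows "reflected_mass \<alpha> a t (\<alpha> - \<rho> - \<delta>) * (1 - far_weight \<alpha> \<delta> t / total_weight \<alpha> t) \<le> scaled_survival \<alpha> a t"
proof -
  let ?s = "sqrt (2 / (pi * t))" and ?L = "total_weight \<alpha> t" and ?H = "reflected_mass \<alpha> a t (\<alpha> - \<rho> - \<delta>)"
  have s: "0 < ?s" using assms by simp
  have L: "0 < ?L" using assms by (intro total_weight_pos)
  have H: "0 \<le> ?H" using assms by (intro reflected_mass_nonneg) auto
  have \<alpha>: "0 < \<alpha>" using assms by simp
  have "?s * ?H * (?L - far_weight \<alpha> \<delta> t) = (\<integral>x. ?s * ?H * (gauss_weight \<alpha> t x - indicator (far \<alpha> \<delta> t) x * chernoff_weight \<alpha> t x) \<partial>\<mu>)"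
    unfolding far_weight_def total_weight_def
    using integrable_weights[OF assms(5)] by (subst integral_mult_right_zero, subst Bochner_Integration.integral_diff) auto
  also have "\<dots> \<le> (\<integral>x. killed_tail \<alpha> a t x \<partial>\<mu>)"
  proof (rule integral_mono_AE)
    show "integrable \<mu> (\<lambda>x. ?s * ?H * (gauss_weight \<alpha> t x - indicator (far \<alpha> \<delta> t) x * chernoff_weight \<alpha> t x))"
      using integrable_weights[OF assms(5)] by (intro Bochner_Integration.integrable_diff integrable_mult_right) auto
    show "AE x in \<mu>. ?s * ?H * (gauss_weight \<alpha> t x - indicator (far \<alpha> \<delta> t) x * chernoff_weight \<alpha> t x) \<le> killed_tail \<alpha> a t x"
      using nonneg
    proof eventually_elim
      case (elim x)
      have g: "0 < gauss_weight \<alpha> t x" by (rule gauss_weight_pos)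
      have killed: "killed_tail \<alpha> a t x = ?s * gauss_weight \<alpha> t x * reflected_mass \<alpha> a t (x / t)"
        unfolding killed_tail_eq_reflected_mass[OF assms(5)] gauss_weight_def ..
      show ?case
      proof (cases "x \<in> far \<alpha> \<delta> t")
        case True
        have "?s * ?H * (gauss_weight \<alpha> t x - indicator (far \<alpha> \<delta> t) x * chernoff_weight \<alpha> t x) \<le> 0"
          using True s H gauss_weight_le_chernoff[OF assms(5), of \<alpha> x] by (intro mult_nonneg_nonpos) auto
        also have "0 \<le> killed_tail \<alpha> a t x"
          unfolding killed using s g elim assms by (intro mult_nonneg_nonneg reflected_mass_nonneg) auto
        finally show ?thesis .
      next
        case False
        note near = near_bounds[OF False assms(5)]
        have "?H \<le> reflected_mass \<alpha> a t (x / t)"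
          using near assms by (intro reflected_mass_mono) auto
        then have "?s * gauss_weight \<alpha> t x * ?H \<le> killed_tail \<alpha> a t x"
          unfolding killed using s g by (intro mult_left_mono) auto
        then show ?thesis using False by (simp add: mult_ac)
      qed
    qed
  qed (use \<alpha> assms in \<open>intro integrable_killed_tail, auto\<close>)
  finally have le: "?s * ?H * (?L - far_weight \<alpha> \<delta> t) / (?s * ?L) \<le> scaled_survival \<alpha> a t"
    unfolding scaled_survival_def using s L by (intro divide_right_mono) auto
  have divide_split: "s * H * (L - f) / (s * L) = H * (1 - f / L)" if "0 < s" "0 < L" for s H L f :: real
    using that by (simp add: field_simps)
  have "?s * ?H * (?L - far_weight \<alpha> \<delta> t) / (?s * ?L) = ?H * (1 - far_weight \<alpha> \<delta> t / ?L)"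
    using divide_split[OF s L] .
  with le show ?thesis by simp
qed

text \<open>Both bounds tend, as \<open>t\<close> grows, to \<open>limit_mass\<close> at a point within
  \<open>\<delta>\<close> of \<open>\<alpha> - \<rho>\<close>; continuity of
  \<open>limit_mass\<close> in \<open>z\<close> allows \<open>\<delta>\<close> to be taken
  small.\<close>
lemma scaled_survival_tendsto:
  assumes "\<rho> < \<alpha>" "0 \<le> a"
  shows "(scaled_survival \<alpha> a \<longlongrightarrow> limit_mass \<alpha> a (\<alpha> - \<rho>)) at_top"
proof -
  define \<gamma> where "\<gamma> = \<alpha> - \<rho>"
  have \<gamma>: "0 < \<gamma>" "\<bar>\<gamma>\<bar> < \<alpha>" using assms rate_pos by (auto simp: \<gamma>_def)
  have m: "0 < min \<rho> \<gamma>" using \<gamma> rate_pos by simp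
  have small: "\<forall>\<^sub>F \<delta> in at_right 0. 0 < \<delta> \<and> \<delta> < \<rho> \<and> \<delta> < \<gamma>"
    using eventually_at_right_real[OF m] by (rule eventually_mono) auto
  have near: "((\<lambda>\<delta>. limit_mass \<alpha> a (\<gamma> + c * \<delta>)) \<longlongrightarrow> limit_mass \<alpha> a \<gamma>) (at_right 0)" for c
  proof -
    have "((\<lambda>\<delta>. \<gamma> + c * \<delta>) \<longlongrightarrow> \<gamma> + c * 0) (at_right 0)" by (intro tendsto_intros)
    then have "((\<lambda>\<delta>. \<gamma> + c * \<delta>) \<longlongrightarrow> \<gamma>) (at_right 0)" by simp
    then show ?thesis by (rule isCont_tendsto_compose[OF isCont_limit_mass[OF \<gamma>(2)]])
  qed
  show ?thesis
  proof (rule order_tendstoI)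
    fix u assume u: "limit_mass \<alpha> a (\<alpha> - \<rho>) < u"
    have "\<forall>\<^sub>F \<delta> in at_right 0. limit_mass \<alpha> a (\<gamma> + \<delta>) < u"
      using order_tendstoD(2)[OF near[of 1] u[folded \<gamma>_def]] by simp
    with small have "\<forall>\<^sub>F \<delta> in at_right (0::real). 0 < \<delta> \<and> \<delta> < \<rho> \<and> \<delta> < \<gamma> \<and> limit_mass \<alpha> a (\<gamma> + \<delta>) < u"
      by eventually_elim auto
    then obtain \<delta> where \<delta>: "0 < \<delta>" "\<delta> < \<rho>" "\<delta> < \<gamma>" "limit_mass \<alpha> a (\<gamma> + \<delta>) < u"
      using eventually_happens[of _ "at_right (0::real)"] by auto
    have "((\<lambda>t. limit_mass \<alpha> a (\<gamma> + \<delta>) + sqrt (pi / 2) * (sqrt t * (far_weight \<alpha> \<delta> t / total_weight \<alpha> t)))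
        \<longlongrightarrow> limit_mass \<alpha> a (\<gamma> + \<delta>) + sqrt (pi / 2) * 0) at_top"
      using \<delta> by (intro tendsto_intros far_weight_negligible) (auto simp: \<gamma>_def)
    then have "\<forall>\<^sub>F t in at_top. limit_mass \<alpha> a (\<gamma> + \<delta>) + sqrt (pi / 2) * (sqrt t * (far_weight \<alpha> \<delta> t / total_weight \<alpha> t)) < u"
      using \<delta> by (intro order_tendstoD(2)) auto
    then show "\<forall>\<^sub>F t in at_top. scaled_survival \<alpha> a t < u"
      using eventually_gt_at_top[of 0]
    proof eventually_elim
      case (elim t)
      then show ?case
        using scaled_survival_upper[of a \<delta> \<alpha> t] \<delta> assms by (simp add: \<gamma>_def)
    qed
  next
    fix u assume u: "u < limit_mass \<alpha> a (\<alpha> - \<rho>)"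
    have "\<forall>\<^sub>F \<delta> in at_right 0. u < limit_mass \<alpha> a (\<gamma> - \<delta>)"
      using order_tendstoD(1)[OF near[of "- 1"] u[folded \<gamma>_def]] by simp
    with small have "\<forall>\<^sub>F \<delta> in at_right (0::real). 0 < \<delta> \<and> \<delta> < \<rho> \<and> \<delta> < \<gamma> \<and> u < limit_mass \<alpha> a (\<gamma> - \<delta>)"
      by eventually_elim auto
    then obtain \<delta> where \<delta>: "0 < \<delta>" "\<delta> < \<rho>" "\<delta> < \<gamma>" "u < limit_mass \<alpha> a (\<gamma> - \<delta>)"
      using eventually_happens[of _ "at_right (0::real)"] by auto
    have "((\<lambda>t. reflected_mass \<alpha> a t (\<gamma> - \<delta>) * (1 - far_weight \<alpha> \<delta> t / total_weight \<alpha> t))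
        \<longlongrightarrow> limit_mass \<alpha> a (\<gamma> - \<delta>) * (1 - 0)) at_top"
      using \<delta> \<gamma> assms by (intro tendsto_intros far_ratio_tendsto_0 reflected_mass_tendsto) (auto simp: \<gamma>_def)
    then have "\<forall>\<^sub>F t in at_top. u < reflected_mass \<alpha> a t (\<gamma> - \<delta>) * (1 - far_weight \<alpha> \<delta> t / total_weight \<alpha> t)"
      using \<delta> by (intro order_tendstoD(1)) auto
    then show "\<forall>\<^sub>F t in at_top. u < scaled_survival \<alpha> a t"
      using eventually_gt_at_top[of 0]
    proof eventually_elim
      case (elim t)
      then show ?case
        using scaled_survival_lower[of a \<delta> \<alpha> t] \<delta> assms by (simp add: \<gamma>_def)
    qed
  qed
qed

lemma tilted_law_tendsto:
  assumes "\<rho> < \<alpha>"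
  shows "weak_conv_m_along (tilted_law \<alpha> \<mu>) (return borel (\<alpha> - \<rho>)) at_top"
  unfolding weak_conv_m_along_def
proof (intro allI impI)
  fix z assume z: "isCont (cdf (return borel (\<alpha> - \<rho>))) z"
  interpret R: real_distribution "return borel (\<alpha> - \<rho>)"
    by (intro real_distribution.intro prob_space_return real_distribution_axioms.intro) auto
  have "z \<noteq> \<alpha> - \<rho>" using z by (auto simp: R.isCont_cdf measure_return)
  then have "((\<lambda>t. tilted_cdf \<alpha> \<mu> t z) \<longlongrightarrow> of_bool (\<alpha> - \<rho> \<le> z)) at_top"
    by (rule tilted_cdf_concentrates[OF assms])
  moreover have "of_bool (\<alpha> - \<rho> \<le> z) = cdf (return borel (\<alpha> - \<rho>)) z"
    by (simp add: cdf_def measure_return)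
  moreover have "\<forall>\<^sub>F t in at_top. tilted_cdf \<alpha> \<mu> t z = cdf (tilted_law \<alpha> \<mu> t) z"
    using eventually_gt_at_top[of 0]
    by eventually_elim (simp add: cdf_tilted_law[OF real_distribution_axioms nonneg])
  ultimately show "((\<lambda>t. cdf (tilted_law \<alpha> \<mu> t) z) \<longlongrightarrow> cdf (return borel (\<alpha> - \<rho>)) z) at_top"
    by (simp add: Lim_transform_eventually)
qed

lemma conditional_law_tendsto:
  assumes "\<rho> < \<alpha>" and brown: "brownian_with_initial_law \<mu> M X0 B"
  shows "weak_conv_m_along (conditional_law \<alpha> M X0 B) (qsd \<alpha> (\<alpha> - \<rho>)) at_top"
  unfolding weak_conv_m_along_def
proof (intro allI impI)
  fix y
  have \<gamma>: "0 < \<alpha> - \<rho>" "\<alpha> - \<rho> < \<alpha>" and \<alpha>: "0 < \<alpha>" using assms rate_pos by auto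
  note lim = scaled_survival_tendsto[OF assms(1)]
  have pos: "0 < limit_mass \<alpha> 0 (\<alpha> - \<rho>)" by (rule limit_mass_pos[OF \<gamma>])
  have "((\<lambda>t. 1 - scaled_survival \<alpha> (max 0 y) t / scaled_survival \<alpha> 0 t)
      \<longlongrightarrow> 1 - limit_mass \<alpha> (max 0 y) (\<alpha> - \<rho>) / limit_mass \<alpha> 0 (\<alpha> - \<rho>)) at_top"
    by (intro tendsto_intros lim) (use pos in auto)
  then have "((\<lambda>t. 1 - scaled_survival \<alpha> (max 0 y) t / scaled_survival \<alpha> 0 t) \<longlongrightarrow> cdf (qsd \<alpha> (\<alpha> - \<rho>)) y) at_top"
    unfolding cdf_qsd[OF \<gamma>] .
  moreover have "\<forall>\<^sub>F t in at_top. 1 - scaled_survival \<alpha> (max 0 y) t / scaled_survival \<alpha> 0 t = cdf (conditional_law \<alpha> M X0 B t) y"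
    using order_tendstoD(1)[OF lim[OF order_refl] pos] eventually_gt_at_top[of 0]
  proof eventually_elim
    case (elim t)
    have d: "0 < sqrt (2 / (pi * t)) * total_weight \<alpha> t" using elim total_weight_pos[of t \<alpha>] by simp
    then have "0 < (\<integral>x. killed_tail \<alpha> 0 t x \<partial>\<mu>)"
      using elim(1) unfolding scaled_survival_def by (simp add: zero_less_divide_iff)
    from cdf_conditional_law[OF brown nonneg \<alpha> elim(2) this, of y] show ?case
      using d unfolding scaled_survival_def by (subst divide_divide_eq_right) auto
  qed
  ultimately show "((\<lambda>t. cdf (conditional_law \<alpha> M X0 B t) y) \<longlongrightarrow> cdf (qsd \<alpha> (\<alpha> - \<rho>)) y) at_top"
    by (rule Lim_transform_eventually)
qed

end

theorem theorem4:
  fixes \<alpha> \<rho> :: real and \<mu> :: "real measure"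
  assumes "0 < \<alpha>"
    and "real_distribution \<mu>" and "AE x in \<mu>. 0 \<le> x"
    and "((\<lambda>x. - ln (measure \<mu> {x..}) / x) \<longlongrightarrow> \<rho>) at_top"
    and "0 < \<rho>" and "\<rho> < \<alpha>"
  shows "weak_conv_m_along (tilted_law \<alpha> \<mu>) (return borel (\<alpha> - \<rho>)) at_top \<and>
    (\<forall>(M :: 'a measure) X0 B. brownian_with_initial_law \<mu> M X0 B \<longrightarrow>
       weak_conv_m_along (conditional_law \<alpha> M X0 B) (qsd \<alpha> (\<alpha> - \<rho>)) at_top)"
proof -
  interpret exponential_tail \<mu> \<rho>
    by (intro exponential_tail.intro exponential_tail_axioms.intro assms)
  show ?thesis using tilted_law_tendsto conditional_law_tendsto assms(6) by blast
qed

end
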